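(* Let $\mathcal F:\mathcal T\to\mathcal H$ be a quasitensor $^*$-functor (with isometries $S_{\rho,\sigma}$) and let $\rho$ be an object of $\mathcal T$ with a conjugate $\overline\rho$ defined by $R\in(\iota,\overline\rho\otimes\rho)$ and $\overline R\in(\iota,\rho\otimes\overline\rho)$. Let $\hat R:=S^*_{\overline\rho,\rho}\circ\mathcal F(R)$, $\hat{\overline R}:=S^*_{\rho,\overline\rho}\circ\mathcal F(\overline R)$, and put $d_{R,\overline R}(\rho)=\|R\|\,\|\overline R\|$, $d_{\hat R,\hat{\overline R}}(\mathcal F(\rho))=\|\hat R\|\,\|\hat{\overline R}\|$. Then $$\dim(\mathcal F(\rho))\le d_{\hat R,\hat{\overline R}}(\mathcal F(\rho))\le d_{R,\overline R}(\rho).$$ Furthermore $d_{\hat R,\hat{\overline R}}(\mathcal F(\rho))=d_{R,\overline R}(\rho)$ if and only if $\mathcal F(R)\in\mathrm{Image}\,S_{\overline\rho,\rho}$ and $\mathcal F(\overline R)\in\mathrm{Image}\,S_{\rho,\overline\rho}$.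
   Context: $\mathcal T$ is a strict tensor $C^*$-category with $(\iota,\iota)=\mathbb C$; $\mathcal H$ is the strict tensor $C^*$-category of Hilbert spaces and bounded linear maps. A map $\mathbb C\to H$ is identified with the image vector of $1$. Quasitensor: a covariant $^*$-functor $\mathcal F:\mathcal T\to\mathcal H$ is quasitensor if $\mathcal F(\iota)=\mathbb C$ and there are isometries $S_{\rho,\sigma}:\mathcal F(\rho)\otimes\mathcal F(\sigma)\to\mathcal F(\rho\otimes\sigma)$ with: $S_{\rho,\iota}=S_{\iota,\rho}=1_{\mathcal F(\rho)}$; $S_{\rho\otimes\sigma,\tau}\circ(S_{\rho,\sigma}\otimes1_{\mathcal F(\tau)})=S_{\rho,\sigma\otimes\tau}\circ(1_{\mathcal F(\rho)}\otimes S_{\sigma,\tau})=:S_{\rho,\sigma,\tau}$; $E_{\rho\otimes\sigma,\tau}\circ E_{\rho,\sigma\otimes\tau}\le E_{\rho,\sigma,\tau}$, where $E_{\rho,\sigma}$, $E_{\rho,\sigma,\tau}$ are the range projections of $S_{\rho,\sigma}$, $S_{\rho,\sigma,\tau}$; $\mathcal F(S\otimes T)\circ S_{\rho,\sigma}=S_{\rho',\sigma'}\circ(\mathcal F(S)\otimes\mathcal F(T))$ for $S\in(\rho,\rho')$, $T\in(\sigma,\sigma')$. A conjugate defined by $R,\overline R$ means: $(\overline R^*\otimes1_\rho)\circ(1_\rho\otimes R)=1_\rho$ and $(R^*\otimes1_{\overline\rho})\circ(1_{\overline\rho}\otimes\overline R)=1_{\overline\rho}$. *)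

theory Defs
  imports "HOL-Analysis.Analysis"
begin

section \<open>Complex vector, Banach and Hilbert spaces on carrier sets\<close>

text \<open>A functor assigns a different Hilbert space to every object, so spaces are given by carrier
  sets with explicit operations rather than by type classes.\<close>

locale cvector_space_on =
  fixes V :: "'a set" and add :: "'a \<Rightarrow> 'a \<Rightarrow> 'a" and zero :: 'a and scale :: "complex \<Rightarrow> 'a \<Rightarrow> 'a"
  assumes zero_closed: "zero \<in> V"
    and add_closed: "\<lbrakk>x \<in> V; y \<in> V\<rbrakk> \<Longrightarrow> add x y \<in> V"
    and scale_closed: "x \<in> V \<Longrightarrow> scale c x \<in> V"
    and add_assoc: "\<lbrakk>x \<in> V; y \<in> V; z \<in> V\<rbrakk> \<Longrightarrow> add (add x y) z = add x (add y z)"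
    and add_commute: "\<lbrakk>x \<in> V; y \<in> V\<rbrakk> \<Longrightarrow> add x y = add y x"
    and add_zero: "x \<in> V \<Longrightarrow> add zero x = x"
    and add_neg: "x \<in> V \<Longrightarrow> add x (scale (- 1) x) = zero"
    and scale_add_right: "\<lbrakk>x \<in> V; y \<in> V\<rbrakk> \<Longrightarrow> scale c (add x y) = add (scale c x) (scale c y)"
    and scale_add_left: "x \<in> V \<Longrightarrow> scale (c + d) x = add (scale c x) (scale d x)"
    and scale_scale: "x \<in> V \<Longrightarrow> scale c (scale d x) = scale (c * d) x"
    and scale_one: "x \<in> V \<Longrightarrow> scale 1 x = x"

locale cbanach_space_on = cvector_space_on +
  fixes nrm :: "'a \<Rightarrow> real"
  assumes nrm_nonneg: "x \<in> V \<Longrightarrow> 0 \<le> nrm x"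
    and nrm_eq_0: "x \<in> V \<Longrightarrow> nrm x = 0 \<longleftrightarrow> x = zero"
    and nrm_triangle: "\<lbrakk>x \<in> V; y \<in> V\<rbrakk> \<Longrightarrow> nrm (add x y) \<le> nrm x + nrm y"
    and nrm_scale: "x \<in> V \<Longrightarrow> nrm (scale c x) = cmod c * nrm x"
    and complete: "Metric_space.mcomplete V (\<lambda>x y. nrm (add x (scale (- 1) y)))"

record 'a hilb =
  hcarrier :: "'a set"
  hadd :: "'a \<Rightarrow> 'a \<Rightarrow> 'a"
  hzero :: 'a
  hscale :: "complex \<Rightarrow> 'a \<Rightarrow> 'a"
  hinner :: "'a \<Rightarrow> 'a \<Rightarrow> complex"

definition hnorm :: "'a hilb \<Rightarrow> 'a \<Rightarrow> real" where
  "hnorm H x = sqrt (Re (hinner H x x))"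

text \<open>Inner products are linear in the second argument.\<close>

locale hilbert_space =
  cvector_space_on "hcarrier H" "hadd H" "hzero H" "hscale H" for H :: "'a hilb" +
  assumes inner_cnj: "\<lbrakk>x \<in> hcarrier H; y \<in> hcarrier H\<rbrakk> \<Longrightarrow> hinner H x y = cnj (hinner H y x)"
    and inner_add: "\<lbrakk>x \<in> hcarrier H; y \<in> hcarrier H; z \<in> hcarrier H\<rbrakk>
      \<Longrightarrow> hinner H x (hadd H y z) = hinner H x y + hinner H x z"
    and inner_scale: "\<lbrakk>x \<in> hcarrier H; y \<in> hcarrier H\<rbrakk>
      \<Longrightarrow> hinner H x (hscale H c y) = c * hinner H x y"
    and inner_nonneg: "x \<in> hcarrier H \<Longrightarrow> 0 \<le> Re (hinner H x x)"
    and inner_eq_0: "\<lbrakk>x \<in> hcarrier H; hinner H x x = 0\<rbrakk> \<Longrightarrow> x = hzero H"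
    and complete: "Metric_space.mcomplete (hcarrier H)
      (\<lambda>x y. hnorm H (hadd H x (hscale H (- 1) y)))"

definition is_onb :: "'a hilb \<Rightarrow> 'a set \<Rightarrow> bool" where
  "is_onb H B \<longleftrightarrow> B \<subseteq> hcarrier H
     \<and> (\<forall>e\<in>B. \<forall>f\<in>B. hinner H e f = (if e = f then 1 else 0))
     \<and> (\<forall>x\<in>hcarrier H. (\<forall>e\<in>B. hinner H e x = 0) \<longrightarrow> x = hzero H)"

definition onb :: "'a hilb \<Rightarrow> 'a set" where
  "onb H = (SOME B. is_onb H B)"

definition hdim :: "'a hilb \<Rightarrow> enat" where
  "hdim H = (if finite (onb H) then enat (card (onb H)) else \<infinity>)"


section \<open>Bounded operators\<close>

text \<open>Operators are only relevant on the carrier of their domain; their values elsewhere are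
  arbitrary.\<close>

definition hmaps :: "'a hilb \<Rightarrow> 'b hilb \<Rightarrow> ('a \<Rightarrow> 'b) set" where
  "hmaps H K = {A. (\<forall>x\<in>hcarrier H. A x \<in> hcarrier K)
     \<and> (\<forall>x\<in>hcarrier H. \<forall>y\<in>hcarrier H. A (hadd H x y) = hadd K (A x) (A y))
     \<and> (\<forall>c. \<forall>x\<in>hcarrier H. A (hscale H c x) = hscale K c (A x))
     \<and> (\<exists>C. \<forall>x\<in>hcarrier H. hnorm K (A x) \<le> C * hnorm H x)}"

definition isometries :: "'a hilb \<Rightarrow> 'b hilb \<Rightarrow> ('a \<Rightarrow> 'b) set" where
  "isometries H K = {A \<in> hmaps H K. \<forall>x\<in>hcarrier H. hnorm K (A x) = hnorm H x}"

definition adj :: "'a hilb \<Rightarrow> 'b hilb \<Rightarrow> ('a \<Rightarrow> 'b) \<Rightarrow> 'b \<Rightarrow> 'a" where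
  "adj H K A y = (THE x. x \<in> hcarrier H
     \<and> (\<forall>x'\<in>hcarrier H. hinner H x x' = hinner K y (A x')))"

text \<open>The orthogonal projection of \<open>K\<close> onto the range of \<open>A\<close>, which has to be closed (it is used
  for isometries).\<close>

definition range_proj :: "'a hilb \<Rightarrow> 'b hilb \<Rightarrow> ('a \<Rightarrow> 'b) \<Rightarrow> 'b \<Rightarrow> 'b" where
  "range_proj H K A y = (THE p. p \<in> A ` hcarrier H
     \<and> (\<forall>m\<in>A ` hcarrier H. hinner K m (hadd K y (hscale K (- 1) p)) = 0))"

definition op_le :: "'a hilb \<Rightarrow> ('a \<Rightarrow> 'a) \<Rightarrow> ('a \<Rightarrow> 'a) \<Rightarrow> bool" where
  "op_le K A B \<longleftrightarrow> (\<forall>x\<in>hcarrier K. hinner K x (B x) - hinner K x (A x) \<in> \<real>\<^sub>\<ge>\<^sub>0)"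


section \<open>Tensor products of Hilbert spaces\<close>

text \<open>\<open>H \<otimes> K\<close> is realised as in Kadison--Ringrose by the Hilbert--Schmidt functionals, i.e. the
  bounded scalar functions \<open>\<phi>\<close> on \<open>H \<times> K\<close>, conjugate linear in both variables, such that
  \<open>\<Sum>\<bar>\<phi> e f\<bar>\<^sup>2\<close> converges over a pair of orthonormal bases. The simple tensor \<open>x \<otimes> y\<close> is the
  functional \<open>(u, v) \<mapsto> \<langle>u, x\<rangle>\<langle>v, y\<rangle>\<close>; thus \<open>\<phi> u v = \<langle>u \<otimes> v, \<phi>\<rangle>\<close>. The space and its inner
  product do not depend on the orthonormal bases. Functionals are extended by 0 outside the
  carriers, so that they are determined by their values on them.\<close>

definition hs_functionals :: "'a hilb \<Rightarrow> 'b hilb \<Rightarrow> ('a \<Rightarrow> 'b \<Rightarrow> complex) set" where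
  "hs_functionals H K = {\<phi>.
     (\<forall>u v. u \<notin> hcarrier H \<or> v \<notin> hcarrier K \<longrightarrow> \<phi> u v = 0)
     \<and> (\<forall>u\<in>hcarrier H. \<forall>u'\<in>hcarrier H. \<forall>v\<in>hcarrier K. \<phi> (hadd H u u') v = \<phi> u v + \<phi> u' v)
     \<and> (\<forall>u\<in>hcarrier H. \<forall>v\<in>hcarrier K. \<forall>v'\<in>hcarrier K. \<phi> u (hadd K v v') = \<phi> u v + \<phi> u v')
     \<and> (\<forall>c. \<forall>u\<in>hcarrier H. \<forall>v\<in>hcarrier K. \<phi> (hscale H c u) v = cnj c * \<phi> u v)
     \<and> (\<forall>c. \<forall>u\<in>hcarrier H. \<forall>v\<in>hcarrier K. \<phi> u (hscale K c v) = cnj c * \<phi> u v)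
     \<and> (\<exists>C. \<forall>u\<in>hcarrier H. \<forall>v\<in>hcarrier K. cmod (\<phi> u v) \<le> C * hnorm H u * hnorm K v)
     \<and> (\<lambda>(e, f). (cmod (\<phi> e f))\<^sup>2) summable_on (onb H \<times> onb K)}"

definition htensor :: "'a hilb \<Rightarrow> 'b hilb \<Rightarrow> ('a \<Rightarrow> 'b \<Rightarrow> complex) hilb"  (infixr "\<otimes>\<^sub>H" 70) where
  "H \<otimes>\<^sub>H K = \<lparr>
     hcarrier = hs_functionals H K,
     hadd = (\<lambda>\<phi> \<psi> u v. \<phi> u v + \<psi> u v),
     hzero = (\<lambda>u v. 0),
     hscale = (\<lambda>c \<phi> u v. c * \<phi> u v),
     hinner = (\<lambda>\<phi> \<psi>. \<Sum>\<^sub>\<infinity>(e, f)\<in>onb H \<times> onb K. cnj (\<phi> e f) * \<psi> e f)\<rparr>"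

definition vtensor :: "'a hilb \<Rightarrow> 'b hilb \<Rightarrow> 'a \<Rightarrow> 'b \<Rightarrow> 'a \<Rightarrow> 'b \<Rightarrow> complex" where
  "vtensor H K x y = (\<lambda>u v. if u \<in> hcarrier H \<and> v \<in> hcarrier K
     then hinner H u x * hinner K v y else 0)"

text \<open>For \<open>A : H \<rightarrow> H'\<close> and \<open>B : K \<rightarrow> K'\<close>, the operator \<open>A \<otimes> B\<close> satisfies
  \<open>((A \<otimes> B) \<phi>) u v = \<langle>u \<otimes> v, (A \<otimes> B) \<phi>\<rangle> = \<langle>A\<^sup>* u \<otimes> B\<^sup>* v, \<phi>\<rangle> = \<phi> (A\<^sup>* u) (B\<^sup>* v)\<close>; it maps
  \<open>x \<otimes> y\<close> to \<open>A x \<otimes> B y\<close>.\<close>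

definition op_tensor :: "'a hilb \<Rightarrow> 'c hilb \<Rightarrow> 'b hilb \<Rightarrow> 'd hilb \<Rightarrow> ('a \<Rightarrow> 'c) \<Rightarrow> ('b \<Rightarrow> 'd)
    \<Rightarrow> ('a \<Rightarrow> 'b \<Rightarrow> complex) \<Rightarrow> 'c \<Rightarrow> 'd \<Rightarrow> complex" where
  "op_tensor H H' K K' A B \<phi> = (\<lambda>u v. if u \<in> hcarrier H' \<and> v \<in> hcarrier K'
     then \<phi> (adj H H' A u) (adj K K' B v) else 0)"


section \<open>Strict tensor C*-categories\<close>

record ('o, 'm) tensor_cat =
  Ob :: "'o set"
  Hom :: "'o \<Rightarrow> 'o \<Rightarrow> 'm set"
  Id :: "'o \<Rightarrow> 'm"
  Comp :: "'m \<Rightarrow> 'm \<Rightarrow> 'm"  (infixr "\<odot>\<index>" 70)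
  Add :: "'m \<Rightarrow> 'm \<Rightarrow> 'm"
  Zero :: "'o \<Rightarrow> 'o \<Rightarrow> 'm"
  Scale :: "complex \<Rightarrow> 'm \<Rightarrow> 'm"
  Norm :: "'m \<Rightarrow> real"
  Star :: "'m \<Rightarrow> 'm"
  Unit :: 'o
  TOb :: "'o \<Rightarrow> 'o \<Rightarrow> 'o"  (infixr "\<boxtimes>\<index>" 75)
  TAr :: "'m \<Rightarrow> 'm \<Rightarrow> 'm"  (infixr "\<otimes>\<index>" 75)

locale cstar_category =
  fixes T :: "('o, 'm) tensor_cat" (structure)
  assumes hom_disjoint: "\<lbrakk>\<rho> \<in> Ob T; \<sigma> \<in> Ob T; \<rho>' \<in> Ob T; \<sigma>' \<in> Ob T;
      x \<in> Hom T \<rho> \<sigma>; x \<in> Hom T \<rho>' \<sigma>'\<rbrakk> \<Longrightarrow> \<rho> = \<rho>' \<and> \<sigma> = \<sigma>'"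
    and id_closed: "\<rho> \<in> Ob T \<Longrightarrow> Id T \<rho> \<in> Hom T \<rho> \<rho>"
    and comp_closed: "\<lbrakk>\<rho> \<in> Ob T; \<sigma> \<in> Ob T; \<tau> \<in> Ob T; x \<in> Hom T \<rho> \<sigma>; y \<in> Hom T \<sigma> \<tau>\<rbrakk>
      \<Longrightarrow> y \<odot> x \<in> Hom T \<rho> \<tau>"
    and comp_assoc: "\<lbrakk>\<rho> \<in> Ob T; \<sigma> \<in> Ob T; \<tau> \<in> Ob T; \<upsilon> \<in> Ob T;
      x \<in> Hom T \<rho> \<sigma>; y \<in> Hom T \<sigma> \<tau>; z \<in> Hom T \<tau> \<upsilon>\<rbrakk> \<Longrightarrow> (z \<odot> y) \<odot> x = z \<odot> (y \<odot> x)"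
    and comp_id_left: "\<lbrakk>\<rho> \<in> Ob T; \<sigma> \<in> Ob T; x \<in> Hom T \<rho> \<sigma>\<rbrakk> \<Longrightarrow> Id T \<sigma> \<odot> x = x"
    and comp_id_right: "\<lbrakk>\<rho> \<in> Ob T; \<sigma> \<in> Ob T; x \<in> Hom T \<rho> \<sigma>\<rbrakk> \<Longrightarrow> x \<odot> Id T \<rho> = x"
    and hom_banach: "\<lbrakk>\<rho> \<in> Ob T; \<sigma> \<in> Ob T\<rbrakk>
      \<Longrightarrow> cbanach_space_on (Hom T \<rho> \<sigma>) (Add T) (Zero T \<rho> \<sigma>) (Scale T) (Norm T)"
    and comp_add_left: "\<lbrakk>\<rho> \<in> Ob T; \<sigma> \<in> Ob T; \<tau> \<in> Ob T;
      x \<in> Hom T \<rho> \<sigma>; y \<in> Hom T \<sigma> \<tau>; z \<in> Hom T \<sigma> \<tau>\<rbrakk>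
      \<Longrightarrow> Add T y z \<odot> x = Add T (y \<odot> x) (z \<odot> x)"
    and comp_add_right: "\<lbrakk>\<rho> \<in> Ob T; \<sigma> \<in> Ob T; \<tau> \<in> Ob T;
      x \<in> Hom T \<rho> \<sigma>; y \<in> Hom T \<rho> \<sigma>; z \<in> Hom T \<sigma> \<tau>\<rbrakk>
      \<Longrightarrow> z \<odot> Add T x y = Add T (z \<odot> x) (z \<odot> y)"
    and comp_scale: "\<lbrakk>\<rho> \<in> Ob T; \<sigma> \<in> Ob T; \<tau> \<in> Ob T; x \<in> Hom T \<rho> \<sigma>; y \<in> Hom T \<sigma> \<tau>\<rbrakk>
      \<Longrightarrow> Scale T c y \<odot> x = Scale T c (y \<odot> x) \<and> y \<odot> Scale T c x = Scale T c (y \<odot> x)"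
    and norm_comp: "\<lbrakk>\<rho> \<in> Ob T; \<sigma> \<in> Ob T; \<tau> \<in> Ob T; x \<in> Hom T \<rho> \<sigma>; y \<in> Hom T \<sigma> \<tau>\<rbrakk>
      \<Longrightarrow> Norm T (y \<odot> x) \<le> Norm T y * Norm T x"
    and star_closed: "\<lbrakk>\<rho> \<in> Ob T; \<sigma> \<in> Ob T; x \<in> Hom T \<rho> \<sigma>\<rbrakk> \<Longrightarrow> Star T x \<in> Hom T \<sigma> \<rho>"
    and star_star: "\<lbrakk>\<rho> \<in> Ob T; \<sigma> \<in> Ob T; x \<in> Hom T \<rho> \<sigma>\<rbrakk> \<Longrightarrow> Star T (Star T x) = x"
    and star_add: "\<lbrakk>\<rho> \<in> Ob T; \<sigma> \<in> Ob T; x \<in> Hom T \<rho> \<sigma>; y \<in> Hom T \<rho> \<sigma>\<rbrakk>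
      \<Longrightarrow> Star T (Add T x y) = Add T (Star T x) (Star T y)"
    and star_scale: "\<lbrakk>\<rho> \<in> Ob T; \<sigma> \<in> Ob T; x \<in> Hom T \<rho> \<sigma>\<rbrakk>
      \<Longrightarrow> Star T (Scale T c x) = Scale T (cnj c) (Star T x)"
    and star_comp: "\<lbrakk>\<rho> \<in> Ob T; \<sigma> \<in> Ob T; \<tau> \<in> Ob T; x \<in> Hom T \<rho> \<sigma>; y \<in> Hom T \<sigma> \<tau>\<rbrakk>
      \<Longrightarrow> Star T (y \<odot> x) = Star T x \<odot> Star T y"
    and cstar: "\<lbrakk>\<rho> \<in> Ob T; \<sigma> \<in> Ob T; x \<in> Hom T \<rho> \<sigma>\<rbrakk>
      \<Longrightarrow> Norm T (Star T x \<odot> x) = (Norm T x)\<^sup>2"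
    \<comment> \<open>\<open>x\<^sup>*x\<close> is a positive element of the C*-algebra \<open>(\<rho>,\<rho>)\<close>\<close>
    and star_positive: "\<lbrakk>\<rho> \<in> Ob T; \<sigma> \<in> Ob T; x \<in> Hom T \<rho> \<sigma>\<rbrakk>
      \<Longrightarrow> \<exists>y\<in>Hom T \<rho> \<rho>. Star T x \<odot> x = Star T y \<odot> y"

locale strict_tensor_cstar_category = cstar_category +
  assumes unit_closed: "Unit T \<in> Ob T"
    and tob_closed: "\<lbrakk>\<rho> \<in> Ob T; \<sigma> \<in> Ob T\<rbrakk> \<Longrightarrow> \<rho> \<boxtimes> \<sigma> \<in> Ob T"
    and tob_assoc: "\<lbrakk>\<rho> \<in> Ob T; \<sigma> \<in> Ob T; \<tau> \<in> Ob T\<rbrakk> \<Longrightarrow> (\<rho> \<boxtimes> \<sigma>) \<boxtimes> \<tau> = \<rho> \<boxtimes> (\<sigma> \<boxtimes> \<tau>)"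
    and tob_unit: "\<rho> \<in> Ob T \<Longrightarrow> Unit T \<boxtimes> \<rho> = \<rho> \<and> \<rho> \<boxtimes> Unit T = \<rho>"
    and tar_closed: "\<lbrakk>\<rho> \<in> Ob T; \<rho>' \<in> Ob T; \<sigma> \<in> Ob T; \<sigma>' \<in> Ob T; x \<in> Hom T \<rho> \<rho>'; y \<in> Hom T \<sigma> \<sigma>'\<rbrakk>
      \<Longrightarrow> x \<otimes> y \<in> Hom T (\<rho> \<boxtimes> \<sigma>) (\<rho>' \<boxtimes> \<sigma>')"
    and tar_assoc: "\<lbrakk>\<rho> \<in> Ob T; \<rho>' \<in> Ob T; \<sigma> \<in> Ob T; \<sigma>' \<in> Ob T; \<tau> \<in> Ob T; \<tau>' \<in> Ob T;
      x \<in> Hom T \<rho> \<rho>'; y \<in> Hom T \<sigma> \<sigma>'; z \<in> Hom T \<tau> \<tau>'\<rbrakk>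
      \<Longrightarrow> (x \<otimes> y) \<otimes> z = x \<otimes> (y \<otimes> z)"
    and tar_unit: "\<lbrakk>\<rho> \<in> Ob T; \<rho>' \<in> Ob T; x \<in> Hom T \<rho> \<rho>'\<rbrakk>
      \<Longrightarrow> Id T (Unit T) \<otimes> x = x \<and> x \<otimes> Id T (Unit T) = x"
    and tar_id: "\<lbrakk>\<rho> \<in> Ob T; \<sigma> \<in> Ob T\<rbrakk> \<Longrightarrow> Id T \<rho> \<otimes> Id T \<sigma> = Id T (\<rho> \<boxtimes> \<sigma>)"
    and tar_comp: "\<lbrakk>\<rho> \<in> Ob T; \<rho>' \<in> Ob T; \<rho>'' \<in> Ob T; \<sigma> \<in> Ob T; \<sigma>' \<in> Ob T; \<sigma>'' \<in> Ob T;
      x \<in> Hom T \<rho> \<rho>'; x' \<in> Hom T \<rho>' \<rho>''; y \<in> Hom T \<sigma> \<sigma>'; y' \<in> Hom T \<sigma>' \<sigma>''\<rbrakk>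
      \<Longrightarrow> (x' \<odot> x) \<otimes> (y' \<odot> y) = (x' \<otimes> y') \<odot> (x \<otimes> y)"
    and tar_add_left: "\<lbrakk>\<rho> \<in> Ob T; \<rho>' \<in> Ob T; \<sigma> \<in> Ob T; \<sigma>' \<in> Ob T;
      x \<in> Hom T \<rho> \<rho>'; x' \<in> Hom T \<rho> \<rho>'; y \<in> Hom T \<sigma> \<sigma>'\<rbrakk>
      \<Longrightarrow> Add T x x' \<otimes> y = Add T (x \<otimes> y) (x' \<otimes> y)"
    and tar_add_right: "\<lbrakk>\<rho> \<in> Ob T; \<rho>' \<in> Ob T; \<sigma> \<in> Ob T; \<sigma>' \<in> Ob T;
      x \<in> Hom T \<rho> \<rho>'; y \<in> Hom T \<sigma> \<sigma>'; y' \<in> Hom T \<sigma> \<sigma>'\<rbrakk>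
      \<Longrightarrow> x \<otimes> Add T y y' = Add T (x \<otimes> y) (x \<otimes> y')"
    and tar_scale: "\<lbrakk>\<rho> \<in> Ob T; \<rho>' \<in> Ob T; \<sigma> \<in> Ob T; \<sigma>' \<in> Ob T; x \<in> Hom T \<rho> \<rho>'; y \<in> Hom T \<sigma> \<sigma>'\<rbrakk>
      \<Longrightarrow> Scale T c x \<otimes> y = Scale T c (x \<otimes> y) \<and> x \<otimes> Scale T c y = Scale T c (x \<otimes> y)"
    and tar_star: "\<lbrakk>\<rho> \<in> Ob T; \<rho>' \<in> Ob T; \<sigma> \<in> Ob T; \<sigma>' \<in> Ob T; x \<in> Hom T \<rho> \<rho>'; y \<in> Hom T \<sigma> \<sigma>'\<rbrakk>
      \<Longrightarrow> Star T (x \<otimes> y) = Star T x \<otimes> Star T y"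

text \<open>\<open>(\<iota>,\<iota>) = \<complex>\<close>.\<close>

definition irreducible_unit :: "('o, 'm) tensor_cat \<Rightarrow> bool" where
  "irreducible_unit T \<longleftrightarrow> Id T (Unit T) \<noteq> Zero T (Unit T) (Unit T)
     \<and> Hom T (Unit T) (Unit T) = range (\<lambda>c. Scale T c (Id T (Unit T)))"

definition conjugate_by ::
    "('o, 'm) tensor_cat \<Rightarrow> 'o \<Rightarrow> 'o \<Rightarrow> 'm \<Rightarrow> 'm \<Rightarrow> bool" where
  "conjugate_by T \<rho> \<rho>b R Rb \<longleftrightarrow>
     R \<in> Hom T (Unit T) (\<rho>b \<boxtimes>\<^bsub>T\<^esub> \<rho>) \<and> Rb \<in> Hom T (Unit T) (\<rho> \<boxtimes>\<^bsub>T\<^esub> \<rho>b)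
     \<and> (Star T Rb \<otimes>\<^bsub>T\<^esub> Id T \<rho>) \<odot>\<^bsub>T\<^esub> (Id T \<rho> \<otimes>\<^bsub>T\<^esub> R) = Id T \<rho>
     \<and> (Star T R \<otimes>\<^bsub>T\<^esub> Id T \<rho>b) \<odot>\<^bsub>T\<^esub> (Id T \<rho>b \<otimes>\<^bsub>T\<^esub> Rb) = Id T \<rho>b"


section \<open>Quasitensor functors to Hilbert spaces\<close>

locale hilbert_star_functor = cstar_category +
  fixes F :: "'o \<Rightarrow> 'h hilb" and FA :: "'m \<Rightarrow> 'h \<Rightarrow> 'h"
  assumes hilbert: "\<rho> \<in> Ob T \<Longrightarrow> hilbert_space (F \<rho>)"
    and maps: "\<lbrakk>\<rho> \<in> Ob T; \<sigma> \<in> Ob T; x \<in> Hom T \<rho> \<sigma>\<rbrakk> \<Longrightarrow> FA x \<in> hmaps (F \<rho>) (F \<sigma>)"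
    and map_id: "\<lbrakk>\<rho> \<in> Ob T; v \<in> hcarrier (F \<rho>)\<rbrakk> \<Longrightarrow> FA (Id T \<rho>) v = v"
    and map_comp: "\<lbrakk>\<rho> \<in> Ob T; \<sigma> \<in> Ob T; \<tau> \<in> Ob T; x \<in> Hom T \<rho> \<sigma>; y \<in> Hom T \<sigma> \<tau>;
      v \<in> hcarrier (F \<rho>)\<rbrakk> \<Longrightarrow> FA (y \<odot> x) v = FA y (FA x v)"
    and map_add: "\<lbrakk>\<rho> \<in> Ob T; \<sigma> \<in> Ob T; x \<in> Hom T \<rho> \<sigma>; y \<in> Hom T \<rho> \<sigma>; v \<in> hcarrier (F \<rho>)\<rbrakk>
      \<Longrightarrow> FA (Add T x y) v = hadd (F \<sigma>) (FA x v) (FA y v)"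
    and map_scale: "\<lbrakk>\<rho> \<in> Ob T; \<sigma> \<in> Ob T; x \<in> Hom T \<rho> \<sigma>; v \<in> hcarrier (F \<rho>)\<rbrakk>
      \<Longrightarrow> FA (Scale T c x) v = hscale (F \<sigma>) c (FA x v)"
    and map_star: "\<lbrakk>\<rho> \<in> Ob T; \<sigma> \<in> Ob T; x \<in> Hom T \<rho> \<sigma>; w \<in> hcarrier (F \<sigma>)\<rbrakk>
      \<Longrightarrow> FA (Star T x) w = adj (F \<rho>) (F \<sigma>) (FA x) w"

text \<open>\<open>S_left \<rho> \<sigma> \<tau>\<close> and \<open>S_right \<rho> \<sigma> \<tau>\<close> are the two sides of the associativity law of \<open>S\<close>. Their
  domains \<open>(F \<rho> \<otimes> F \<sigma>) \<otimes> F \<tau>\<close> and \<open>F \<rho> \<otimes> (F \<sigma> \<otimes> F \<tau>)\<close> are different sets here, although they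
  coincide in the strict category of Hilbert spaces. The identification
  \<open>(x \<otimes> y) \<otimes> z = x \<otimes> (y \<otimes> z)\<close> is made explicit in the axiom \<open>S_assoc\<close> below: the simple
  tensors are total and both sides are bounded operators. The common operator
  \<open>S\<^bsub>\<rho>,\<sigma>,\<tau>\<^esub>\<close> is represented by \<open>S_left\<close>.\<close>

definition S_left :: "('o, 'm) tensor_cat \<Rightarrow> ('o \<Rightarrow> 'h hilb)
    \<Rightarrow> ('o \<Rightarrow> 'o \<Rightarrow> ('h \<Rightarrow> 'h \<Rightarrow> complex) \<Rightarrow> 'h) \<Rightarrow> 'o \<Rightarrow> 'o \<Rightarrow> 'o
    \<Rightarrow> (('h \<Rightarrow> 'h \<Rightarrow> complex) \<Rightarrow> 'h \<Rightarrow> complex) \<Rightarrow> 'h" where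
  "S_left T F S \<rho> \<sigma> \<tau> = S (\<rho> \<boxtimes>\<^bsub>T\<^esub> \<sigma>) \<tau>
     \<circ> op_tensor (F \<rho> \<otimes>\<^sub>H F \<sigma>) (F (\<rho> \<boxtimes>\<^bsub>T\<^esub> \<sigma>)) (F \<tau>) (F \<tau>) (S \<rho> \<sigma>) id"

definition S_right :: "('o, 'm) tensor_cat \<Rightarrow> ('o \<Rightarrow> 'h hilb)
    \<Rightarrow> ('o \<Rightarrow> 'o \<Rightarrow> ('h \<Rightarrow> 'h \<Rightarrow> complex) \<Rightarrow> 'h) \<Rightarrow> 'o \<Rightarrow> 'o \<Rightarrow> 'o
    \<Rightarrow> ('h \<Rightarrow> ('h \<Rightarrow> 'h \<Rightarrow> complex) \<Rightarrow> complex) \<Rightarrow> 'h" where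
  "S_right T F S \<rho> \<sigma> \<tau> = S \<rho> (\<sigma> \<boxtimes>\<^bsub>T\<^esub> \<tau>)
     \<circ> op_tensor (F \<rho>) (F \<rho>) (F \<sigma> \<otimes>\<^sub>H F \<tau>) (F (\<sigma> \<boxtimes>\<^bsub>T\<^esub> \<tau>)) id (S \<sigma> \<tau>)"

definition E2 :: "('o, 'm) tensor_cat \<Rightarrow> ('o \<Rightarrow> 'h hilb)
    \<Rightarrow> ('o \<Rightarrow> 'o \<Rightarrow> ('h \<Rightarrow> 'h \<Rightarrow> complex) \<Rightarrow> 'h) \<Rightarrow> 'o \<Rightarrow> 'o \<Rightarrow> 'h \<Rightarrow> 'h" where
  "E2 T F S \<rho> \<sigma> = range_proj (F \<rho> \<otimes>\<^sub>H F \<sigma>) (F (\<rho> \<boxtimes>\<^bsub>T\<^esub> \<sigma>)) (S \<rho> \<sigma>)"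

definition E3 :: "('o, 'm) tensor_cat \<Rightarrow> ('o \<Rightarrow> 'h hilb)
    \<Rightarrow> ('o \<Rightarrow> 'o \<Rightarrow> ('h \<Rightarrow> 'h \<Rightarrow> complex) \<Rightarrow> 'h) \<Rightarrow> 'o \<Rightarrow> 'o \<Rightarrow> 'o \<Rightarrow> 'h \<Rightarrow> 'h" where
  "E3 T F S \<rho> \<sigma> \<tau> = range_proj ((F \<rho> \<otimes>\<^sub>H F \<sigma>) \<otimes>\<^sub>H F \<tau>) (F (\<rho> \<boxtimes>\<^bsub>T\<^esub> \<sigma> \<boxtimes>\<^bsub>T\<^esub> \<tau>)) (S_left T F S \<rho> \<sigma> \<tau>)"

text \<open>\<open>F \<iota> = \<complex>\<close> is rendered by a unit vector \<open>\<Omega>\<close> spanning \<open>F \<iota>\<close>, i.e. by the identification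
  \<open>c \<mapsto> c \<Omega>\<close> of \<open>\<complex>\<close> with \<open>F \<iota>\<close>. Accordingly \<open>F \<rho> \<otimes> \<complex> = F \<rho> = \<complex> \<otimes> F \<rho>\<close> means
  \<open>v \<otimes> c \<Omega> = c v = c \<Omega> \<otimes> v\<close>.\<close>

locale quasitensor_functor =
  strict_tensor_cstar_category T + hilbert_star_functor T F FA
  for T :: "('o, 'm) tensor_cat" (structure) and F :: "'o \<Rightarrow> 'h hilb" and FA :: "'m \<Rightarrow> 'h \<Rightarrow> 'h" +
  fixes \<Omega> :: 'h
    and S :: "'o \<Rightarrow> 'o \<Rightarrow> ('h \<Rightarrow> 'h \<Rightarrow> complex) \<Rightarrow> 'h"
  assumes unit_vector: "\<Omega> \<in> hcarrier (F (Unit T))" "hnorm (F (Unit T)) \<Omega> = 1"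
    and unit_space: "hcarrier (F (Unit T)) = range (\<lambda>c. hscale (F (Unit T)) c \<Omega>)"
    and S_isometry: "\<lbrakk>\<rho> \<in> Ob T; \<sigma> \<in> Ob T\<rbrakk> \<Longrightarrow> S \<rho> \<sigma> \<in> isometries (F \<rho> \<otimes>\<^sub>H F \<sigma>) (F (\<rho> \<boxtimes> \<sigma>))"
    and S_unit_right: "\<lbrakk>\<rho> \<in> Ob T; v \<in> hcarrier (F \<rho>)\<rbrakk>
      \<Longrightarrow> S \<rho> (Unit T) (vtensor (F \<rho>) (F (Unit T)) v (hscale (F (Unit T)) c \<Omega>)) = hscale (F \<rho>) c v"
    and S_unit_left: "\<lbrakk>\<rho> \<in> Ob T; v \<in> hcarrier (F \<rho>)\<rbrakk>
      \<Longrightarrow> S (Unit T) \<rho> (vtensor (F (Unit T)) (F \<rho>) (hscale (F (Unit T)) c \<Omega>) v) = hscale (F \<rho>) c v"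
    and S_assoc: "\<lbrakk>\<rho> \<in> Ob T; \<sigma> \<in> Ob T; \<tau> \<in> Ob T;
      u \<in> hcarrier (F \<rho>); v \<in> hcarrier (F \<sigma>); w \<in> hcarrier (F \<tau>)\<rbrakk>
      \<Longrightarrow> S_left T F S \<rho> \<sigma> \<tau> (vtensor (F \<rho> \<otimes>\<^sub>H F \<sigma>) (F \<tau>) (vtensor (F \<rho>) (F \<sigma>) u v) w)
        = S_right T F S \<rho> \<sigma> \<tau> (vtensor (F \<rho>) (F \<sigma> \<otimes>\<^sub>H F \<tau>) u (vtensor (F \<sigma>) (F \<tau>) v w))"
    and E_le: "\<lbrakk>\<rho> \<in> Ob T; \<sigma> \<in> Ob T; \<tau> \<in> Ob T\<rbrakk>
      \<Longrightarrow> op_le (F (\<rho> \<boxtimes> \<sigma> \<boxtimes> \<tau>)) (E2 T F S (\<rho> \<boxtimes> \<sigma>) \<tau> \<circ> E2 T F S \<rho> (\<sigma> \<boxtimes> \<tau>)) (E3 T F S \<rho> \<sigma> \<tau>)"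
    and S_natural: "\<lbrakk>\<rho> \<in> Ob T; \<rho>' \<in> Ob T; \<sigma> \<in> Ob T; \<sigma>' \<in> Ob T;
      x \<in> Hom T \<rho> \<rho>'; y \<in> Hom T \<sigma> \<sigma>'; \<phi> \<in> hcarrier (F \<rho> \<otimes>\<^sub>H F \<sigma>)\<rbrakk>
      \<Longrightarrow> FA (x \<otimes> y) (S \<rho> \<sigma> \<phi>)
        = S \<rho>' \<sigma>' (op_tensor (F \<rho>) (F \<rho>') (F \<sigma>) (F \<sigma>') (FA x) (FA y) \<phi>)"

text \<open>The element \<open>S\<^bsub>\<rho>,\<sigma>\<^esub>\<^sup>* \<circ> F(R)\<close> of \<open>F \<rho> \<otimes> F \<sigma>\<close> for \<open>R \<in> (\<iota>, \<rho> \<otimes> \<sigma>)\<close>, where the map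
  \<open>F(R) : \<complex> \<rightarrow> F (\<rho> \<otimes> \<sigma>)\<close> is identified with the vector \<open>F(R) \<Omega>\<close>.\<close>

definition hat :: "('o, 'm) tensor_cat \<Rightarrow> ('o \<Rightarrow> 'h hilb) \<Rightarrow> ('m \<Rightarrow> 'h \<Rightarrow> 'h) \<Rightarrow> 'h
    \<Rightarrow> ('o \<Rightarrow> 'o \<Rightarrow> ('h \<Rightarrow> 'h \<Rightarrow> complex) \<Rightarrow> 'h) \<Rightarrow> 'o \<Rightarrow> 'o \<Rightarrow> 'm \<Rightarrow> 'h \<Rightarrow> 'h \<Rightarrow> complex" where
  "hat T F FA \<Omega> S \<rho> \<sigma> R = adj (F \<rho> \<otimes>\<^sub>H F \<sigma>) (F (\<rho> \<boxtimes>\<^bsub>T\<^esub> \<sigma>)) (S \<rho> \<sigma>) (FA R \<Omega>)"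

end

theory Submission
  imports Defs
begin

text \<open>
  Let \<open>e\<close> be a basis vector of \<open>F \<rho>\<close>. Applying \<open>F\<close> to the conjugate equation gives
  \<open>1 = \<langle>S (F(Rb) \<otimes> e), S (e \<otimes> F(R))\<rangle>\<close>. The condition on the range projections allows one to replace
  \<open>F(Rb)\<close> and \<open>F(R)\<close> by their projections onto the ranges of \<open>S\<close>, and associativity then turns the
  right-hand side into \<open>\<Sum>\<^sub>f cnj (Rbhat e f) * Rhat f e\<close>. Summing over \<open>e\<close>, the Cauchy--Schwarz inequality
  bounds the dimension of \<open>F \<rho>\<close> by the product of the Hilbert--Schmidt norms of \<open>Rhat\<close> and \<open>Rbhat\<close>.
  The other inequality holds since \<open>S\<^sup>*\<close> is a contraction and \<open>\<parallel>F(R) \<Omega>\<parallel> = \<parallel>R\<parallel>\<close>, with equality exactly on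
  the range of \<open>S\<close>.
\<close>

section \<open>Square-summable families and inner product spaces\<close>

text \<open>What is needed of a Hilbert space is split into two properties:
  \<open>parseval_space\<close>, which gives expansions of functionals and the definiteness of the
  inner product on tensor products, and \<open>riesz_space\<close>, which gives adjoints. A tensor
  product of two Parseval spaces has the Riesz property because the representing functional can be
  written down, so iterated tensor products are covered as well.

  In the central computation the inequality of the projections is applied to F(Rb) alone. Once F(Rb)
  is replaced by its projection, associativity pairs F(R) only with vectors S (f \<otimes> e), and
  these pairings are the coefficients \<open>Rhat f e\<close>; the projection of F(R) thus appears
  by itself.

  A priori the basis of F \<rho> may be infinite. The Cauchy--Schwarz bound is therefore proved for
  a sum of absolute values, which can be restricted to finite sets of basis vectors.\<close>

lemma l2_product:
  fixes f g :: "'a \<Rightarrow> complex"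
  assumes f: "(\<lambda>x. (cmod (f x))\<^sup>2) summable_on A" and g: "(\<lambda>x. (cmod (g x))\<^sup>2) summable_on A"
  shows l2_product_abs_summable: "(\<lambda>x. cmod (cnj (f x) * g x)) summable_on A"
    and l2_product_infsum_le: "(\<Sum>\<^sub>\<infinity>x\<in>A. cmod (cnj (f x) * g x))
      \<le> sqrt (\<Sum>\<^sub>\<infinity>x\<in>A. (cmod (f x))\<^sup>2) * sqrt (\<Sum>\<^sub>\<infinity>x\<in>A. (cmod (g x))\<^sup>2)" (is "_ \<le> ?b")
proof -
  have fin: "(\<Sum>x\<in>X. cmod (cnj (f x) * g x)) \<le> ?b" if X: "finite X" "X \<subseteq> A" for X
  proof -
    have "(\<Sum>x\<in>X. cmod (cnj (f x) * g x)) = (\<Sum>x\<in>X. \<bar>cmod (f x)\<bar> * \<bar>cmod (g x)\<bar>)"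
      by (simp add: norm_mult)
    also have "\<dots> \<le> L2_set (\<lambda>x. cmod (f x)) X * L2_set (\<lambda>x. cmod (g x)) X"
      by (rule L2_set_mult_ineq)
    also have "\<dots> \<le> ?b"
      unfolding L2_set_def
      by (intro mult_mono real_sqrt_le_mono finite_sum_le_infsum f g X)
         (auto simp: infsum_nonneg sum_nonneg)
    finally show ?thesis .
  qed
  show s: "(\<lambda>x. cmod (cnj (f x) * g x)) summable_on A"
    by (rule nonneg_bdd_above_summable_on) (use fin in \<open>auto intro!: bdd_aboveI2\<close>)
  show "(\<Sum>\<^sub>\<infinity>x\<in>A. cmod (cnj (f x) * g x)) \<le> ?b"
    by (rule infsum_le_finite_sums[OF s fin])
qed

lemma l2_product_summable:
  fixes f g :: "'a \<Rightarrow> complex"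
  assumes "(\<lambda>x. (cmod (f x))\<^sup>2) summable_on A" "(\<lambda>x. (cmod (g x))\<^sup>2) summable_on A"
  shows "(\<lambda>x. cnj (f x) * g x) summable_on A"
  using l2_product_abs_summable[OF assms] by (rule Infinite_Sum.abs_summable_summable)

lemma l2_add_summable:
  fixes f g :: "'a \<Rightarrow> complex"
  assumes f: "(\<lambda>x. (cmod (f x))\<^sup>2) summable_on A" and g: "(\<lambda>x. (cmod (g x))\<^sup>2) summable_on A"
  shows "(\<lambda>x. (cmod (f x + g x))\<^sup>2) summable_on A"
proof (rule summable_on_comparison_test)
  show "(\<lambda>x. 2 * (cmod (f x))\<^sup>2 + 2 * (cmod (g x))\<^sup>2) summable_on A"
    by (intro summable_on_add summable_on_cmult_right f g)
  fix x
  have "(cmod (f x + g x))\<^sup>2 \<le> (cmod (f x) + cmod (g x))\<^sup>2"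
    by (intro power_mono norm_triangle_ineq) auto
  also have "\<dots> \<le> 2 * (cmod (f x))\<^sup>2 + 2 * (cmod (g x))\<^sup>2"
    using sum_squares_bound[of "cmod (f x)" "cmod (g x)"] by (simp add: power2_sum)
  finally show "(cmod (f x + g x))\<^sup>2 \<le> 2 * (cmod (f x))\<^sup>2 + 2 * (cmod (g x))\<^sup>2" .
qed auto

section \<open>Inner product spaces\<close>

abbreviation hsub :: "'a hilb \<Rightarrow> 'a \<Rightarrow> 'a \<Rightarrow> 'a" where
  "hsub H x y \<equiv> hadd H x (hscale H (- 1) y)"

text \<open>These are the axioms of \<open>hilbert_space\<close> except completeness. Tensor
  products are shown to satisfy them first and obtain the Riesz property afterwards.\<close>

locale pre_hilbert_space =
  cvector_space_on "hcarrier H" "hadd H" "hzero H" "hscale H" for H :: "'a hilb" +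
  assumes inner_sym: "\<lbrakk>x \<in> hcarrier H; y \<in> hcarrier H\<rbrakk> \<Longrightarrow> hinner H x y = cnj (hinner H y x)"
    and inner_add_right: "\<lbrakk>x \<in> hcarrier H; y \<in> hcarrier H; z \<in> hcarrier H\<rbrakk>
      \<Longrightarrow> hinner H x (hadd H y z) = hinner H x y + hinner H x z"
    and inner_scale_right: "\<lbrakk>x \<in> hcarrier H; y \<in> hcarrier H\<rbrakk>
      \<Longrightarrow> hinner H x (hscale H c y) = c * hinner H x y"
    and inner_pos: "x \<in> hcarrier H \<Longrightarrow> 0 \<le> Re (hinner H x x)"
    and inner_def: "\<lbrakk>x \<in> hcarrier H; hinner H x x = 0\<rbrakk> \<Longrightarrow> x = hzero H"
begin

lemma inner_add_left:
  "\<lbrakk>x \<in> hcarrier H; y \<in> hcarrier H; z \<in> hcarrier H\<rbrakk>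
    \<Longrightarrow> hinner H (hadd H x y) z = hinner H x z + hinner H y z"
  by (subst inner_sym) (auto simp: add_closed inner_add_right inner_sym[of z])

lemma inner_scale_left:
  "\<lbrakk>x \<in> hcarrier H; y \<in> hcarrier H\<rbrakk> \<Longrightarrow> hinner H (hscale H c x) y = cnj c * hinner H x y"
  by (subst inner_sym) (auto simp: scale_closed inner_scale_right inner_sym[of y])

lemmas closed = zero_closed add_closed scale_closed
lemmas inner_simps = inner_add_right inner_add_left inner_scale_right inner_scale_left

lemma scale_zero: "x \<in> hcarrier H \<Longrightarrow> hscale H 0 x = hzero H"
  using scale_add_left[of x 1 "-1"] add_neg[of x] by (simp add: scale_one)

lemma inner_zero_left: "x \<in> hcarrier H \<Longrightarrow> hinner H (hzero H) x = 0"
  using inner_scale_left[of x x 0] by (simp add: scale_zero)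

lemma inner_zero_right: "x \<in> hcarrier H \<Longrightarrow> hinner H x (hzero H) = 0"
  using inner_scale_right[of x x 0] by (simp add: scale_zero)

lemma inner_self: "x \<in> hcarrier H \<Longrightarrow> hinner H x x = complex_of_real ((hnorm H x)\<^sup>2)"
  using inner_sym[of x x] inner_pos[of x] by (simp add: hnorm_def complex_eq_iff)

lemma norm_nonneg: "x \<in> hcarrier H \<Longrightarrow> 0 \<le> hnorm H x"
  by (simp add: hnorm_def inner_pos)

lemma norm_zero: "hnorm H (hzero H) = 0"
  by (simp add: hnorm_def inner_zero_left zero_closed)

lemma norm_eq_zero: "x \<in> hcarrier H \<Longrightarrow> hnorm H x = 0 \<longleftrightarrow> x = hzero H"
  using inner_def inner_self norm_zero by fastforce

lemma eq_if_sub_zero: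
  assumes "x \<in> hcarrier H" "y \<in> hcarrier H" "hsub H x y = hzero H"
  shows "x = y"
proof -
  have "x = hadd H x (hadd H y (hscale H (-1) y))"
    using assms by (simp add: add_neg add_commute[of x "hzero H"] add_zero zero_closed)
  also have "\<dots> = hadd H (hsub H x y) y"
    using assms(1,2) by (simp add: add_assoc scale_closed add_commute[of y])
  also have "\<dots> = y" using assms(2) by (simp add: assms(3) add_zero)
  finally show ?thesis .
qed

lemma eq_if_inner_eq:
  assumes "x \<in> hcarrier H" "y \<in> hcarrier H" "\<And>z. z \<in> hcarrier H \<Longrightarrow> hinner H z x = hinner H z y"
  shows "x = y"
proof (rule eq_if_sub_zero[OF assms(1,2)], rule inner_def)
  show "hinner H (hsub H x y) (hsub H x y) = 0"
    using assms(1,2) assms(3)[of "hsub H x y"]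
    by (subst inner_add_right) (auto simp: closed inner_scale_right)
qed (simp add: assms closed)

lemma norm_scale: "x \<in> hcarrier H \<Longrightarrow> hnorm H (hscale H c x) = cmod c * hnorm H x"
proof -
  assume x: "x \<in> hcarrier H"
  have "hinner H (hscale H c x) (hscale H c x) = (cnj c * c) * hinner H x x"
    using x by (simp add: closed inner_simps)
  also have "\<dots> = complex_of_real ((cmod c * hnorm H x)\<^sup>2)"
    using complex_norm_square[of c] by (simp add: inner_self x power_mult_distrib mult.commute)
  finally show ?thesis
    using x norm_nonneg[OF x] by (simp add: hnorm_def[of H "hscale H c x"])
qed

lemma norm_add_sq:
  assumes "x \<in> hcarrier H" "y \<in> hcarrier H"
  shows "(hnorm H (hadd H x y))\<^sup>2 = (hnorm H x)\<^sup>2 + (hnorm H y)\<^sup>2 + 2 * Re (hinner H x y)"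
proof -
  have "hinner H (hadd H x y) (hadd H x y)
      = hinner H x x + hinner H y y + (hinner H x y + cnj (hinner H x y))"
    using assms by (simp add: inner_simps closed inner_sym[of y x])
  also have "\<dots> = complex_of_real ((hnorm H x)\<^sup>2 + (hnorm H y)\<^sup>2 + 2 * Re (hinner H x y))"
    using assms by (simp add: inner_self complex_add_cnj)
  finally show ?thesis
    using assms by (simp add: inner_self closed del: of_real_power of_real_add)
qed

lemma cauchy_schwarz:
  assumes x: "x \<in> hcarrier H" and y: "y \<in> hcarrier H"
  shows "cmod (hinner H x y) \<le> hnorm H x * hnorm H y"
proof (cases "hnorm H y = 0")
  case True
  then have "y = hzero H" using y by (simp add: norm_eq_zero)
  then show ?thesis using x by (simp add: inner_zero_right norm_nonneg norm_zero)
next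
  case False
  define n where "n = (hnorm H y)\<^sup>2"
  have n: "n > 0" using False by (simp add: n_def)
  \<comment> \<open>\<open>z\<close> is the component of x orthogonal to y; the inequality says that
    its norm is nonnegative.\<close>
  define z where "z = hadd H x (hscale H (- hinner H y x / n) y)"
  have "0 \<le> (hnorm H z)\<^sup>2" by simp
  also have "(hnorm H z)\<^sup>2 = (hnorm H x)\<^sup>2 + (cmod (hinner H y x) / n * hnorm H y)\<^sup>2
      + 2 * Re (- hinner H y x / n * cnj (hinner H y x))"
    unfolding z_def using x y n
    by (subst norm_add_sq) (auto simp: closed norm_scale inner_scale_right norm_divide inner_sym[of x y])
  also have "(cmod (hinner H y x) / n * hnorm H y)\<^sup>2 = (cmod (hinner H y x))\<^sup>2 / n"
    using n by (simp add: power_mult_distrib power_divide n_def[symmetric] power2_eq_square[of n])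
  also have "Re (- hinner H y x / n * cnj (hinner H y x)) = - (cmod (hinner H y x))\<^sup>2 / n"
  proof -
    have "- hinner H y x / n * cnj (hinner H y x) = complex_of_real (- (cmod (hinner H y x))\<^sup>2 / n)"
      using complex_norm_square[of "hinner H y x"] by (simp add: mult.commute)
    then show ?thesis by (simp del: of_real_divide of_real_minus of_real_power)
  qed
  finally have "(cmod (hinner H y x))\<^sup>2 \<le> (hnorm H x)\<^sup>2 * n"
    using n by (simp add: field_simps)
  then have "(cmod (hinner H y x))\<^sup>2 \<le> (hnorm H x * hnorm H y)\<^sup>2"
    by (simp add: n_def power_mult_distrib)
  then have "cmod (hinner H y x) \<le> hnorm H x * hnorm H y"
    by (rule power2_le_imp_le) (simp add: norm_nonneg x y)
  then show ?thesis by (simp add: inner_sym[OF x y])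
qed

lemma norm_sub_sq:
  assumes "x \<in> hcarrier H" "y \<in> hcarrier H"
  shows "(hnorm H (hsub H x y))\<^sup>2 = (hnorm H x)\<^sup>2 + (hnorm H y)\<^sup>2 - 2 * Re (hinner H x y)"
  using assms by (simp add: norm_add_sq closed norm_scale inner_scale_right)

section \<open>Bounded functionals and orthonormal families\<close>

definition linear_functional :: "('a \<Rightarrow> complex) \<Rightarrow> bool" where
  "linear_functional f \<longleftrightarrow> (\<forall>x\<in>hcarrier H. \<forall>y\<in>hcarrier H. f (hadd H x y) = f x + f y)
     \<and> (\<forall>c. \<forall>x\<in>hcarrier H. f (hscale H c x) = c * f x)
     \<and> (\<exists>C. \<forall>x\<in>hcarrier H. cmod (f x) \<le> C * hnorm H x)"

lemma linear_functionalE: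
  assumes "linear_functional f"
  obtains C where "C \<ge> 0" "\<And>x. x \<in> hcarrier H \<Longrightarrow> cmod (f x) \<le> C * hnorm H x"
    "\<And>x y. \<lbrakk>x \<in> hcarrier H; y \<in> hcarrier H\<rbrakk> \<Longrightarrow> f (hadd H x y) = f x + f y"
    "\<And>c x. x \<in> hcarrier H \<Longrightarrow> f (hscale H c x) = c * f x"
proof -
  obtain C where C: "\<And>x. x \<in> hcarrier H \<Longrightarrow> cmod (f x) \<le> C * hnorm H x"
    using assms unfolding linear_functional_def by blast
  have "cmod (f x) \<le> \<bar>C\<bar> * hnorm H x" if "x \<in> hcarrier H" for x
    using C[OF that] norm_nonneg[OF that] mult_right_mono[of C "\<bar>C\<bar>" "hnorm H x"] by linarith
  then show ?thesis
    using assms by (intro that[of "\<bar>C\<bar>"]) (auto simp: linear_functional_def)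
qed

definition orthonormal_family :: "('i \<Rightarrow> 'a) \<Rightarrow> 'i set \<Rightarrow> bool" where
  "orthonormal_family b I \<longleftrightarrow> (\<forall>i\<in>I. b i \<in> hcarrier H)
     \<and> (\<forall>i\<in>I. \<forall>j\<in>I. hinner H (b i) (b j) = (if i = j then 1 else 0))"

text \<open>The operations are explicit functions on a carrier, so \<open>sum\<close> does not apply
  to vectors. The combination of the \<open>b i\<close> with coefficients \<open>c i\<close> is
  therefore described by its value under \<open>f\<close> and its inner products.\<close>

lemma linear_combination:
  assumes f: "linear_functional f" and b: "b ` X \<subseteq> hcarrier H" and "finite X"
  shows "\<exists>s\<in>hcarrier H. f s = (\<Sum>i\<in>X. c i * f (b i))
      \<and> (\<forall>x\<in>hcarrier H. hinner H x s = (\<Sum>i\<in>X. c i * hinner H x (b i)))"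
  using \<open>finite X\<close> b
proof (induction X)
  case empty
  have "f (hzero H) = f (hscale H 0 (hzero H))" by (simp add: scale_zero zero_closed)
  also have "\<dots> = 0" using f by (simp add: linear_functional_def zero_closed)
  finally show ?case by (intro bexI[of _ "hzero H"]) (auto simp: zero_closed inner_zero_right)
next
  case (insert i X)
  then obtain s where s: "s \<in> hcarrier H" "f s = (\<Sum>i\<in>X. c i * f (b i))"
    "\<forall>x\<in>hcarrier H. hinner H x s = (\<Sum>i\<in>X. c i * hinner H x (b i))" by blast
  have bi: "b i \<in> hcarrier H" using insert.prems by blast
  have "f (hadd H (hscale H (c i) (b i)) s) = c i * f (b i) + f s"
    using f bi s(1) by (simp add: linear_functional_def closed)
  then show ?case
    using insert.hyps s bi by (intro bexI[of _ "hadd H (hscale H (c i) (b i)) s"])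
      (simp_all add: closed inner_add_right inner_scale_right)
qed

lemma linear_functional_inner:
  assumes "x \<in> hcarrier H"
  shows "linear_functional (hinner H x)"
  unfolding linear_functional_def
  using assms cauchy_schwarz[OF assms] by (auto simp: inner_add_right inner_scale_right)

text \<open>\<open>s\<close> is the orthogonal projection of x onto the span of the
  \<open>b i\<close>. Carrying the value of \<open>f\<close> along lets the same vector serve for
  Bessel's inequality and for the expansion of \<open>f x\<close>.\<close>

lemma finite_projection:
  assumes b: "orthonormal_family b I" and X: "finite X" "X \<subseteq> I"
    and f: "linear_functional f" and x: "x \<in> hcarrier H"
  obtains s where "s \<in> hcarrier H" "f s = (\<Sum>i\<in>X. hinner H (b i) x * f (b i))"
    "(hnorm H (hsub H x s))\<^sup>2 = (hnorm H x)\<^sup>2 - (\<Sum>i\<in>X. (cmod (hinner H (b i) x))\<^sup>2)"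
proof -
  let ?c = "\<lambda>i. hinner H (b i) x"
  have bc: "b i \<in> hcarrier H" if "i \<in> X" for i
    using b X that by (auto simp: orthonormal_family_def)
  obtain s where s: "s \<in> hcarrier H" "f s = (\<Sum>i\<in>X. ?c i * f (b i))"
    and inn: "\<forall>y\<in>hcarrier H. hinner H y s = (\<Sum>i\<in>X. ?c i * hinner H y (b i))"
    using linear_combination[OF f _ X(1), of b ?c] bc by blast
  have xs: "hinner H x s = of_real (\<Sum>i\<in>X. (cmod (?c i))\<^sup>2)"
    using x bc by (simp add: inn inner_sym[of x "b _"] complex_norm_square[symmetric] del: of_real_power)
  have sb: "hinner H s (b i) = cnj (?c i)" if "i \<in> X" for i
  proof -
    have "hinner H (b i) s = (\<Sum>j\<in>X. if i = j then ?c j else 0)"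
      unfolding inn[rule_format, OF bc[OF that]]
      by (rule sum.cong) (use b X that in \<open>auto simp: orthonormal_family_def subset_iff\<close>)
    also have "\<dots> = ?c i" using X that by simp
    finally show ?thesis using s(1) bc[OF that] by (simp add: inner_sym[of s])
  qed
  have "complex_of_real ((hnorm H s)\<^sup>2) = of_real (\<Sum>i\<in>X. (cmod (?c i))\<^sup>2)"
    using sb s(1) by (simp add: inner_self[symmetric] inn complex_norm_square[symmetric] del: of_real_power)
  then have "(hnorm H s)\<^sup>2 = (\<Sum>i\<in>X. (cmod (?c i))\<^sup>2)" by (simp only: of_real_eq_iff)
  then show ?thesis using that[OF s] s(1) x by (simp add: norm_sub_sq xs)
qed

lemma bessel:
  assumes b: "orthonormal_family b I" and x: "x \<in> hcarrier H"
  shows bessel_finite: "\<lbrakk>finite X; X \<subseteq> I\<rbrakk> \<Longrightarrow> (\<Sum>i\<in>X. (cmod (hinner H (b i) x))\<^sup>2) \<le> (hnorm H x)\<^sup>2"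
    and bessel_summable: "(\<lambda>i. (cmod (hinner H (b i) x))\<^sup>2) summable_on I"
    and bessel_infsum: "(\<Sum>\<^sub>\<infinity>i\<in>I. (cmod (hinner H (b i) x))\<^sup>2) \<le> (hnorm H x)\<^sup>2"
proof -
  show fin: "(\<Sum>i\<in>X. (cmod (hinner H (b i) x))\<^sup>2) \<le> (hnorm H x)\<^sup>2" if X: "finite X" "X \<subseteq> I" for X
  proof -
    obtain s where "(hnorm H (hsub H x s))\<^sup>2 = (hnorm H x)\<^sup>2 - (\<Sum>i\<in>X. (cmod (hinner H (b i) x))\<^sup>2)"
      by (rule finite_projection[OF b X linear_functional_inner[OF x] x]) blast
    then show ?thesis using zero_le_power2[of "hnorm H (hsub H x s)"] by linarith
  qed
  show s: "(\<lambda>i. (cmod (hinner H (b i) x))\<^sup>2) summable_on I"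
    by (rule nonneg_bdd_above_summable_on) (use fin in \<open>auto intro!: bdd_aboveI2\<close>)
  show "(\<Sum>\<^sub>\<infinity>i\<in>I. (cmod (hinner H (b i) x))\<^sup>2) \<le> (hnorm H x)\<^sup>2"
    by (rule infsum_le_finite_sums[OF s fin])
qed

text \<open>The vector s with coefficients \<open>cnj (f (b i))\<close> has both its squared norm
  and its value under \<open>f\<close> equal to the partial sum N. Boundedness of \<open>f\<close>
  gives N \<le> C sqrt N, hence N \<le> C^2 for every finite set of indices.\<close>

lemma functional_l2_summable:
  assumes b: "orthonormal_family b I" and f: "linear_functional f"
  shows "(\<lambda>i. (cmod (f (b i)))\<^sup>2) summable_on I"
proof -
  obtain C where C: "C \<ge> 0" "\<And>x. x \<in> hcarrier H \<Longrightarrow> cmod (f x) \<le> C * hnorm H x"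
    by (rule linear_functionalE[OF f]) blast
  have "(\<Sum>i\<in>X. (cmod (f (b i)))\<^sup>2) \<le> C\<^sup>2" if X: "finite X" "X \<subseteq> I" for X
  proof -
    define N where "N = (\<Sum>i\<in>X. (cmod (f (b i)))\<^sup>2)"
    have bc: "b i \<in> hcarrier H" if "i \<in> X" for i
      using b X that by (auto simp: orthonormal_family_def)
    obtain s where s: "s \<in> hcarrier H" "f s = (\<Sum>i\<in>X. cnj (f (b i)) * f (b i))"
      and inn: "\<forall>y\<in>hcarrier H. hinner H y s = (\<Sum>i\<in>X. cnj (f (b i)) * hinner H y (b i))"
      using linear_combination[OF f _ X(1), of b "\<lambda>i. cnj (f (b i))"] bc by blast
    have fs: "f s = of_real N"
      using s(2) by (simp add: N_def complex_norm_square mult.commute del: of_real_power)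
    have "hinner H (b i) s = cnj (f (b i))" if "i \<in> X" for i
    proof -
      have "hinner H (b i) s = (\<Sum>j\<in>X. if i = j then cnj (f (b j)) else 0)"
        unfolding inn[rule_format, OF bc[OF that]]
        by (rule sum.cong) (use b X that in \<open>auto simp: orthonormal_family_def subset_iff\<close>)
      then show ?thesis using X that by simp
    qed
    then have "hinner H s s = of_real N"
      using s(1) bc by (simp add: inn inner_sym[of s "b _"] s(2)[symmetric] fs)
    then have ns: "(hnorm H s)\<^sup>2 = N" using s(1) by (simp add: inner_self del: of_real_power)
    have N: "N \<ge> 0" by (simp add: N_def sum_nonneg)
    have "N \<le> C * hnorm H s" using C(2)[OF s(1)] N by (simp add: fs)
    then have le: "hnorm H s * hnorm H s \<le> C * hnorm H s" by (simp add: ns[symmetric] power2_eq_square)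
    have "hnorm H s \<le> C"
    proof (cases "hnorm H s = 0")
      case False
      then show ?thesis using le norm_nonneg[OF s(1)] by (simp add: mult_le_cancel_right)
    qed (simp add: C)
    then show ?thesis
      using norm_nonneg[OF s(1)] by (simp add: N_def[symmetric] ns[symmetric] power_mono)
  qed
  then show ?thesis by (intro nonneg_bdd_above_summable_on) (auto intro!: bdd_aboveI2)
qed

text \<open>The error of a partial sum is the value of \<open>f\<close> at x minus its finite
  projection. It is at most C times the distance from x to that projection, which tends to 0 by
  Parseval's identity.\<close>

lemma functional_expansion:
  assumes b: "orthonormal_family b I" and f: "linear_functional f" and x: "x \<in> hcarrier H"
    and parseval: "((\<lambda>i. (cmod (hinner H (b i) x))\<^sup>2) has_sum (hnorm H x)\<^sup>2) I"
  shows "((\<lambda>i. hinner H (b i) x * f (b i)) has_sum f x) I"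
proof -
  obtain C where C: "C \<ge> 0" "\<And>x. x \<in> hcarrier H \<Longrightarrow> cmod (f x) \<le> C * hnorm H x"
    and f_add: "\<And>x y. \<lbrakk>x \<in> hcarrier H; y \<in> hcarrier H\<rbrakk> \<Longrightarrow> f (hadd H x y) = f x + f y"
    and f_scale: "\<And>c x. x \<in> hcarrier H \<Longrightarrow> f (hscale H c x) = c * f x"
    by (rule linear_functionalE[OF f]) blast
  let ?r = "\<lambda>X. (hnorm H x)\<^sup>2 - (\<Sum>i\<in>X. (cmod (hinner H (b i) x))\<^sup>2)"
  have bound: "cmod ((\<Sum>i\<in>X. hinner H (b i) x * f (b i)) - f x) \<le> C * sqrt (?r X)"
    if X: "finite X" "X \<subseteq> I" for X
  proof -
    obtain s where s: "s \<in> hcarrier H" "f s = (\<Sum>i\<in>X. hinner H (b i) x * f (b i))"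
      "(hnorm H (hsub H x s))\<^sup>2 = ?r X"
      by (rule finite_projection[OF b X f x])
    have "cmod (f s - f x) = cmod (f (hsub H x s))"
      using s(1) x by (simp add: f_add f_scale closed norm_minus_commute)
    also have "\<dots> \<le> C * hnorm H (hsub H x s)" using s(1) x by (intro C) (simp add: closed)
    also have "hnorm H (hsub H x s) = sqrt (?r X)"
      using s x by (intro real_sqrt_unique[symmetric]) (auto simp: norm_nonneg closed)
    finally show ?thesis by (simp add: s(2))
  qed
  have "((\<lambda>X. C * sqrt (?r X)) \<longlongrightarrow> C * sqrt ((hnorm H x)\<^sup>2 - (hnorm H x)\<^sup>2)) (finite_subsets_at_top I)"
    using parseval unfolding has_sum_def by (intro tendsto_intros)
  then have lim: "((\<lambda>X. C * sqrt (?r X)) \<longlongrightarrow> 0) (finite_subsets_at_top I)" by simp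
  have "((\<lambda>X. (\<Sum>i\<in>X. hinner H (b i) x * f (b i)) - f x) \<longlongrightarrow> 0) (finite_subsets_at_top I)"
    by (rule Lim_null_comparison[OF eventually_finite_subsets_at_top_weakI lim]) (rule bound)
  then show ?thesis unfolding has_sum_def by (rule LIM_zero_cancel)
qed

end

section \<open>Orthonormal bases, the Riesz property and adjoints\<close>

context pre_hilbert_space
begin

text \<open>The last clause of \<open>is_onb\<close> asks only that no nonzero vector be orthogonal
  to the set, so every maximal orthonormal set qualifies: such a vector, once normalised, would
  enlarge it. Parseval's identity is a separate matter.\<close>

lemma is_onb_onb: "is_onb H (onb H)"
proof -
  define ortho where "ortho B \<longleftrightarrow> B \<subseteq> hcarrier H
    \<and> (\<forall>e\<in>B. \<forall>f\<in>B. hinner H e f = (if e = f then 1 else 0))" for B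
  have "\<exists>M\<in>Collect ortho. \<forall>X\<in>Collect ortho. M \<subseteq> X \<longrightarrow> X = M"
  proof (rule subset_Zorn_nonempty)
    have "ortho {}" by (simp add: ortho_def)
    then show "Collect ortho \<noteq> {}" by blast
  next
    fix C assume "C \<noteq> {}" and chain: "subset.chain (Collect ortho) C"
    have "hinner H e f = (if e = f then 1 else 0)" if ef: "e \<in> \<Union>C" "f \<in> \<Union>C" for e f
    proof -
      obtain A B where AB: "A \<in> C" "B \<in> C" "e \<in> A" "f \<in> B" using ef by blast
      have "A \<subseteq> B \<or> B \<subseteq> A" using chain AB(1,2) by (simp add: subset_chain_def)
      then obtain D where "D \<in> C" "e \<in> D" "f \<in> D" using AB by blast
      moreover have "ortho D" using \<open>D \<in> C\<close> chain by (auto simp: subset_chain_def)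
      ultimately show ?thesis by (simp add: ortho_def)
    qed
    moreover have "\<Union>C \<subseteq> hcarrier H"
      using chain unfolding subset_chain_def ortho_def by blast
    ultimately show "\<Union>C \<in> Collect ortho" by (simp add: ortho_def)
  qed
  then obtain B where B: "ortho B" and max: "\<And>X. \<lbrakk>ortho X; B \<subseteq> X\<rbrakk> \<Longrightarrow> X = B" by auto
  have "x = hzero H" if x: "x \<in> hcarrier H" and perp: "\<forall>e\<in>B. hinner H e x = 0" for x
  proof (rule ccontr)
    assume "x \<noteq> hzero H"
    then have n: "hnorm H x \<noteq> 0" using norm_eq_zero[OF x] by simp
    define u where "u = hscale H (1 / hnorm H x) x"
    have u: "u \<in> hcarrier H" by (simp add: u_def closed x)
    have uu: "hinner H u u = 1"
      using n norm_nonneg[OF x] x by (simp add: u_def closed inner_self norm_scale norm_divide)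
    have ue: "hinner H e u = 0 \<and> hinner H u e = 0" if e: "e \<in> B" for e
    proof -
      have "e \<in> hcarrier H" using B e by (auto simp: ortho_def)
      then show ?thesis
        using perp e x by (simp add: u_def inner_scale_right inner_scale_left inner_sym[of x e])
    qed
    have "u \<notin> B" using ue uu by force
    moreover have "ortho (insert u B)"
      using B u uu ue \<open>u \<notin> B\<close> unfolding ortho_def by (metis insert_iff insert_subset)
    ultimately show False using max[of "insert u B"] by blast
  qed
  then have "is_onb H B" using B unfolding is_onb_def ortho_def by simp
  then show ?thesis unfolding onb_def by (rule someI)
qed

lemma onb_orthonormal: "orthonormal_family (\<lambda>e. e) (onb H)"
  using is_onb_onb by (auto simp: is_onb_def orthonormal_family_def)

lemma onb_closed: "e \<in> onb H \<Longrightarrow> e \<in> hcarrier H"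
  using is_onb_onb by (auto simp: is_onb_def)

lemma onb_inner: "\<lbrakk>e \<in> onb H; f \<in> onb H\<rbrakk> \<Longrightarrow> hinner H e f = (if e = f then 1 else 0)"
  using is_onb_onb by (auto simp: is_onb_def)

lemma onb_total: "\<lbrakk>x \<in> hcarrier H; \<And>e. e \<in> onb H \<Longrightarrow> hinner H e x = 0\<rbrakk> \<Longrightarrow> x = hzero H"
  using is_onb_onb by (auto simp: is_onb_def)

end

text \<open>In an incomplete space a maximal orthonormal set may violate Parseval's identity. The
  identity is isolated here because it is what makes a Hilbert--Schmidt functional determined by its
  values on pairs of basis vectors.\<close>

locale parseval_space = pre_hilbert_space +
  assumes parseval_norm: "x \<in> hcarrier H
    \<Longrightarrow> ((\<lambda>e. (cmod (hinner H e x))\<^sup>2) has_sum (hnorm H x)\<^sup>2) (onb H)"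
begin

lemma onb_expansion:
  assumes "linear_functional f" "x \<in> hcarrier H"
  shows "((\<lambda>e. hinner H e x * f e) has_sum f x) (onb H)"
  using functional_expansion[OF onb_orthonormal assms parseval_norm[OF assms(2)]] .

end

text \<open>For an inner product space, representability of all bounded functionals is equivalent to
  completeness. This form of completeness yields adjoints directly.\<close>

locale riesz_space = pre_hilbert_space +
  assumes riesz: "linear_functional f \<Longrightarrow> \<exists>x\<in>hcarrier H. \<forall>y\<in>hcarrier H. f y = hinner H x y"

text \<open>The vector representing \<open>y \<mapsto> \<Sum>\<^sub>e \<langle>x, e\<rangle>\<langle>e, y\<rangle>\<close> differs from \<open>x\<close> by a vector orthogonal to
  the basis, so it is \<open>x\<close>.\<close>

sublocale riesz_space \<subseteq> parseval_space
proof
  fix x assume x: "x \<in> hcarrier H"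
  let ?B = "onb H"
  define g where "g y = (\<Sum>\<^sub>\<infinity>e\<in>?B. cnj (hinner H e x) * hinner H e y)" for y
  note l2 = bessel_summable[OF onb_orthonormal]
  have g_summable: "(\<lambda>e. cnj (hinner H e x) * hinner H e y) summable_on ?B" if "y \<in> hcarrier H" for y
    by (intro l2_product_summable l2 x that)
  have "linear_functional g"
    unfolding linear_functional_def
  proof (intro conjI ballI allI exI)
    fix y z assume yz: "y \<in> hcarrier H" "z \<in> hcarrier H"
    have "g (hadd H y z) = (\<Sum>\<^sub>\<infinity>e\<in>?B. cnj (hinner H e x) * hinner H e y + cnj (hinner H e x) * hinner H e z)"
      unfolding g_def
      by (rule infsum_cong) (use yz in \<open>simp add: inner_add_right onb_closed distrib_left\<close>)
    then show "g (hadd H y z) = g y + g z"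
      using yz by (simp add: g_def infsum_add g_summable)
  next
    fix c y assume y: "y \<in> hcarrier H"
    have "g (hscale H c y) = (\<Sum>\<^sub>\<infinity>e\<in>?B. c * (cnj (hinner H e x) * hinner H e y))"
      unfolding g_def
      by (rule infsum_cong) (use y in \<open>simp add: inner_scale_right onb_closed\<close>)
    then show "g (hscale H c y) = c * g y"
      using y by (simp add: g_def infsum_cmult_right g_summable)
  next
    fix y assume y: "y \<in> hcarrier H"
    have "cmod (g y) \<le> (\<Sum>\<^sub>\<infinity>e\<in>?B. cmod (cnj (hinner H e x) * hinner H e y))"
      unfolding g_def by (intro norm_infsum_bound l2_product_abs_summable l2 x y)
    also have "\<dots> \<le> sqrt (\<Sum>\<^sub>\<infinity>e\<in>?B. (cmod (hinner H e x))\<^sup>2) * sqrt (\<Sum>\<^sub>\<infinity>e\<in>?B. (cmod (hinner H e y))\<^sup>2)"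
      by (intro l2_product_infsum_le l2 x y)
    also have "\<dots> \<le> sqrt ((hnorm H x)\<^sup>2) * sqrt ((hnorm H y)\<^sup>2)"
      by (intro mult_mono real_sqrt_le_mono bessel_infsum[OF onb_orthonormal] x y)
         (auto simp: infsum_nonneg)
    finally show "cmod (g y) \<le> hnorm H x * hnorm H y" using x y by (simp add: norm_nonneg)
  qed
  then obtain x' where x': "x' \<in> hcarrier H" "\<And>y. y \<in> hcarrier H \<Longrightarrow> g y = hinner H x' y"
    using riesz by blast
  have "hinner H e x' = hinner H e x" if e: "e \<in> ?B" for e
  proof -
    have "g e = infsum (\<lambda>e'. cnj (hinner H e' x) * hinner H e' e) {e}"
      unfolding g_def by (rule infsum_cong_neutral) (use e in \<open>auto simp: onb_inner\<close>)
    also have "\<dots> = cnj (hinner H e x)" using e by (simp add: onb_inner)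
    finally show ?thesis
      using x'(2)[OF onb_closed[OF e]] inner_sym[OF onb_closed[OF e] x'(1)] by simp
  qed
  then have "hsub H x x' = hzero H"
    using x x'(1) by (intro onb_total) (auto simp: closed inner_simps onb_closed)
  then have "x = x'" using x x'(1) by (rule_tac eq_if_sub_zero)
  \<comment> \<open>At x itself, g is on the one hand the sum of the squared coefficients and on the
    other hand the squared norm; this is Parseval's identity.\<close>
  then have "g x = complex_of_real ((hnorm H x)\<^sup>2)" using x x'(2)[OF x] by (simp add: inner_self)
  moreover have "((\<lambda>e. cnj (hinner H e x) * hinner H e x) has_sum g x) ?B"
    unfolding g_def by (rule has_sum_infsum[OF g_summable[OF x]])
  ultimately have "((\<lambda>e. complex_of_real ((cmod (hinner H e x))\<^sup>2)) has_sum complex_of_real ((hnorm H x)\<^sup>2)) ?B"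
    by (simp add: complex_norm_square mult.commute del: of_real_power)
  then show "((\<lambda>e. (cmod (hinner H e x))\<^sup>2) has_sum (hnorm H x)\<^sup>2) (onb H)"
    by (simp only: has_sum_of_real_iff)
qed

sublocale hilbert_space \<subseteq> pre_hilbert_space
  by unfold_locales (auto intro: inner_cnj inner_add inner_scale inner_nonneg inner_eq_0)

section \<open>Bounded operators and their adjoints\<close>

lemma hmapsE:
  assumes "A \<in> hmaps H K"
  obtains C where "\<And>x. x \<in> hcarrier H \<Longrightarrow> A x \<in> hcarrier K"
    "\<And>x y. \<lbrakk>x \<in> hcarrier H; y \<in> hcarrier H\<rbrakk> \<Longrightarrow> A (hadd H x y) = hadd K (A x) (A y)"
    "\<And>c x. x \<in> hcarrier H \<Longrightarrow> A (hscale H c x) = hscale K c (A x)"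
    "\<And>x. x \<in> hcarrier H \<Longrightarrow> hnorm K (A x) \<le> C * hnorm H x"
  using assms unfolding hmaps_def by blast

lemma hmaps_closed: "\<lbrakk>A \<in> hmaps H K; x \<in> hcarrier H\<rbrakk> \<Longrightarrow> A x \<in> hcarrier K"
  and hmaps_add: "\<lbrakk>A \<in> hmaps H K; x \<in> hcarrier H; y \<in> hcarrier H\<rbrakk> \<Longrightarrow> A (hadd H x y) = hadd K (A x) (A y)"
  and hmaps_scale: "\<lbrakk>A \<in> hmaps H K; x \<in> hcarrier H\<rbrakk> \<Longrightarrow> A (hscale H c x) = hscale K c (A x)"
  by (auto simp: hmaps_def)

lemma hmaps_zero:
  assumes "pre_hilbert_space H" "pre_hilbert_space K" "A \<in> hmaps H K"
  shows "A (hzero H) = hzero K"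
proof -
  interpret H: pre_hilbert_space H by fact
  interpret K: pre_hilbert_space K by fact
  show ?thesis
    using hmaps_scale[OF assms(3) H.zero_closed, of 0] hmaps_closed[OF assms(3) H.zero_closed]
    by (simp add: H.scale_zero H.zero_closed K.scale_zero)
qed

lemma id_hmaps: "id \<in> hmaps H H"
  by (auto simp: hmaps_def intro!: exI[of _ 1])

lemma linear_functional_hmaps:
  assumes "pre_hilbert_space H" "pre_hilbert_space K" and A: "A \<in> hmaps H K"
    and f: "pre_hilbert_space.linear_functional K f"
  shows "pre_hilbert_space.linear_functional H (\<lambda>x. f (A x))"
proof -
  interpret H: pre_hilbert_space H by fact
  interpret K: pre_hilbert_space K by fact
  obtain C where C: "\<And>x. x \<in> hcarrier H \<Longrightarrow> hnorm K (A x) \<le> C * hnorm H x"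
    by (rule hmapsE[OF A]) blast
  obtain D where D: "D \<ge> 0" "\<And>x. x \<in> hcarrier K \<Longrightarrow> cmod (f x) \<le> D * hnorm K x"
    by (rule K.linear_functionalE[OF f]) blast
  have "cmod (f (A x)) \<le> D * C * hnorm H x" if x: "x \<in> hcarrier H" for x
    using D(2)[OF hmaps_closed[OF A x]] mult_left_mono[OF C[OF x] D(1)] by simp
  then show ?thesis
    using f hmaps_closed[OF A] hmaps_add[OF A] hmaps_scale[OF A]
    unfolding H.linear_functional_def K.linear_functional_def by auto
qed

text \<open>\<open>adj\<close> is a definite description. Existence is the Riesz property of the
  domain, applied to x \<mapsto> \<langle>y, A x\<rangle>; uniqueness holds because a vector is
  determined by its inner products.\<close>

lemma adj:
  assumes "riesz_space H" "pre_hilbert_space K" and A: "A \<in> hmaps H K" and y: "y \<in> hcarrier K"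
  shows adj_closed: "adj H K A y \<in> hcarrier H"
    and adj_inner: "x \<in> hcarrier H \<Longrightarrow> hinner H (adj H K A y) x = hinner K y (A x)"
    and adj_eqI: "\<lbrakk>z \<in> hcarrier H; \<And>x. x \<in> hcarrier H \<Longrightarrow> hinner H z x = hinner K y (A x)\<rbrakk>
      \<Longrightarrow> adj H K A y = z"
proof -
  interpret H: riesz_space H by fact
  interpret K: pre_hilbert_space K by fact
  let ?P = "\<lambda>z. z \<in> hcarrier H \<and> (\<forall>x\<in>hcarrier H. hinner H z x = hinner K y (A x))"
  have uniq: "z = z'" if "?P z" "?P z'" for z z'
    by (rule H.eq_if_inner_eq) (use that in \<open>auto simp: H.inner_sym[of _ z] H.inner_sym[of _ z']\<close>)
  have "H.linear_functional (\<lambda>x. hinner K y (A x))"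
    by (rule linear_functional_hmaps[OF H.pre_hilbert_space_axioms assms(2) A K.linear_functional_inner[OF y]])
  then obtain z where z: "?P z" using H.riesz by metis
  have "?P (adj H K A y)" unfolding adj_def by (rule theI[of ?P, OF z]) (rule uniq[OF _ z])
  then show "adj H K A y \<in> hcarrier H"
    "x \<in> hcarrier H \<Longrightarrow> hinner H (adj H K A y) x = hinner K y (A x)"
    "\<lbrakk>z \<in> hcarrier H; \<And>x. x \<in> hcarrier H \<Longrightarrow> hinner H z x = hinner K y (A x)\<rbrakk> \<Longrightarrow> adj H K A y = z"
    for x z by (auto intro: uniq)
qed

text \<open>Polarisation: norms of sums determine the real parts, and replacing y by -i y turns
  imaginary parts into real parts, since Re (-i z) = Im z.\<close>

lemma isometry_inner:
  assumes "pre_hilbert_space H" "pre_hilbert_space K" and A: "A \<in> isometries H K"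
    and x: "x \<in> hcarrier H" and y: "y \<in> hcarrier H"
  shows "hinner K (A x) (A y) = hinner H x y"
proof -
  interpret H: pre_hilbert_space H by fact
  interpret K: pre_hilbert_space K by fact
  have hm: "A \<in> hmaps H K" using A by (simp add: isometries_def)
  have norm: "hnorm K (A z) = hnorm H z" if "z \<in> hcarrier H" for z
    using A that by (simp add: isometries_def)
  have re: "Re (hinner K (A x) (A z)) = Re (hinner H x z)" if z: "z \<in> hcarrier H" for z
    using norm[of "hadd H x z"] norm[OF x] norm[OF z] x z
      K.norm_add_sq[OF hmaps_closed[OF hm x] hmaps_closed[OF hm z]] H.norm_add_sq[OF x z]
    by (simp add: H.closed hmaps_add[OF hm])
  have "Im (hinner K (A x) (A y)) = Im (hinner H x y)"
    using re[of "hscale H (- \<i>) y"] x y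
    by (simp add: H.closed hmaps_scale[OF hm] hmaps_closed[OF hm] K.inner_scale_right H.inner_scale_right)
  then show ?thesis using re[OF y] by (simp add: complex_eq_iff)
qed

section \<open>Tensor products\<close>

lemma htensor_simps [simp]:
  "hcarrier (H \<otimes>\<^sub>H K) = hs_functionals H K"
  "hadd (H \<otimes>\<^sub>H K) = (\<lambda>\<phi> \<psi> u v. \<phi> u v + \<psi> u v)"
  "hzero (H \<otimes>\<^sub>H K) = (\<lambda>u v. 0)"
  "hscale (H \<otimes>\<^sub>H K) = (\<lambda>c \<phi> u v. c * \<phi> u v)"
  by (simp_all add: htensor_def)

lemma htensor_inner:
  "hinner (H \<otimes>\<^sub>H K) \<phi> \<psi> = (\<Sum>\<^sub>\<infinity>p\<in>onb H \<times> onb K. cnj (case_prod \<phi> p) * case_prod \<psi> p)"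
  by (simp add: htensor_def case_prod_unfold)

lemma hs_l2: "\<phi> \<in> hs_functionals H K \<Longrightarrow> (\<lambda>p. (cmod (case_prod \<phi> p))\<^sup>2) summable_on (onb H \<times> onb K)"
  by (simp add: hs_functionals_def case_prod_unfold)

lemma hs_outside: "\<lbrakk>\<phi> \<in> hs_functionals H K; u \<notin> hcarrier H \<or> v \<notin> hcarrier K\<rbrakk> \<Longrightarrow> \<phi> u v = 0"
  by (simp add: hs_functionals_def)

lemma hs_functionalsI:
  assumes "\<And>u v. u \<notin> hcarrier H \<or> v \<notin> hcarrier K \<Longrightarrow> \<phi> u v = 0"
    and "\<And>u u' v. \<lbrakk>u \<in> hcarrier H; u' \<in> hcarrier H; v \<in> hcarrier K\<rbrakk> \<Longrightarrow> \<phi> (hadd H u u') v = \<phi> u v + \<phi> u' v"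
    and "\<And>u v v'. \<lbrakk>u \<in> hcarrier H; v \<in> hcarrier K; v' \<in> hcarrier K\<rbrakk> \<Longrightarrow> \<phi> u (hadd K v v') = \<phi> u v + \<phi> u v'"
    and "\<And>c u v. \<lbrakk>u \<in> hcarrier H; v \<in> hcarrier K\<rbrakk> \<Longrightarrow> \<phi> (hscale H c u) v = cnj c * \<phi> u v"
    and "\<And>c u v. \<lbrakk>u \<in> hcarrier H; v \<in> hcarrier K\<rbrakk> \<Longrightarrow> \<phi> u (hscale K c v) = cnj c * \<phi> u v"
    and "\<And>u v. \<lbrakk>u \<in> hcarrier H; v \<in> hcarrier K\<rbrakk> \<Longrightarrow> cmod (\<phi> u v) \<le> C * hnorm H u * hnorm K v"
    and "(\<lambda>p. (cmod (case_prod \<phi> p))\<^sup>2) summable_on (onb H \<times> onb K)"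
  shows "\<phi> \<in> hs_functionals H K"
  unfolding hs_functionals_def using assms
  by (intro CollectI conjI allI ballI impI exI[of _ C]) (auto simp: case_prod_unfold)

lemma hs_add_left: "\<lbrakk>\<phi> \<in> hs_functionals H K; u \<in> hcarrier H; u' \<in> hcarrier H; v \<in> hcarrier K\<rbrakk>
    \<Longrightarrow> \<phi> (hadd H u u') v = \<phi> u v + \<phi> u' v"
  and hs_add_right: "\<lbrakk>\<phi> \<in> hs_functionals H K; u \<in> hcarrier H; v \<in> hcarrier K; v' \<in> hcarrier K\<rbrakk>
    \<Longrightarrow> \<phi> u (hadd K v v') = \<phi> u v + \<phi> u v'"
  and hs_scale_left: "\<lbrakk>\<phi> \<in> hs_functionals H K; u \<in> hcarrier H; v \<in> hcarrier K\<rbrakk>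
    \<Longrightarrow> \<phi> (hscale H c u) v = cnj c * \<phi> u v"
  and hs_scale_right: "\<lbrakk>\<phi> \<in> hs_functionals H K; u \<in> hcarrier H; v \<in> hcarrier K\<rbrakk>
    \<Longrightarrow> \<phi> u (hscale K c v) = cnj c * \<phi> u v"
  by (simp_all add: hs_functionals_def)

lemma hs_bounded:
  assumes "\<phi> \<in> hs_functionals H K"
  shows "\<exists>C. \<forall>u\<in>hcarrier H. \<forall>v\<in>hcarrier K. cmod (\<phi> u v) \<le> C * hnorm H u * hnorm K v"
  using assms by (simp add: hs_functionals_def)

lemma hs_add:
  assumes f: "\<phi> \<in> hs_functionals H K" and g: "\<psi> \<in> hs_functionals H K"
  shows "(\<lambda>u v. \<phi> u v + \<psi> u v) \<in> hs_functionals H K"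
proof -
  obtain C where C: "\<forall>u\<in>hcarrier H. \<forall>v\<in>hcarrier K. cmod (\<phi> u v) \<le> C * hnorm H u * hnorm K v"
    using hs_bounded[OF f] by blast
  obtain D where D: "\<forall>u\<in>hcarrier H. \<forall>v\<in>hcarrier K. cmod (\<psi> u v) \<le> D * hnorm H u * hnorm K v"
    using hs_bounded[OF g] by blast
  show ?thesis
  proof (rule hs_functionalsI[where C = "C + D"])
    fix u v assume "u \<in> hcarrier H" "v \<in> hcarrier K"
    then show "cmod (\<phi> u v + \<psi> u v) \<le> (C + D) * hnorm H u * hnorm K v"
      using C D norm_triangle_ineq[of "\<phi> u v" "\<psi> u v"] by (fastforce simp: algebra_simps)
  next
    show "(\<lambda>p. (cmod (case p of (u, v) \<Rightarrow> \<phi> u v + \<psi> u v))\<^sup>2) summable_on onb H \<times> onb K"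
      using l2_add_summable[OF hs_l2[OF f] hs_l2[OF g]] by (simp add: case_prod_unfold)
  qed (use f g in \<open>auto simp: hs_outside hs_add_left hs_add_right hs_scale_left hs_scale_right algebra_simps\<close>)
qed

lemma hs_scale:
  assumes f: "\<phi> \<in> hs_functionals H K"
  shows "(\<lambda>u v. c * \<phi> u v) \<in> hs_functionals H K"
proof -
  obtain C where C: "\<forall>u\<in>hcarrier H. \<forall>v\<in>hcarrier K. cmod (\<phi> u v) \<le> C * hnorm H u * hnorm K v"
    using hs_bounded[OF f] by blast
  show ?thesis
  proof (rule hs_functionalsI[where C = "cmod c * C"])
    fix u v assume "u \<in> hcarrier H" "v \<in> hcarrier K"
    then show "cmod (c * \<phi> u v) \<le> cmod c * C * hnorm H u * hnorm K v"
      using C mult_left_mono[of "cmod (\<phi> u v)" _ "cmod c"] by (fastforce simp: norm_mult mult.assoc)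
  next
    have "(\<lambda>p. (cmod c)\<^sup>2 * (cmod (case_prod \<phi> p))\<^sup>2) summable_on onb H \<times> onb K"
      by (intro summable_on_cmult_right hs_l2 f)
    then show "(\<lambda>p. (cmod (case p of (u, v) \<Rightarrow> c * \<phi> u v))\<^sup>2) summable_on onb H \<times> onb K"
      by (simp add: case_prod_unfold norm_mult power_mult_distrib)
  qed (use f in \<open>auto simp: hs_outside hs_add_left hs_add_right hs_scale_left hs_scale_right algebra_simps\<close>)
qed

lemma hs_zero: "(\<lambda>u v. 0) \<in> hs_functionals H K"
  by (rule hs_functionalsI[where C = 0]) auto

lemma product_summable:
  fixes f :: "'a \<Rightarrow> real" and g :: "'b \<Rightarrow> real"
  assumes f: "f summable_on A" and g: "g summable_on B"
    and "\<And>x. x \<in> A \<Longrightarrow> f x \<ge> 0" "\<And>y. y \<in> B \<Longrightarrow> g y \<ge> 0"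
  shows "(\<lambda>p. f (fst p) * g (snd p)) summable_on A \<times> B"
proof (rule summable_on_SigmaI)
  show "((\<lambda>y. f (fst (x, y)) * g (snd (x, y))) has_sum f x * infsum g B) B" for x
    using has_sum_cmult_right[OF has_sum_infsum[OF g], of "f x"] by simp
  show "(\<lambda>x. f x * infsum g B) summable_on A" by (intro summable_on_cmult_left f)
qed (use assms in auto)

lemma hs_inner_has_sum:
  assumes "\<phi> \<in> hs_functionals H K" "\<psi> \<in> hs_functionals H K"
  shows "((\<lambda>p. cnj (case_prod \<phi> p) * case_prod \<psi> p) has_sum hinner (H \<otimes>\<^sub>H K) \<phi> \<psi>) (onb H \<times> onb K)"
  unfolding htensor_inner
  by (intro has_sum_infsum l2_product_summable hs_l2 assms)

lemma hs_inner_self: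
  assumes "\<phi> \<in> hs_functionals H K"
  shows "hinner (H \<otimes>\<^sub>H K) \<phi> \<phi>
    = complex_of_real (\<Sum>\<^sub>\<infinity>p\<in>onb H \<times> onb K. (cmod (case_prod \<phi> p))\<^sup>2)"
proof -
  have "((\<lambda>p. complex_of_real ((cmod (case_prod \<phi> p))\<^sup>2)) has_sum
      complex_of_real (\<Sum>\<^sub>\<infinity>p\<in>onb H \<times> onb K. (cmod (case_prod \<phi> p))\<^sup>2)) (onb H \<times> onb K)"
    unfolding has_sum_of_real_iff by (intro has_sum_infsum hs_l2 assms)
  moreover have "complex_of_real ((cmod z)\<^sup>2) = cnj z * z" for z
    by (simp add: complex_norm_square mult.commute del: of_real_power)
  ultimately show ?thesis
    using hs_inner_has_sum[OF assms assms] has_sum_unique by (simp del: of_real_power) blast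
qed

lemma hs_norm_has_sum:
  assumes "\<phi> \<in> hs_functionals H K"
  shows "((\<lambda>p. (cmod (case_prod \<phi> p))\<^sup>2) has_sum (hnorm (H \<otimes>\<^sub>H K) \<phi>)\<^sup>2) (onb H \<times> onb K)"
  using has_sum_infsum[OF hs_l2[OF assms]] by (simp add: hnorm_def hs_inner_self[OF assms] infsum_nonneg)

text \<open>Summability comes from Bessel's inequality, so the lemma is available before Parseval's
  identity is known; \<open>F_parseval\<close> relies on this.\<close>

lemma vtensor_hs_functional:
  assumes "pre_hilbert_space H" "pre_hilbert_space K" and x: "x \<in> hcarrier H" and y: "y \<in> hcarrier K"
  shows "vtensor H K x y \<in> hs_functionals H K"
proof -
  interpret H: pre_hilbert_space H by fact
  interpret K: pre_hilbert_space K by fact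
  show ?thesis
  proof (rule hs_functionalsI[where C = "hnorm H x * hnorm K y"])
    fix u v assume uv: "u \<in> hcarrier H" "v \<in> hcarrier K"
    have "cmod (hinner H u x * hinner K v y) \<le> (hnorm H u * hnorm H x) * (hnorm K v * hnorm K y)"
      unfolding norm_mult using uv x y
      by (intro mult_mono H.cauchy_schwarz K.cauchy_schwarz) (auto simp: H.norm_nonneg)
    then show "cmod (vtensor H K x y u v) \<le> hnorm H x * hnorm K y * hnorm H u * hnorm K v"
      using uv by (simp add: vtensor_def mult_ac)
  next
    have "(\<lambda>p. (cmod (hinner H (fst p) x))\<^sup>2 * (cmod (hinner K (snd p) y))\<^sup>2) summable_on onb H \<times> onb K"
      using H.bessel_summable[OF H.onb_orthonormal x] K.bessel_summable[OF K.onb_orthonormal y]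
      by (intro product_summable) auto
    then show "(\<lambda>p. (cmod (case_prod (vtensor H K x y) p))\<^sup>2) summable_on onb H \<times> onb K"
      by (rule summable_on_cong[THEN iffD1, rotated])
         (auto simp: vtensor_def H.onb_closed K.onb_closed norm_mult power_mult_distrib)
  qed (use x y in \<open>auto simp: vtensor_def H.inner_add_left K.inner_add_left H.inner_scale_left
          K.inner_scale_left H.closed K.closed algebra_simps\<close>)
qed

text \<open>The right-hand side consists of sums of squared coefficients rather than norms, because
  the factors need not satisfy Parseval's identity. In \<open>F_parseval\<close> that identity is
  obtained by comparing this formula with a known norm.\<close>

lemma norm_vtensor_sq:
  assumes "pre_hilbert_space H" "pre_hilbert_space K" and x: "x \<in> hcarrier H" and y: "y \<in> hcarrier K"
  shows "(hnorm (H \<otimes>\<^sub>H K) (vtensor H K x y))\<^sup>2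
    = (\<Sum>\<^sub>\<infinity>e\<in>onb H. (cmod (hinner H e x))\<^sup>2) * (\<Sum>\<^sub>\<infinity>f\<in>onb K. (cmod (hinner K f y))\<^sup>2)"
proof -
  interpret H: pre_hilbert_space H by fact
  interpret K: pre_hilbert_space K by fact
  let ?a = "\<lambda>e. (cmod (hinner H e x))\<^sup>2" and ?b = "\<lambda>f. (cmod (hinner K f y))\<^sup>2"
  note t = vtensor_hs_functional[OF assms]
  have "((\<lambda>p. (cmod (case_prod (vtensor H K x y) p))\<^sup>2) has_sum (hnorm (H \<otimes>\<^sub>H K) (vtensor H K x y))\<^sup>2)
      (onb H \<times> onb K)"
    by (rule hs_norm_has_sum[OF t])
  then have "((\<lambda>p. ?a (fst p) * ?b (snd p)) has_sum (hnorm (H \<otimes>\<^sub>H K) (vtensor H K x y))\<^sup>2) (onb H \<times> onb K)"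
    by (rule has_sum_cong[THEN iffD1, rotated])
       (auto simp: vtensor_def H.onb_closed K.onb_closed norm_mult power_mult_distrib)
  then have "((\<lambda>e. ?a e * infsum ?b (onb K)) has_sum (hnorm (H \<otimes>\<^sub>H K) (vtensor H K x y))\<^sup>2) (onb H)"
    by (rule has_sum_SigmaD)
       (use has_sum_cmult_right[OF has_sum_infsum[OF K.bessel_summable[OF K.onb_orthonormal y]]] in simp)
  moreover have "((\<lambda>e. ?a e * infsum ?b (onb K)) has_sum infsum ?a (onb H) * infsum ?b (onb K)) (onb H)"
    by (intro has_sum_cmult_left has_sum_infsum H.bessel_summable[OF H.onb_orthonormal x])
  ultimately show ?thesis using has_sum_unique by blast
qed

section \<open>The tensor product of two Parseval spaces\<close>

locale hs_tensor = H: parseval_space H + K: parseval_space K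
  for H :: "'a hilb" and K :: "'b hilb"
begin

lemma hs_left_functional:
  assumes "\<phi> \<in> hs_functionals H K" "v \<in> hcarrier K"
  shows "H.linear_functional (\<lambda>u. cnj (\<phi> u v))"
proof -
  obtain C where "\<forall>u\<in>hcarrier H. \<forall>v\<in>hcarrier K. cmod (\<phi> u v) \<le> C * hnorm H u * hnorm K v"
    using hs_bounded[OF assms(1)] by blast
  then have "\<forall>u\<in>hcarrier H. cmod (cnj (\<phi> u v)) \<le> (C * hnorm K v) * hnorm H u"
    using assms(2) by (simp add: mult_ac)
  then show ?thesis
    using assms unfolding H.linear_functional_def by (auto simp: hs_add_left hs_scale_left)
qed

lemma hs_right_functional:
  assumes "\<phi> \<in> hs_functionals H K" "u \<in> hcarrier H"
  shows "K.linear_functional (\<lambda>v. cnj (\<phi> u v))"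
proof -
  obtain C where "\<forall>u\<in>hcarrier H. \<forall>v\<in>hcarrier K. cmod (\<phi> u v) \<le> C * hnorm H u * hnorm K v"
    using hs_bounded[OF assms(1)] by blast
  then have "\<forall>v\<in>hcarrier K. cmod (cnj (\<phi> u v)) \<le> (C * hnorm H u) * hnorm K v"
    using assms(2) by simp
  then show ?thesis
    using assms unfolding K.linear_functional_def by (auto simp: hs_add_right hs_scale_right)
qed

lemma hs_left_expansion:
  assumes "\<phi> \<in> hs_functionals H K" "u \<in> hcarrier H" "v \<in> hcarrier K"
  shows "((\<lambda>e. cnj (hinner H e u) * \<phi> e v) has_sum \<phi> u v) (onb H)"
proof -
  have "((\<lambda>e. cnj (hinner H e u * cnj (\<phi> e v))) has_sum cnj (cnj (\<phi> u v))) (onb H)"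
    unfolding has_sum_cnj_iff by (rule H.onb_expansion[OF hs_left_functional]) (use assms in auto)
  then show ?thesis by simp
qed

lemma hs_right_expansion:
  assumes "\<phi> \<in> hs_functionals H K" "u \<in> hcarrier H" "v \<in> hcarrier K"
  shows "((\<lambda>f. cnj (hinner K f v) * \<phi> u f) has_sum \<phi> u v) (onb K)"
proof -
  have "((\<lambda>f. cnj (hinner K f v * cnj (\<phi> u f))) has_sum cnj (cnj (\<phi> u v))) (onb K)"
    unfolding has_sum_cnj_iff by (rule K.onb_expansion[OF hs_right_functional]) (use assms in auto)
  then show ?thesis by simp
qed

text \<open>Expanding in the first variable carries the vanishing from pairs of basis vectors to
  pairs (u, f) with f in the basis; expanding in the second variable then carries it to all pairs.
  This is the definiteness of the inner product.\<close>

lemma hs_eq_zeroI: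
  assumes f: "\<phi> \<in> hs_functionals H K" and zero: "\<And>e f. \<lbrakk>e \<in> onb H; f \<in> onb K\<rbrakk> \<Longrightarrow> \<phi> e f = 0"
  shows "\<phi> = (\<lambda>u v. 0)"
proof (intro ext)
  fix u v
  have *: "\<phi> u f = 0" if "u \<in> hcarrier H" "f \<in> onb K" for u f
  proof -
    have "((\<lambda>e. 0) has_sum \<phi> u f) (onb H)"
      using hs_left_expansion[OF f that(1) K.onb_closed[OF that(2)]] zero[OF _ that(2)]
      by (subst has_sum_cong[where g = "\<lambda>e. cnj (hinner H e u) * \<phi> e f"]) auto
    then show ?thesis using has_sum_0_simp has_sum_unique by blast
  qed
  have "\<phi> u v = 0" if "u \<in> hcarrier H" "v \<in> hcarrier K"
  proof -
    have "((\<lambda>e. 0) has_sum \<phi> u v) (onb K)"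
      using hs_right_expansion[OF f that] *[OF that(1)]
      by (subst has_sum_cong[where g = "\<lambda>e. cnj (hinner K e v) * \<phi> u e"]) auto
    then show ?thesis using has_sum_0_simp has_sum_unique by blast
  qed
  then show "\<phi> u v = 0" using hs_outside[OF f] by blast
qed

sublocale X: pre_hilbert_space "H \<otimes>\<^sub>H K"
proof (unfold_locales, unfold htensor_simps)
  fix \<phi> \<psi> \<theta> :: "'a \<Rightarrow> 'b \<Rightarrow> complex" and c d :: complex
  show "(\<lambda>u v. 0) \<in> hs_functionals H K" by (rule hs_zero)
  show "(\<lambda>u v. 0 + \<phi> u v) = \<phi>" "(\<lambda>u v. 1 * \<phi> u v) = \<phi>"
    "(\<lambda>u v. \<phi> u v + - 1 * \<phi> u v) = (\<lambda>u v. 0)" "(\<lambda>u v. \<phi> u v + \<psi> u v) = (\<lambda>u v. \<psi> u v + \<phi> u v)"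
    by (auto simp: fun_eq_iff)
  show "(\<lambda>u v. \<phi> u v + \<psi> u v + \<theta> u v) = (\<lambda>u v. \<phi> u v + (\<psi> u v + \<theta> u v))"
    "(\<lambda>u v. c * (\<phi> u v + \<psi> u v)) = (\<lambda>u v. c * \<phi> u v + c * \<psi> u v)"
    "(\<lambda>u v. (c + d) * \<phi> u v) = (\<lambda>u v. c * \<phi> u v + d * \<phi> u v)"
    "(\<lambda>u v. c * (d * \<phi> u v)) = (\<lambda>u v. c * d * \<phi> u v)"
    by (auto simp: fun_eq_iff algebra_simps)
next
  fix \<phi> assume f: "\<phi> \<in> hs_functionals H K"
  show "0 \<le> Re (hinner (H \<otimes>\<^sub>H K) \<phi> \<phi>)" by (simp add: hs_inner_self[OF f] infsum_nonneg)
  assume "hinner (H \<otimes>\<^sub>H K) \<phi> \<phi> = 0"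
  then have "(\<Sum>\<^sub>\<infinity>p\<in>onb H \<times> onb K. (cmod (case_prod \<phi> p))\<^sup>2) = 0"
    by (simp add: hs_inner_self[OF f])
  then have "(cmod (case_prod \<phi> p))\<^sup>2 = 0" if "p \<in> onb H \<times> onb K" for p
    using that hs_l2[OF f] by (intro nonneg_infsum_le_0D[where A = "onb H \<times> onb K"]) auto
  then show "\<phi> = (\<lambda>u v. 0)" by (intro hs_eq_zeroI[OF f]) force
next
  fix \<phi> \<psi> :: "'a \<Rightarrow> 'b \<Rightarrow> complex"
  assume f: "\<phi> \<in> hs_functionals H K" and g: "\<psi> \<in> hs_functionals H K"
  show "(\<lambda>u v. \<phi> u v + \<psi> u v) \<in> hs_functionals H K" by (rule hs_add[OF f g])
  show "hinner (H \<otimes>\<^sub>H K) \<phi> \<psi> = cnj (hinner (H \<otimes>\<^sub>H K) \<psi> \<phi>)"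
    by (simp add: htensor_inner infsum_cnj[symmetric] mult.commute del: infsum_cnj)
  have "((\<lambda>p. c * (cnj (case_prod \<phi> p) * case_prod \<psi> p)) has_sum c * hinner (H \<otimes>\<^sub>H K) \<phi> \<psi>) (onb H \<times> onb K)" for c
    by (intro has_sum_cmult_right hs_inner_has_sum f g)
  then show "hinner (H \<otimes>\<^sub>H K) \<phi> (\<lambda>u v. c * \<psi> u v) = c * hinner (H \<otimes>\<^sub>H K) \<phi> \<psi>" for c
    unfolding htensor_inner[of H K \<phi> "\<lambda>u v. c * \<psi> u v"]
    by (intro infsumI) (simp add: case_prod_unfold mult.left_commute)
  fix \<theta> assume h: "\<theta> \<in> hs_functionals H K"
  have "((\<lambda>p. cnj (case_prod \<phi> p) * case_prod \<psi> p + cnj (case_prod \<phi> p) * case_prod \<theta> p) has_sum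
      hinner (H \<otimes>\<^sub>H K) \<phi> \<psi> + hinner (H \<otimes>\<^sub>H K) \<phi> \<theta>) (onb H \<times> onb K)"
    by (intro has_sum_add hs_inner_has_sum f g h)
  then show "hinner (H \<otimes>\<^sub>H K) \<phi> (\<lambda>u v. \<psi> u v + \<theta> u v) = hinner (H \<otimes>\<^sub>H K) \<phi> \<psi> + hinner (H \<otimes>\<^sub>H K) \<phi> \<theta>"
    unfolding htensor_inner[of H K \<phi> "\<lambda>u v. \<psi> u v + \<theta> u v"]
    by (intro infsumI) (simp add: case_prod_unfold distrib_left)
next
  fix \<phi> c assume "\<phi> \<in> hs_functionals H K"
  then show "(\<lambda>u v. c * \<phi> u v) \<in> hs_functionals H K" by (rule hs_scale)
qed

lemmas vtensor_hs = vtensor_hs_functional[OF H.pre_hilbert_space_axioms K.pre_hilbert_space_axioms]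

text \<open>The double sum is evaluated over the basis of K first and over that of H second; each of
  the two sums is an expansion of \<phi> in one variable.\<close>

lemma inner_vtensor:
  assumes x: "x \<in> hcarrier H" and y: "y \<in> hcarrier K" and f: "\<phi> \<in> hs_functionals H K"
  shows "hinner (H \<otimes>\<^sub>H K) (vtensor H K x y) \<phi> = \<phi> x y"
proof -
  have sum: "((\<lambda>p. cnj (hinner H (fst p) x) * (cnj (hinner K (snd p) y) * \<phi> (fst p) (snd p)))
      has_sum hinner (H \<otimes>\<^sub>H K) (vtensor H K x y) \<phi>) (onb H \<times> onb K)"
    using hs_inner_has_sum[OF vtensor_hs[OF x y] f]
    by (rule has_sum_cong[THEN iffD1, rotated]) (auto simp: vtensor_def H.onb_closed K.onb_closed)
  have "((\<lambda>e. cnj (hinner H e x) * \<phi> e y) has_sum hinner (H \<otimes>\<^sub>H K) (vtensor H K x y) \<phi>) (onb H)"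
    by (rule has_sum_SigmaD[OF sum])
       (use has_sum_cmult_right[OF hs_right_expansion[OF f H.onb_closed y]] in auto)
  then show ?thesis using hs_left_expansion[OF f x y] has_sum_unique by blast
qed

lemma inner_vtensor_vtensor:
  assumes "x \<in> hcarrier H" "y \<in> hcarrier K" "x' \<in> hcarrier H" "y' \<in> hcarrier K"
  shows "hinner (H \<otimes>\<^sub>H K) (vtensor H K x y) (vtensor H K x' y') = hinner H x x' * hinner K y y'"
  unfolding inner_vtensor[OF assms(1,2) vtensor_hs[OF assms(3,4)]]
  using assms by (simp add: vtensor_def)

lemma norm_vtensor:
  assumes x: "x \<in> hcarrier H" and y: "y \<in> hcarrier K"
  shows "hnorm (H \<otimes>\<^sub>H K) (vtensor H K x y) = hnorm H x * hnorm K y"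
proof -
  have "complex_of_real ((hnorm (H \<otimes>\<^sub>H K) (vtensor H K x y))\<^sup>2)
      = complex_of_real ((hnorm H x * hnorm K y)\<^sup>2)"
    using X.inner_self[of "vtensor H K x y"] inner_vtensor_vtensor[OF x y x y] x y
    by (simp add: vtensor_hs H.inner_self K.inner_self power_mult_distrib)
  then have "(hnorm (H \<otimes>\<^sub>H K) (vtensor H K x y))\<^sup>2 = (hnorm H x * hnorm K y)\<^sup>2"
    by (simp only: of_real_eq_iff)
  then show ?thesis
    by (rule power2_eq_imp_eq) (use x y X.norm_nonneg vtensor_hs in \<open>auto simp: H.norm_nonneg K.norm_nonneg\<close>)
qed

lemma vtensor_add_left:
  "\<lbrakk>x \<in> hcarrier H; x' \<in> hcarrier H; y \<in> hcarrier K\<rbrakk>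
    \<Longrightarrow> vtensor H K (hadd H x x') y = hadd (H \<otimes>\<^sub>H K) (vtensor H K x y) (vtensor H K x' y)"
  and vtensor_add_right:
  "\<lbrakk>x \<in> hcarrier H; y \<in> hcarrier K; y' \<in> hcarrier K\<rbrakk>
    \<Longrightarrow> vtensor H K x (hadd K y y') = hadd (H \<otimes>\<^sub>H K) (vtensor H K x y) (vtensor H K x y')"
  and vtensor_scale_left:
  "\<lbrakk>x \<in> hcarrier H; y \<in> hcarrier K\<rbrakk>
    \<Longrightarrow> vtensor H K (hscale H c x) y = hscale (H \<otimes>\<^sub>H K) c (vtensor H K x y)"
  and vtensor_scale_right:
  "\<lbrakk>x \<in> hcarrier H; y \<in> hcarrier K\<rbrakk>
    \<Longrightarrow> vtensor H K x (hscale K c y) = hscale (H \<otimes>\<^sub>H K) c (vtensor H K x y)"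
  by (auto simp: vtensor_def fun_eq_iff H.inner_add_right K.inner_add_right H.inner_scale_right
      K.inner_scale_right distrib_left distrib_right)

text \<open>The set \<open>onb (H \<otimes>\<^sub>H K)\<close> is an arbitrary choice, unrelated to
  the bases of the factors. Expansions in the tensor product use this family instead, since the
  inner product is a sum over the same index set.\<close>

lemma vtensor_orthonormal:
  "X.orthonormal_family (\<lambda>p. vtensor H K (fst p) (snd p)) (onb H \<times> onb K)"
  by (auto simp: X.orthonormal_family_def vtensor_hs inner_vtensor_vtensor H.onb_closed K.onb_closed
      H.onb_inner K.onb_inner)

text \<open>By \<open>inner_vtensor\<close> the representing functional must have the value
  \<open>cnj (L (vtensor H K u v))\<close> at (u, v). It is square summable by
  \<open>functional_l2_summable\<close>. Parseval's identity for the product family is the formula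
  for the tensor norm, so \<open>functional_expansion\<close> computes L on every \<phi>.\<close>

lemma htensor_riesz:
  assumes L: "X.linear_functional L"
  shows "\<exists>\<psi>\<in>hs_functionals H K. \<forall>\<phi>\<in>hs_functionals H K. L \<phi> = hinner (H \<otimes>\<^sub>H K) \<psi> \<phi>"
proof -
  obtain C where C: "C \<ge> 0" "\<And>\<phi>. \<phi> \<in> hs_functionals H K \<Longrightarrow> cmod (L \<phi>) \<le> C * hnorm (H \<otimes>\<^sub>H K) \<phi>"
    and L_add: "\<And>\<phi> \<psi>. \<lbrakk>\<phi> \<in> hs_functionals H K; \<psi> \<in> hs_functionals H K\<rbrakk>
      \<Longrightarrow> L (hadd (H \<otimes>\<^sub>H K) \<phi> \<psi>) = L \<phi> + L \<psi>"
    and L_scale: "\<And>c \<phi>. \<phi> \<in> hs_functionals H K \<Longrightarrow> L (hscale (H \<otimes>\<^sub>H K) c \<phi>) = c * L \<phi>"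
    by (rule X.linear_functionalE[OF L, unfolded htensor_simps(1)]) blast
  define \<psi> where "\<psi> u v = (if u \<in> hcarrier H \<and> v \<in> hcarrier K then cnj (L (vtensor H K u v)) else 0)" for u v
  have psi: "\<psi> \<in> hs_functionals H K"
  proof (rule hs_functionalsI[where C = C])
    fix u v assume "u \<in> hcarrier H" "v \<in> hcarrier K"
    then show "cmod (\<psi> u v) \<le> C * hnorm H u * hnorm K v"
      using C(2)[OF vtensor_hs, of u v] by (simp add: \<psi>_def norm_vtensor mult.assoc)
  next
    show "(\<lambda>p. (cmod (case_prod \<psi> p))\<^sup>2) summable_on onb H \<times> onb K"
      using X.functional_l2_summable[OF vtensor_orthonormal L]
      by (rule summable_on_cong[THEN iffD1, rotated]) (auto simp: \<psi>_def H.onb_closed K.onb_closed)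
  qed (auto simp: \<psi>_def H.closed K.closed vtensor_add_left vtensor_add_right vtensor_scale_left
      vtensor_scale_right L_add L_scale vtensor_hs simp del: htensor_simps)
  have "L \<phi> = hinner (H \<otimes>\<^sub>H K) \<psi> \<phi>" if f: "\<phi> \<in> hs_functionals H K" for \<phi>
  proof -
    have "((\<lambda>p. (cmod (case_prod \<phi> p))\<^sup>2) has_sum (hnorm (H \<otimes>\<^sub>H K) \<phi>)\<^sup>2) (onb H \<times> onb K)"
      by (rule hs_norm_has_sum[OF f])
    then have "((\<lambda>p. (cmod (hinner (H \<otimes>\<^sub>H K) (vtensor H K (fst p) (snd p)) \<phi>))\<^sup>2) has_sum
        (hnorm (H \<otimes>\<^sub>H K) \<phi>)\<^sup>2) (onb H \<times> onb K)"
      by (rule has_sum_cong[THEN iffD1, rotated]) (auto simp: inner_vtensor H.onb_closed K.onb_closed f)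
    then have "((\<lambda>p. hinner (H \<otimes>\<^sub>H K) (vtensor H K (fst p) (snd p)) \<phi> * L (vtensor H K (fst p) (snd p)))
        has_sum L \<phi>) (onb H \<times> onb K)"
      using X.functional_expansion[OF vtensor_orthonormal L] f by simp
    then have "((\<lambda>p. cnj (case_prod \<psi> p) * case_prod \<phi> p) has_sum L \<phi>) (onb H \<times> onb K)"
      by (rule has_sum_cong[THEN iffD1, rotated])
         (auto simp: inner_vtensor H.onb_closed K.onb_closed f \<psi>_def)
    then show ?thesis using hs_inner_has_sum[OF psi f] has_sum_unique by blast
  qed
  then show ?thesis using psi by blast
qed

sublocale X: riesz_space "H \<otimes>\<^sub>H K"
  by unfold_locales (simp add: htensor_riesz)

end

section \<open>Adjoints and tensor products of operators\<close>

lemma adj_hmaps: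
  assumes H: "riesz_space H" and K: "pre_hilbert_space K" and A: "A \<in> hmaps H K"
  shows "adj H K A \<in> hmaps K H"
proof -
  interpret H: riesz_space H by fact
  interpret K: pre_hilbert_space K by fact
  note closed = adj_closed[OF H K A] hmaps_closed[OF A]
  note inner = adj_inner[OF H K A]
  obtain D where D: "\<And>x. x \<in> hcarrier H \<Longrightarrow> hnorm K (A x) \<le> D * hnorm H x"
    by (rule hmapsE[OF A]) blast
  \<comment> \<open>\<open>hmaps\<close> does not say that its bound is nonnegative; on the zero
    space any number will do.\<close>
  define C where "C = \<bar>D\<bar>"
  have C: "hnorm K (A x) \<le> C * hnorm H x" if x: "x \<in> hcarrier H" for x
    using D[OF x] mult_right_mono[OF abs_ge_self H.norm_nonneg[OF x], of D] by (simp add: C_def)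
  have bound: "hnorm H (adj H K A y) \<le> C * hnorm K y" if y: "y \<in> hcarrier K" for y
  proof (cases "hnorm H (adj H K A y) = 0")
    case True
    then show ?thesis using K.norm_nonneg[OF y] by (simp add: C_def)
  next
    case False
    let ?z = "adj H K A y"
    have "(hnorm H ?z)\<^sup>2 = cmod (hinner H ?z ?z)"
      using closed(1)[OF y] by (simp add: H.inner_self norm_power)
    also have "\<dots> = cmod (hinner K y (A ?z))" using y by (simp add: inner closed)
    also have "\<dots> \<le> hnorm K y * (C * hnorm H ?z)"
      using K.cauchy_schwarz[OF y closed(2)[OF closed(1)[OF y]]]
        mult_left_mono[OF C[OF closed(1)[OF y]] K.norm_nonneg[OF y]] by linarith
    finally have "hnorm H ?z * hnorm H ?z \<le> (C * hnorm K y) * hnorm H ?z"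
      by (simp add: power2_eq_square mult_ac)
    then show ?thesis using False H.norm_nonneg[OF closed(1)[OF y]] by (simp add: mult_le_cancel_right)
  qed
  have "adj H K A (hadd K y y') = hadd H (adj H K A y) (adj H K A y')"
    if "y \<in> hcarrier K" "y' \<in> hcarrier K" for y y'
    by (rule adj_eqI[OF H K A])
       (use that in \<open>auto simp: K.closed H.closed closed H.inner_add_left K.inner_add_left inner\<close>)
  moreover have "adj H K A (hscale K c y) = hscale H c (adj H K A y)" if "y \<in> hcarrier K" for c y
    by (rule adj_eqI[OF H K A])
       (use that in \<open>auto simp: K.closed H.closed closed H.inner_scale_left K.inner_scale_left inner\<close>)
  ultimately show ?thesis using closed(1) bound unfolding hmaps_def by blast
qed

lemma adj_id:
  assumes "riesz_space H" "x \<in> hcarrier H"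
  shows "adj H H id x = x"
proof -
  interpret H: riesz_space H by fact
  show ?thesis using assms by (intro adj_eqI[OF assms(1) H.pre_hilbert_space_axioms id_hmaps]) auto
qed

lemma op_tensor_vtensor:
  assumes H: "riesz_space H" and H': "pre_hilbert_space H'" and K: "riesz_space K" and K': "pre_hilbert_space K'"
    and A: "A \<in> hmaps H H'" and B: "B \<in> hmaps K K'"
    and x: "x \<in> hcarrier H" and y: "y \<in> hcarrier K"
  shows "op_tensor H H' K K' A B (vtensor H K x y) = vtensor H' K' (A x) (B y)"
  unfolding op_tensor_def vtensor_def
  by (intro ext)
     (use x y in \<open>auto simp: adj_closed[OF H H' A] adj_closed[OF K K' B] adj_inner[OF H H' A] adj_inner[OF K K' B]\<close>)

text \<open>The difficulty is square summability, because the bases of H and H' are unrelated. For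
  fixed v, Riesz represents \<phi> by a vector \<open>x v\<close> of H, and the new functional is
  then represented by \<open>A (x v)\<close>. By Parseval in H and in H', the inner sums are the
  squared norms of \<open>x f\<close> and of \<open>A (x f)\<close>, and the latter is at most
  \<open>E\<^sup>2\<close> times the former.\<close>

lemma op_tensor_id_hs:
  assumes H: "riesz_space H" and H': "parseval_space H'" and K: "riesz_space K"
    and A: "A \<in> hmaps H H'" and f: "\<phi> \<in> hs_functionals H K"
  shows "op_tensor H H' K K A id \<phi> \<in> hs_functionals H' K"
proof -
  interpret H: riesz_space H by fact
  interpret H': parseval_space H' by fact
  interpret K: riesz_space K by fact
  interpret hs_tensor H K by unfold_locales
  note hm = adj_hmaps[OF H H'.pre_hilbert_space_axioms A]
  note A_closed = hmaps_closed[OF A]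
  note adj_A = hmaps_closed[OF hm] hmaps_add[OF hm] hmaps_scale[OF hm]
  let ?\<psi> = "op_tensor H H' K K A id \<phi>"
  have psi: "?\<psi> u v = (if u \<in> hcarrier H' \<and> v \<in> hcarrier K then \<phi> (adj H H' A u) v else 0)" for u v
    by (simp add: op_tensor_def adj_id[OF K])
  obtain C where C: "\<forall>u\<in>hcarrier H. \<forall>v\<in>hcarrier K. cmod (\<phi> u v) \<le> C * hnorm H u * hnorm K v"
    using hs_bounded[OF f] by blast
  obtain D where D: "\<And>u. u \<in> hcarrier H' \<Longrightarrow> hnorm H (adj H H' A u) \<le> D * hnorm H' u"
    by (rule hmapsE[OF hm]) blast
  obtain E where E: "\<And>x. x \<in> hcarrier H \<Longrightarrow> hnorm H' (A x) \<le> E * hnorm H x"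
    by (rule hmapsE[OF A]) blast
  show ?thesis
  proof (rule hs_functionalsI[where C = "\<bar>C\<bar> * D"])
    fix u v assume uv: "u \<in> hcarrier H'" "v \<in> hcarrier K"
    have "cmod (?\<psi> u v) \<le> C * hnorm H (adj H H' A u) * hnorm K v"
      using uv C adj_A by (simp add: psi)
    also have "\<dots> \<le> \<bar>C\<bar> * (D * hnorm H' u) * hnorm K v"
      using uv adj_A by (intro mult_right_mono mult_mono D) (auto simp: H.norm_nonneg K.norm_nonneg)
    finally show "cmod (?\<psi> u v) \<le> \<bar>C\<bar> * D * hnorm H' u * hnorm K v" by (simp add: mult_ac)
  next
    have "\<exists>x. \<forall>v\<in>hcarrier K. x v \<in> hcarrier H \<and> (\<forall>u\<in>hcarrier H. cnj (\<phi> u v) = hinner H (x v) u)"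
      using H.riesz[OF hs_left_functional[OF f]] by (intro bchoice) blast
    then obtain x where x: "\<And>v. v \<in> hcarrier K \<Longrightarrow> x v \<in> hcarrier H"
      and phi: "\<And>u v. \<lbrakk>u \<in> hcarrier H; v \<in> hcarrier K\<rbrakk> \<Longrightarrow> cnj (\<phi> u v) = hinner H (x v) u" by blast
    have phi': "\<phi> u v = hinner H u (x v)" if "u \<in> hcarrier H" "v \<in> hcarrier K" for u v
      using phi[OF that] H.inner_sym[OF that(1) x[OF that(2)]] by (metis complex_cnj_cnj)
    have psi': "?\<psi> u v = hinner H' u (A (x v))" if "u \<in> hcarrier H'" "v \<in> hcarrier K" for u v
      using that by (simp add: psi phi' adj_A x adj_inner[OF H H'.pre_hilbert_space_axioms A])
    \<comment> \<open>The factors are swapped so that the inner sum runs over the basis of H, where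
      Parseval's identity applies to \<open>x f\<close>.\<close>
    have "(\<lambda>(f, e). (cmod (\<phi> e f))\<^sup>2) summable_on onb K \<times> onb H"
      using hs_l2[OF f] by (subst summable_on_swap) (simp add: case_prod_unfold)
    then obtain s where s: "((\<lambda>(f, e). (cmod (\<phi> e f))\<^sup>2) has_sum s) (onb K \<times> onb H)"
      by (auto simp: summable_on_def)
    have "((\<lambda>f. (hnorm H (x f))\<^sup>2) has_sum s) (onb K)"
    proof (rule has_sum_SigmaD[OF s])
      fix f assume "f \<in> onb K"
      then show "((\<lambda>e. case (f, e) of (f, e) \<Rightarrow> (cmod (\<phi> e f))\<^sup>2) has_sum (hnorm H (x f))\<^sup>2) (onb H)"
        using H.parseval_norm[OF x[OF K.onb_closed]]
        by (subst has_sum_cong[where g = "\<lambda>e. (cmod (hinner H e (x f)))\<^sup>2"])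
           (simp_all add: phi' H.onb_closed K.onb_closed)
    qed
    then have "(\<lambda>f. (hnorm H (x f))\<^sup>2) summable_on onb K" by (auto simp: summable_on_def)
    then have "(\<lambda>f. E\<^sup>2 * (hnorm H (x f))\<^sup>2) summable_on onb K" by (rule summable_on_cmult_right)
    then have "(\<lambda>f. (hnorm H' (A (x f)))\<^sup>2) summable_on onb K"
    proof (rule summable_on_comparison_test)
      fix f assume "f \<in> onb K"
      then have xf: "x f \<in> hcarrier H" by (intro x K.onb_closed)
      show "(hnorm H' (A (x f)))\<^sup>2 \<le> E\<^sup>2 * (hnorm H (x f))\<^sup>2"
        using power_mono[OF E[OF xf] H'.norm_nonneg[OF A_closed[OF xf]], of 2] by (simp add: power_mult_distrib)
    qed simp
    moreover have "((\<lambda>e. (cmod (?\<psi> e f))\<^sup>2) has_sum (hnorm H' (A (x f)))\<^sup>2) (onb H')" if "f \<in> onb K" for f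
      using H'.parseval_norm[OF A_closed[OF x[OF K.onb_closed[OF that]]]]
      by (rule has_sum_cong[THEN iffD1, rotated]) (simp add: psi' H'.onb_closed K.onb_closed that)
    ultimately have "(\<lambda>p. (cmod (?\<psi> (snd p) (fst p)))\<^sup>2) summable_on onb K \<times> onb H'"
      by (intro summable_on_SigmaI) auto
    then show "(\<lambda>p. (cmod (case_prod ?\<psi> p))\<^sup>2) summable_on onb H' \<times> onb K"
      by (subst (asm) summable_on_swap) (simp add: case_prod_unfold)
  qed (use f in \<open>auto simp: psi H'.closed K.closed adj_A hs_add_left hs_add_right hs_scale_left hs_scale_right\<close>)
qed

section \<open>Isometries and dimension\<close>

text \<open>The difference of two candidates lies in the range and is orthogonal to it, so it
  vanishes. The properties of A are listed one by one because the lemma is applied to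
  \<open>S_left\<close>, for which only closure and linearity are established.\<close>

lemma range_proj_eqI:
  assumes "pre_hilbert_space H" "pre_hilbert_space K"
    and A: "\<And>x. x \<in> hcarrier H \<Longrightarrow> A x \<in> hcarrier K"
    and A_add: "\<And>x y. \<lbrakk>x \<in> hcarrier H; y \<in> hcarrier H\<rbrakk> \<Longrightarrow> A (hadd H x y) = hadd K (A x) (A y)"
    and A_scale: "\<And>c x. x \<in> hcarrier H \<Longrightarrow> A (hscale H c x) = hscale K c (A x)"
    and x: "x \<in> hcarrier H" and y: "y \<in> hcarrier K"
    and perp: "\<And>z. z \<in> hcarrier H \<Longrightarrow> hinner K (A z) (hsub K y (A x)) = 0"
  shows "range_proj H K A y = A x"
  unfolding range_proj_def
proof (rule the_equality)
  interpret H: pre_hilbert_space H by fact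
  interpret K: pre_hilbert_space K by fact
  show "A x \<in> A ` hcarrier H \<and> (\<forall>m\<in>A ` hcarrier H. hinner K m (hsub K y (A x)) = 0)"
    using x perp by auto
  fix p assume p: "p \<in> A ` hcarrier H \<and> (\<forall>m\<in>A ` hcarrier H. hinner K m (hsub K y p) = 0)"
  then obtain x' where x': "x' \<in> hcarrier H" "p = A x'" by blast
  let ?z = "hsub H x' x"
  have z: "?z \<in> hcarrier H" "A ?z = hsub K p (A x)"
    using x x' by (auto simp: H.closed A_add A_scale)
  have "hinner K (A ?z) (hsub K y p) = 0" "hinner K (A ?z) (hsub K y (A x)) = 0"
    using p z(1) perp by blast+
  then have "hinner K (A ?z) p = hinner K (A ?z) (A x)"
    using z(1) x x' y A by (simp add: K.closed K.inner_add_right K.inner_scale_right)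
  then have "hinner K (A ?z) (hsub K p (A x)) = 0"
    using z(1) x x' A by (simp add: K.closed K.inner_add_right K.inner_scale_right)
  then have "hsub K p (A x) = hzero K"
    using A[OF z(1)] by (intro K.inner_def) (simp_all add: z(2))
  then show "p = A x" using K.eq_if_sub_zero A x x' by blast
qed

lemma isometry_hmaps: "A \<in> isometries H K \<Longrightarrow> A \<in> hmaps H K"
  and isometry_norm: "\<lbrakk>A \<in> isometries H K; x \<in> hcarrier H\<rbrakk> \<Longrightarrow> hnorm K (A x) = hnorm H x"
  by (auto simp: isometries_def)

locale hilbert_isometry = H: riesz_space H + K: pre_hilbert_space K
  for H :: "'a hilb" and K :: "'b hilb" +
  fixes A
  assumes isometry: "A \<in> isometries H K"
begin

lemmas A_hmaps = isometry_hmaps[OF isometry]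
lemmas A_closed = hmaps_closed[OF A_hmaps]
lemmas A_norm = isometry_norm[OF isometry]
lemmas A_inner = isometry_inner[OF H.pre_hilbert_space_axioms K.pre_hilbert_space_axioms isometry]
lemmas A_adj_closed = adj_closed[OF H.riesz_space_axioms K.pre_hilbert_space_axioms A_hmaps]
lemmas A_adj_inner = adj_inner[OF H.riesz_space_axioms K.pre_hilbert_space_axioms A_hmaps]

lemma inner_A_adj:
  assumes "x \<in> hcarrier H" "y \<in> hcarrier K"
  shows "hinner K (A x) y = hinner H x (adj H K A y)"
  using A_adj_inner[OF assms(2,1)] assms A_closed A_adj_closed
  by (metis H.inner_sym K.inner_sym)

lemma adj_A: "x \<in> hcarrier H \<Longrightarrow> adj H K A (A x) = x"
  by (rule adj_eqI[OF H.riesz_space_axioms K.pre_hilbert_space_axioms A_hmaps])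
     (auto simp: A_closed A_inner)

lemma range_proj_eq:
  assumes y: "y \<in> hcarrier K"
  shows "range_proj H K A y = A (adj H K A y)"
proof (rule range_proj_eqI[OF H.pre_hilbert_space_axioms K.pre_hilbert_space_axioms A_closed
      hmaps_add[OF A_hmaps] hmaps_scale[OF A_hmaps] A_adj_closed[OF y] y])
  fix z assume z: "z \<in> hcarrier H"
  show "hinner K (A z) (hsub K y (A (adj H K A y))) = 0"
    using z y A_closed A_adj_closed[OF y]
    by (simp add: K.closed K.inner_add_right K.inner_scale_right inner_A_adj[OF z y] A_inner)
qed

text \<open>Pythagoras for y and its projection, which has the norm of the adjoint vector because A
  is isometric. The contraction property of the adjoint and its equality case are both read off from
  this formula.\<close>

lemma norm_residual:
  assumes y: "y \<in> hcarrier K"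
  shows "(hnorm K (hsub K y (A (adj H K A y))))\<^sup>2 = (hnorm K y)\<^sup>2 - (hnorm H (adj H K A y))\<^sup>2"
proof -
  have "hinner K y (A (adj H K A y)) = of_real ((hnorm H (adj H K A y))\<^sup>2)"
    using y by (simp add: A_adj_inner[symmetric] A_adj_closed H.inner_self)
  then show ?thesis
    using y by (simp add: K.norm_sub_sq A_closed A_adj_closed A_norm del: of_real_power)
qed

lemma norm_adj_le: "y \<in> hcarrier K \<Longrightarrow> hnorm H (adj H K A y) \<le> hnorm K y"
  using norm_residual[of y] zero_le_power2[of "hnorm K (hsub K y (A (adj H K A y)))"]
  by (rule_tac power2_le_imp_le) (auto simp: K.norm_nonneg)

lemma norm_adj_eq_iff:
  assumes y: "y \<in> hcarrier K"
  shows "hnorm H (adj H K A y) = hnorm K y \<longleftrightarrow> y \<in> A ` hcarrier H"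
proof
  assume "hnorm H (adj H K A y) = hnorm K y"
  then have "hnorm K (hsub K y (A (adj H K A y))) = 0" using norm_residual[OF y] by simp
  then have "y = A (adj H K A y)"
    using y by (rule_tac K.eq_if_sub_zero) (simp_all add: K.norm_eq_zero K.closed A_closed A_adj_closed)
  then show "y \<in> A ` hcarrier H" using A_adj_closed[OF y] by blast
next
  assume "y \<in> A ` hcarrier H"
  then obtain x where x: "x \<in> hcarrier H" "y = A x" by blast
  then show "hnorm H (adj H K A y) = hnorm K y" by (simp add: adj_A A_norm)
qed

end

text \<open>By Cauchy--Schwarz the absolute values of all terms, over pairs (e, f), sum to at most
  the product of the norms. The terms with a given e sum to 1, so their absolute values contribute
  at least 1. Hence every finite set of basis vectors has at most that many elements, which forces
  the basis to be finite.\<close>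

lemma hdim_le_if_conjugate:
  assumes "pre_hilbert_space H"
    and f: "\<phi> \<in> hs_functionals K H" and g: "\<psi> \<in> hs_functionals H K"
    and one: "\<And>e. e \<in> onb H \<Longrightarrow> ((\<lambda>f. cnj (\<phi> f e) * \<psi> e f) has_sum 1) (onb K)"
  shows "ereal_of_enat (hdim H) \<le> ereal (hnorm (K \<otimes>\<^sub>H H) \<phi> * hnorm (H \<otimes>\<^sub>H K) \<psi>)" (is "_ \<le> ereal ?N")
proof -
  have f': "((\<lambda>p. (cmod (\<phi> (snd p) (fst p)))\<^sup>2) has_sum (hnorm (K \<otimes>\<^sub>H H) \<phi>)\<^sup>2) (onb H \<times> onb K)"
    using hs_norm_has_sum[OF f] by (subst has_sum_swap) (simp add: case_prod_unfold)
  have g': "((\<lambda>p. (cmod (\<psi> (fst p) (snd p)))\<^sup>2) has_sum (hnorm (H \<otimes>\<^sub>H K) \<psi>)\<^sup>2) (onb H \<times> onb K)"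
    using hs_norm_has_sum[OF g] by (simp add: case_prod_unfold)
  let ?g = "\<lambda>p. cnj (\<phi> (snd p) (fst p)) * \<psi> (fst p) (snd p)"
  have norms: "0 \<le> hnorm (K \<otimes>\<^sub>H H) \<phi>" "0 \<le> hnorm (H \<otimes>\<^sub>H K) \<psi>"
    by (simp_all add: hnorm_def hs_inner_self f g infsum_nonneg)
  have summable: "(\<lambda>p. cmod (?g p)) summable_on onb H \<times> onb K"
    using f' g' by (intro l2_product_abs_summable) (auto simp: summable_on_def)
  have "(\<Sum>\<^sub>\<infinity>p\<in>onb H \<times> onb K. cmod (?g p)) \<le> sqrt ((hnorm (K \<otimes>\<^sub>H H) \<phi>)\<^sup>2) * sqrt ((hnorm (H \<otimes>\<^sub>H K) \<psi>)\<^sup>2)"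
    unfolding infsumI[OF f', symmetric] infsumI[OF g', symmetric]
    using f' g' by (intro l2_product_infsum_le) (auto simp: summable_on_def)
  then have N: "(\<Sum>\<^sub>\<infinity>p\<in>onb H \<times> onb K. cmod (?g p)) \<le> ?N" using norms by simp
  have fin: "real (card X) \<le> ?N" if X: "finite X" "X \<subseteq> onb H" for X
  proof -
    have slice: "(\<lambda>f. cmod (?g (e, f))) summable_on onb K" if "e \<in> onb H" for e
      using summable_on_SigmaD1[of "\<lambda>e f. cmod (?g (e, f))" "onb H" "\<lambda>_. onb K", OF _ that] summable
      by (simp add: case_prod_unfold)
    have "1 \<le> (\<Sum>\<^sub>\<infinity>f\<in>onb K. cmod (?g (e, f)))" if "e \<in> onb H" for e
      using norm_infsum_bound[OF slice[OF that]] infsumI[OF one[OF that]] by simp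
    then have "real (card X) \<le> (\<Sum>e\<in>X. \<Sum>\<^sub>\<infinity>f\<in>onb K. cmod (?g (e, f)))"
      using X sum_mono[of X "\<lambda>_. 1::real"] by (simp add: subset_iff)
    also have "\<dots> \<le> (\<Sum>\<^sub>\<infinity>e\<in>onb H. \<Sum>\<^sub>\<infinity>f\<in>onb K. cmod (?g (e, f)))"
      using X summable_on_SigmaD[OF summable slice]
      by (intro finite_sum_le_infsum) (auto simp: infsum_nonneg)
    also have "\<dots> = (\<Sum>\<^sub>\<infinity>p\<in>onb H \<times> onb K. cmod (?g p))"
      by (rule infsum_Sigma_banach[OF summable])
    finally show ?thesis using N by simp
  qed
  have finite: "finite (onb H)"
  proof (rule ccontr)
    assume "infinite (onb H)"
    then obtain X where X: "finite X" "card X = nat \<lceil>?N\<rceil> + 1" "X \<subseteq> onb H"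
      using infinite_arbitrarily_large by blast
    have "?N < real (nat \<lceil>?N\<rceil> + 1)"
      using real_nat_ceiling_ge[of ?N] by simp
    then show False using fin[OF X(1,3)] X(2) by simp
  qed
  then have "ereal_of_enat (hdim H) = ereal (real (card (onb H)))" by (simp add: hdim_def)
  then show ?thesis using fin[OF finite subset_refl] by (simp only: ereal_less_eq)
qed

section \<open>Quasitensor functors\<close>

context cstar_category
begin

lemma star_id: "\<rho> \<in> Ob T \<Longrightarrow> Star T (Id T \<rho>) = Id T \<rho>"
proof -
  assume r: "\<rho> \<in> Ob T"
  let ?I = "Id T \<rho>"
  have c: "?I \<in> Hom T \<rho> \<rho>" "Star T ?I \<in> Hom T \<rho> \<rho>"
    using r id_closed star_closed by auto
  have "Star T (Star T ?I \<odot> ?I) = Star T ?I \<odot> Star T (Star T ?I)"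
    by (rule star_comp[OF r r r c])
  then show ?thesis using comp_id_right[OF r r c(2)] star_star[OF r r c(1)] by simp
qed

lemma norm_id:
  assumes "\<rho> \<in> Ob T" "Id T \<rho> \<noteq> Zero T \<rho> \<rho>"
  shows "Norm T (Id T \<rho>) = 1"
proof -
  interpret B: cbanach_space_on "Hom T \<rho> \<rho>" "Add T" "Zero T \<rho> \<rho>" "Scale T" "Norm T"
    by (rule hom_banach[OF assms(1,1)])
  note c = id_closed[OF assms(1)]
  have "Norm T (Id T \<rho>) = (Norm T (Id T \<rho>))\<^sup>2"
    using cstar[OF assms(1,1) c] by (simp only: star_id[OF assms(1)] comp_id_left[OF assms(1,1) c])
  then have "Norm T (Id T \<rho>) * (Norm T (Id T \<rho>) - 1) = 0" by (simp add: power2_eq_square algebra_simps)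
  then show ?thesis using B.nrm_eq_0[OF c] assms by simp
qed

text \<open>Vanishing is written as x = 0 x because the axioms for composition, tensor product,
  \<open>Star\<close> and \<open>FA\<close> say how these treat \<open>Scale\<close>; in this form
  it passes through all of them.\<close>

lemma eq_scale_zero:
  assumes "\<rho> \<in> Ob T" "\<sigma> \<in> Ob T" "x \<in> Hom T \<rho> \<sigma>" "Norm T x = 0"
  shows "x = Scale T 0 x"
proof -
  interpret B: cbanach_space_on "Hom T \<rho> \<sigma>" "Add T" "Zero T \<rho> \<sigma>" "Scale T" "Norm T"
    by (rule hom_banach[OF assms(1,2)])
  have "Norm T (Scale T 0 x) = 0" using assms(3) by (simp add: B.nrm_scale)
  then show ?thesis
    using B.nrm_eq_0[OF assms(3)] B.nrm_eq_0[OF B.scale_closed[OF assms(3)]] assms(4) by simp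
qed

end

section \<open>The spaces F \<rho> as Parseval and Riesz spaces\<close>

context quasitensor_functor
begin

lemma F_pre_hilbert: "\<rho> \<in> Ob T \<Longrightarrow> pre_hilbert_space (F \<rho>)"
proof -
  assume "\<rho> \<in> Ob T"
  then interpret hilbert_space "F \<rho>" by (rule hilbert)
  show ?thesis by (rule pre_hilbert_space_axioms)
qed

lemma inner_unit_vector: "hinner (F (Unit T)) \<Omega> \<Omega> = 1"
proof -
  interpret pre_hilbert_space "F (Unit T)" by (rule F_pre_hilbert[OF unit_closed])
  show ?thesis using inner_self[OF unit_vector(1)] unit_vector(2) by simp
qed

text \<open>On the line spanned by \<Omega> the representing vector is an explicit multiple of
  \<Omega>. From this one space the properties of all other F \<rho> are derived.\<close>

lemma F_unit_riesz: "riesz_space (F (Unit T))"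
proof -
  interpret pre_hilbert_space "F (Unit T)" by (rule F_pre_hilbert[OF unit_closed])
  show ?thesis
  proof unfold_locales
    fix f assume f: "linear_functional f"
    have "f y = hinner (F (Unit T)) (hscale (F (Unit T)) (cnj (f \<Omega>)) \<Omega>) y"
      if y: "y \<in> hcarrier (F (Unit T))" for y
    proof -
      obtain c where c: "y = hscale (F (Unit T)) c \<Omega>" using y unit_space by auto
      have "f y = c * f \<Omega>" using f unit_vector(1) by (simp add: linear_functional_def c)
      then show ?thesis
        using unit_vector(1) by (simp add: c closed inner_scale_left inner_scale_right inner_unit_vector)
    qed
    then show "\<exists>x\<in>hcarrier (F (Unit T)). \<forall>y\<in>hcarrier (F (Unit T)). f y = hinner (F (Unit T)) x y"
      using unit_vector(1) closed(3) by blast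
  qed
qed

lemma S_unit_right_vector:
  assumes "\<rho> \<in> Ob T" "v \<in> hcarrier (F \<rho>)"
  shows "S \<rho> (Unit T) (vtensor (F \<rho>) (F (Unit T)) v \<Omega>) = v"
proof -
  interpret I: pre_hilbert_space "F (Unit T)" by (rule F_pre_hilbert[OF unit_closed])
  interpret pre_hilbert_space "F \<rho>" by (rule F_pre_hilbert[OF assms(1)])
  show ?thesis
    using S_unit_right[OF assms, of 1] unit_vector(1) assms(2) by (simp add: I.scale_one scale_one)
qed

lemma S_unit_left_vector:
  assumes "\<rho> \<in> Ob T" "v \<in> hcarrier (F \<rho>)"
  shows "S (Unit T) \<rho> (vtensor (F (Unit T)) (F \<rho>) \<Omega> v) = v"
proof -
  interpret I: pre_hilbert_space "F (Unit T)" by (rule F_pre_hilbert[OF unit_closed])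
  interpret pre_hilbert_space "F \<rho>" by (rule F_pre_hilbert[OF assms(1)])
  show ?thesis
    using S_unit_left[OF assms, of 1] unit_vector(1) assms(2) by (simp add: I.scale_one scale_one)
qed

lemma S_unit_isometry: "\<rho> \<in> Ob T \<Longrightarrow> S \<rho> (Unit T) \<in> isometries (F \<rho> \<otimes>\<^sub>H F (Unit T)) (F \<rho>)"
  using S_isometry[OF _ unit_closed, of \<rho>] tob_unit[of \<rho>] by simp

text \<open>The completeness clause of \<open>hilbert_space\<close> evaluates \<open>Metric_space.mcomplete\<close> at a function that
  is a metric only on the carrier, and the library characterises \<open>mcomplete\<close> only for functions that are
  non-negative and symmetric everywhere. The Riesz property of \<open>F \<rho>\<close> is obtained instead from
  \<open>F \<rho> = F \<rho> \<otimes> \<complex>\<close>: norms in \<open>F \<rho> \<otimes> \<complex>\<close> are sums over the basis, and bounded functionals on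
  \<open>F \<rho> \<otimes> \<complex>\<close> are represented by Hilbert--Schmidt functionals.\<close>

lemma F_parseval:
  assumes r: "\<rho> \<in> Ob T"
  shows "parseval_space (F \<rho>)"
proof -
  interpret I: riesz_space "F (Unit T)" by (rule F_unit_riesz)
  interpret pre_hilbert_space "F \<rho>" by (rule F_pre_hilbert[OF r])
  show ?thesis
  proof unfold_locales
    fix x assume x: "x \<in> hcarrier (F \<rho>)"
    let ?t = "vtensor (F \<rho>) (F (Unit T)) x \<Omega>"
    have t: "?t \<in> hcarrier (F \<rho> \<otimes>\<^sub>H F (Unit T))"
      using vtensor_hs_functional[OF pre_hilbert_space_axioms I.pre_hilbert_space_axioms x unit_vector(1)] by simp
    \<comment> \<open>S is isometric and sends x \<otimes> \<Omega> to x. In the formula for the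
      norm of x \<otimes> \<Omega> the second factor is the Parseval sum of \<Omega>, which is
      1.\<close>
    have "(hnorm (F \<rho>) x)\<^sup>2 = (hnorm (F \<rho> \<otimes>\<^sub>H F (Unit T)) ?t)\<^sup>2"
      using isometry_norm[OF S_unit_isometry[OF r] t] by (simp add: S_unit_right_vector[OF r x])
    also have "\<dots> = (\<Sum>\<^sub>\<infinity>e\<in>onb (F \<rho>). (cmod (hinner (F \<rho>) e x))\<^sup>2)"
      unfolding norm_vtensor_sq[OF pre_hilbert_space_axioms I.pre_hilbert_space_axioms x unit_vector(1)]
        infsumI[OF I.parseval_norm[OF unit_vector(1)]]
      by (simp add: unit_vector(2))
    finally show "((\<lambda>e. (cmod (hinner (F \<rho>) e x))\<^sup>2) has_sum (hnorm (F \<rho>) x)\<^sup>2) (onb (F \<rho>))"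
      using has_sum_infsum[OF bessel_summable[OF onb_orthonormal x]] by simp
  qed
qed

text \<open>If \<psi> represents the functional f composed with S, then S \<psi> represents f,
  because S preserves inner products and every y is of the form S (y \<otimes> \<Omega>). The locale
  \<open>hs_tensor\<close> asks for Parseval factors, so \<open>F_parseval\<close> has to come
  first.\<close>

lemma F_riesz:
  assumes r: "\<rho> \<in> Ob T"
  shows "riesz_space (F \<rho>)"
proof -
  interpret I: riesz_space "F (Unit T)" by (rule F_unit_riesz)
  interpret P: parseval_space "F \<rho>" by (rule F_parseval[OF r])
  interpret X: hs_tensor "F \<rho>" "F (Unit T)" by unfold_locales
  note iso = S_unit_isometry[OF r]
  note hm = isometry_hmaps[OF iso]
  show ?thesis
  proof unfold_locales
    fix f assume f: "P.linear_functional f"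
    obtain \<psi> where psi: "\<psi> \<in> hcarrier (F \<rho> \<otimes>\<^sub>H F (Unit T))"
      "\<forall>\<phi>\<in>hcarrier (F \<rho> \<otimes>\<^sub>H F (Unit T)). f (S \<rho> (Unit T) \<phi>) = hinner (F \<rho> \<otimes>\<^sub>H F (Unit T)) \<psi> \<phi>"
      using X.X.riesz[OF linear_functional_hmaps[OF X.X.pre_hilbert_space_axioms P.pre_hilbert_space_axioms hm f]]
      by blast
    have "f y = hinner (F \<rho>) (S \<rho> (Unit T) \<psi>) y" if y: "y \<in> hcarrier (F \<rho>)" for y
    proof -
      let ?t = "vtensor (F \<rho>) (F (Unit T)) y \<Omega>"
      have t: "?t \<in> hcarrier (F \<rho> \<otimes>\<^sub>H F (Unit T))" using X.vtensor_hs[OF y unit_vector(1)] by simp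
      have "f (S \<rho> (Unit T) ?t) = hinner (F \<rho>) (S \<rho> (Unit T) \<psi>) (S \<rho> (Unit T) ?t)"
        using psi t isometry_inner[OF X.X.pre_hilbert_space_axioms P.pre_hilbert_space_axioms iso psi(1) t]
        by simp
      then show ?thesis by (simp add: S_unit_right_vector[OF r y])
    qed
    then show "\<exists>x\<in>hcarrier (F \<rho>). \<forall>y\<in>hcarrier (F \<rho>). f y = hinner (F \<rho>) x y"
      using hmaps_closed[OF hm psi(1)] by blast
  qed
qed

section \<open>The isometries S: projections and associativity\<close>

lemma F_tensor: "\<lbrakk>\<rho> \<in> Ob T; \<sigma> \<in> Ob T\<rbrakk> \<Longrightarrow> hs_tensor (F \<rho>) (F \<sigma>)"
  by (intro hs_tensor.intro F_parseval)

lemma S_hilbert_isometry: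
  assumes "\<rho> \<in> Ob T" "\<sigma> \<in> Ob T"
  shows "hilbert_isometry (F \<rho> \<otimes>\<^sub>H F \<sigma>) (F (\<rho> \<boxtimes> \<sigma>)) (S \<rho> \<sigma>)"
proof -
  interpret hs_tensor "F \<rho>" "F \<sigma>" by (rule F_tensor[OF assms])
  show ?thesis
    by (intro hilbert_isometry.intro hilbert_isometry_axioms.intro X.riesz_space_axioms
        F_pre_hilbert tob_closed S_isometry assms)
qed

text \<open>With \<open>y = x - E\<^bsub>\<rho>,\<sigma>\<^esub> x\<close>, the vector \<open>q = S (y \<otimes> w)\<close> lies in the range of \<open>E\<^bsub>\<rho>\<otimes>\<sigma>,\<tau>\<^esub>\<close> and is
  orthogonal to that of \<open>E\<^bsub>\<rho>,\<sigma>,\<tau>\<^esub>\<close>. The condition on the projections, tested on \<open>q\<close>, gives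
  \<open>-\<parallel>E\<^bsub>\<rho>,\<sigma>\<otimes>\<tau>\<^esub> q\<parallel>\<^sup>2 \<ge> 0\<close>, so \<open>q\<close> is orthogonal to the range of \<open>E\<^bsub>\<rho>,\<sigma>\<otimes>\<tau>\<^esub>\<close>.\<close>

lemma inner_S_project:
  assumes r: "\<rho> \<in> Ob T" and s: "\<sigma> \<in> Ob T" and t: "\<tau> \<in> Ob T"
    and x: "x \<in> hcarrier (F (\<rho> \<boxtimes> \<sigma>))" and w: "w \<in> hcarrier (F \<tau>)"
    and \<beta>: "\<beta> \<in> hcarrier (F \<rho> \<otimes>\<^sub>H F (\<sigma> \<boxtimes> \<tau>))"
  defines "x' \<equiv> S \<rho> \<sigma> (adj (F \<rho> \<otimes>\<^sub>H F \<sigma>) (F (\<rho> \<boxtimes> \<sigma>)) (S \<rho> \<sigma>) x)"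
  shows "hinner (F (\<rho> \<boxtimes> \<sigma> \<boxtimes> \<tau>)) (S (\<rho> \<boxtimes> \<sigma>) \<tau> (vtensor (F (\<rho> \<boxtimes> \<sigma>)) (F \<tau>) x w)) (S \<rho> (\<sigma> \<boxtimes> \<tau>) \<beta>)
    = hinner (F (\<rho> \<boxtimes> \<sigma> \<boxtimes> \<tau>)) (S (\<rho> \<boxtimes> \<sigma>) \<tau> (vtensor (F (\<rho> \<boxtimes> \<sigma>)) (F \<tau>) x' w)) (S \<rho> (\<sigma> \<boxtimes> \<tau>) \<beta>)"
proof -
  let ?K = "F (\<rho> \<boxtimes> \<sigma> \<boxtimes> \<tau>)" and ?A = "S (\<rho> \<boxtimes> \<sigma>) \<tau>" and ?B = "S \<rho> (\<sigma> \<boxtimes> \<tau>)"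
  note rs = tob_closed[OF r s] and st = tob_closed[OF s t]
  note ob = tob_assoc[OF r s t]
  interpret RS: hs_tensor "F \<rho>" "F \<sigma>" by (rule F_tensor[OF r s])
  interpret Frs: riesz_space "F (\<rho> \<boxtimes> \<sigma>)" by (rule F_riesz[OF rs])
  interpret Ft: riesz_space "F \<tau>" by (rule F_riesz[OF t])
  interpret K: pre_hilbert_space ?K by (rule F_pre_hilbert[OF tob_closed[OF r st]])
  interpret S0: hilbert_isometry "F \<rho> \<otimes>\<^sub>H F \<sigma>" "F (\<rho> \<boxtimes> \<sigma>)" "S \<rho> \<sigma>" by (rule S_hilbert_isometry[OF r s])
  \<comment> \<open>Strict associativity of objects makes the two isometries end in the same
    space.\<close>
  interpret A: hilbert_isometry "F (\<rho> \<boxtimes> \<sigma>) \<otimes>\<^sub>H F \<tau>" ?K ?A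
    using S_hilbert_isometry[OF rs t] by (simp only: ob)
  interpret B: hilbert_isometry "F \<rho> \<otimes>\<^sub>H F (\<sigma> \<boxtimes> \<tau>)" ?K ?B by (rule S_hilbert_isometry[OF r st])
  interpret RST: hs_tensor "F (\<rho> \<boxtimes> \<sigma>)" "F \<tau>" by (rule F_tensor[OF rs t])
  interpret L: hs_tensor "F \<rho> \<otimes>\<^sub>H F \<sigma>" "F \<tau>" by unfold_locales
  let ?S0a = "adj (F \<rho> \<otimes>\<^sub>H F \<sigma>) (F (\<rho> \<boxtimes> \<sigma>)) (S \<rho> \<sigma>)"
  have x': "x' \<in> hcarrier (F (\<rho> \<boxtimes> \<sigma>))" unfolding x'_def by (intro S0.A_closed S0.A_adj_closed x)
  define y where "y = hsub (F (\<rho> \<boxtimes> \<sigma>)) x x'"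
  have y: "y \<in> hcarrier (F (\<rho> \<boxtimes> \<sigma>))" using x x' by (simp add: y_def Frs.closed)
  have Say: "?S0a y = hzero (F \<rho> \<otimes>\<^sub>H F \<sigma>)"
  proof (rule adj_eqI[OF RS.X.riesz_space_axioms Frs.pre_hilbert_space_axioms S0.A_hmaps y])
    show "hzero (F \<rho> \<otimes>\<^sub>H F \<sigma>) \<in> hcarrier (F \<rho> \<otimes>\<^sub>H F \<sigma>)" by (rule RS.X.zero_closed)
    fix z assume z: "z \<in> hcarrier (F \<rho> \<otimes>\<^sub>H F \<sigma>)"
    have "hinner (F (\<rho> \<boxtimes> \<sigma>)) x' (S \<rho> \<sigma> z) = hinner (F (\<rho> \<boxtimes> \<sigma>)) x (S \<rho> \<sigma> z)"
      unfolding x'_def S0.A_inner[OF S0.A_adj_closed[OF x] z] by (rule S0.A_adj_inner[OF x z])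
    then have "hinner (F (\<rho> \<boxtimes> \<sigma>)) y (S \<rho> \<sigma> z) = 0"
      using x x' S0.A_closed[OF z] unfolding y_def
      by (simp add: Frs.closed Frs.inner_add_left Frs.inner_scale_left)
    then show "hinner (F \<rho> \<otimes>\<^sub>H F \<sigma>) (hzero (F \<rho> \<otimes>\<^sub>H F \<sigma>)) z = hinner (F (\<rho> \<boxtimes> \<sigma>)) y (S \<rho> \<sigma> z)"
      using RS.X.inner_zero_left[OF z] by simp
  qed
  define ty where "ty = vtensor (F (\<rho> \<boxtimes> \<sigma>)) (F \<tau>) y w"
  have ty: "ty \<in> hcarrier (F (\<rho> \<boxtimes> \<sigma>) \<otimes>\<^sub>H F \<tau>)" using RST.vtensor_hs[OF y w] by (simp add: ty_def)
  define q where "q = ?A ty"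
  have q: "q \<in> hcarrier ?K" unfolding q_def by (rule A.A_closed[OF ty])
  let ?op = "op_tensor (F \<rho> \<otimes>\<^sub>H F \<sigma>) (F (\<rho> \<boxtimes> \<sigma>)) (F \<tau>) (F \<tau>) (S \<rho> \<sigma>) id"
  let ?X3 = "(F \<rho> \<otimes>\<^sub>H F \<sigma>) \<otimes>\<^sub>H F \<tau>"
  have SL: "S_left T F S \<rho> \<sigma> \<tau> m = ?A (?op m)" for m by (simp add: S_left_def)
  have op: "?op m \<in> hcarrier (F (\<rho> \<boxtimes> \<sigma>) \<otimes>\<^sub>H F \<tau>)" if "m \<in> hcarrier ?X3" for m
    using op_tensor_id_hs[OF RS.X.riesz_space_axioms Frs.parseval_space_axioms Ft.riesz_space_axioms S0.A_hmaps, of m]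
      that by simp
  have perp: "hinner ?K (S_left T F S \<rho> \<sigma> \<tau> m) q = 0" if m: "m \<in> hcarrier ?X3" for m
  proof -
    have "hinner ?K q (S_left T F S \<rho> \<sigma> \<tau> m) = hinner (F (\<rho> \<boxtimes> \<sigma>) \<otimes>\<^sub>H F \<tau>) ty (?op m)"
      unfolding SL q_def by (rule A.A_inner[OF ty op[OF m]])
    also have "\<dots> = ?op m y w" using RST.inner_vtensor[OF y w] op[OF m] by (simp add: ty_def)
    \<comment> \<open>\<open>op_tensor\<close> evaluates m at the adjoint vectors, and the adjoint
      of \<open>S \<rho> \<sigma>\<close> annihilates y.\<close>
    also have "\<dots> = m (hzero (F \<rho> \<otimes>\<^sub>H F \<sigma>)) w"
      using y w Say adj_id[OF Ft.riesz_space_axioms w] by (simp add: op_tensor_def del: htensor_simps)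
    also have "\<dots> = m (hscale (F \<rho> \<otimes>\<^sub>H F \<sigma>) 0 (hzero (F \<rho> \<otimes>\<^sub>H F \<sigma>))) w"
      using RS.X.scale_zero[OF RS.X.zero_closed] by simp
    also have "\<dots> = 0"
      using hs_scale_left[of m "F \<rho> \<otimes>\<^sub>H F \<sigma>" "F \<tau>" "hzero (F \<rho> \<otimes>\<^sub>H F \<sigma>)" w 0] m w RS.X.zero_closed by simp
    finally have 0: "hinner ?K q (S_left T F S \<rho> \<sigma> \<tau> m) = 0" .
    have "S_left T F S \<rho> \<sigma> \<tau> m \<in> hcarrier ?K" unfolding SL by (rule A.A_closed[OF op[OF m]])
    then show ?thesis using 0 K.inner_sym[OF _ q] by simp
  qed
  have op_add: "?op (hadd ?X3 m n) = hadd (F (\<rho> \<boxtimes> \<sigma>) \<otimes>\<^sub>H F \<tau>) (?op m) (?op n)"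
    and op_scale: "?op (hscale ?X3 c m) = hscale (F (\<rho> \<boxtimes> \<sigma>) \<otimes>\<^sub>H F \<tau>) c (?op m)" for c m n
    by (auto simp: op_tensor_def fun_eq_iff)
  have SL_zero: "S_left T F S \<rho> \<sigma> \<tau> (hzero ?X3) = hzero ?K"
  proof -
    have "?op (hzero ?X3) = hzero (F (\<rho> \<boxtimes> \<sigma>) \<otimes>\<^sub>H F \<tau>)" by (simp add: op_tensor_def fun_eq_iff)
    then show ?thesis
      unfolding SL using hmaps_zero[OF A.H.pre_hilbert_space_axioms K.pre_hilbert_space_axioms A.A_hmaps] by simp
  qed
  \<comment> \<open>The projection of q is 0; it is written as the image of 0 because
    \<open>range_proj_eqI\<close> takes a preimage of the projection.\<close>
  have "E3 T F S \<rho> \<sigma> \<tau> q = S_left T F S \<rho> \<sigma> \<tau> (hzero ?X3)"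
    unfolding E3_def
  proof (rule range_proj_eqI[OF L.X.pre_hilbert_space_axioms K.pre_hilbert_space_axioms _ _ _ L.X.zero_closed q])
    show "S_left T F S \<rho> \<sigma> \<tau> m \<in> hcarrier ?K" if "m \<in> hcarrier ?X3" for m
      unfolding SL by (rule A.A_closed[OF op[OF that]])
    show "S_left T F S \<rho> \<sigma> \<tau> (hadd ?X3 m n) = hadd ?K (S_left T F S \<rho> \<sigma> \<tau> m) (S_left T F S \<rho> \<sigma> \<tau> n)"
      if "m \<in> hcarrier ?X3" "n \<in> hcarrier ?X3" for m n
      unfolding SL op_add by (rule hmaps_add[OF A.A_hmaps op[OF that(1)] op[OF that(2)]])
    show "S_left T F S \<rho> \<sigma> \<tau> (hscale ?X3 c m) = hscale ?K c (S_left T F S \<rho> \<sigma> \<tau> m)"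
      if "m \<in> hcarrier ?X3" for c m
      unfolding SL op_scale by (rule hmaps_scale[OF A.A_hmaps op[OF that]])
    fix m assume m: "m \<in> hcarrier ?X3"
    have "S_left T F S \<rho> \<sigma> \<tau> m \<in> hcarrier ?K" unfolding SL by (rule A.A_closed[OF op[OF m]])
    then show "hinner ?K (S_left T F S \<rho> \<sigma> \<tau> m) (hsub ?K q (S_left T F S \<rho> \<sigma> \<tau> (hzero ?X3))) = 0"
      unfolding SL_zero using q perp[OF m]
      by (simp add: K.closed K.inner_add_right K.inner_scale_right K.inner_zero_right)
  qed
  then have E3q: "E3 T F S \<rho> \<sigma> \<tau> q = hzero ?K" by (simp only: SL_zero)
  let ?Ba = "adj (F \<rho> \<otimes>\<^sub>H F (\<sigma> \<boxtimes> \<tau>)) ?K ?B" and ?Aa = "adj (F (\<rho> \<boxtimes> \<sigma>) \<otimes>\<^sub>H F \<tau>) ?K ?A"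
  let ?Bq = "?B (?Ba q)"
  have Bq: "?Bq \<in> hcarrier ?K" by (intro B.A_closed B.A_adj_closed q)
  have E2B: "E2 T F S \<rho> (\<sigma> \<boxtimes> \<tau>) q = ?Bq"
    unfolding E2_def by (rule B.range_proj_eq[OF q])
  have E2A: "E2 T F S (\<rho> \<boxtimes> \<sigma>) \<tau> ?Bq = ?A (?Aa ?Bq)"
    unfolding E2_def ob by (rule A.range_proj_eq[OF Bq])
  \<comment> \<open>Since q lies in the range of \<open>?A\<close>, the projection onto that range
    disappears from the inner product with q. What remains is the squared norm of the adjoint of
    \<open>?B\<close> at q.\<close>
  have "hinner ?K q (?A (?Aa ?Bq)) = hinner (F (\<rho> \<boxtimes> \<sigma>) \<otimes>\<^sub>H F \<tau>) ty (?Aa ?Bq)"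
    unfolding q_def by (rule A.A_inner[OF ty A.A_adj_closed[OF Bq[unfolded q_def]]])
  also have "\<dots> = hinner ?K q ?Bq"
    unfolding q_def by (rule A.inner_A_adj[OF ty Bq[unfolded q_def], symmetric])
  also have "\<dots> = hinner (F \<rho> \<otimes>\<^sub>H F (\<sigma> \<boxtimes> \<tau>)) (?Ba q) (?Ba q)"
    by (rule B.A_adj_inner[OF q B.A_adj_closed[OF q], symmetric])
  also have "\<dots> = of_real ((hnorm (F \<rho> \<otimes>\<^sub>H F (\<sigma> \<boxtimes> \<tau>)) (?Ba q))\<^sup>2)"
    by (rule B.H.inner_self[OF B.A_adj_closed[OF q]])
  finally have AB: "hinner ?K q (?A (?Aa ?Bq)) = of_real ((hnorm (F \<rho> \<otimes>\<^sub>H F (\<sigma> \<boxtimes> \<tau>)) (?Ba q))\<^sup>2)" .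
  have "hinner ?K q (hzero ?K) - hinner ?K q (?A (?Aa ?Bq)) \<in> \<real>\<^sub>\<ge>\<^sub>0"
    using E_le[OF r s t] q unfolding op_le_def o_def by (metis E3q E2B E2A)
  then have "(hnorm (F \<rho> \<otimes>\<^sub>H F (\<sigma> \<boxtimes> \<tau>)) (?Ba q))\<^sup>2 \<le> 0"
    unfolding AB K.inner_zero_right[OF q] by (simp add: complex_nonneg_Reals_iff)
  then have "?Ba q = hzero (F \<rho> \<otimes>\<^sub>H F (\<sigma> \<boxtimes> \<tau>))"
    using B.H.norm_eq_zero[OF B.A_adj_closed[OF q]] by simp
  then have qb: "hinner ?K q (?B \<beta>) = 0"
    using B.A_adj_inner[OF q \<beta>] B.H.inner_zero_left[OF \<beta>] by simp
  have "x = hadd (F (\<rho> \<boxtimes> \<sigma>)) x' y"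
    by (rule Frs.eq_if_inner_eq) (use x x' in \<open>auto simp: y_def Frs.closed Frs.inner_add_right Frs.inner_scale_right\<close>)
  then have "vtensor (F (\<rho> \<boxtimes> \<sigma>)) (F \<tau>) x w
      = hadd (F (\<rho> \<boxtimes> \<sigma>) \<otimes>\<^sub>H F \<tau>) (vtensor (F (\<rho> \<boxtimes> \<sigma>)) (F \<tau>) x' w) ty"
    using RST.vtensor_add_left[OF x' y w] by (simp only: ty_def)
  moreover have tx': "vtensor (F (\<rho> \<boxtimes> \<sigma>)) (F \<tau>) x' w \<in> hcarrier (F (\<rho> \<boxtimes> \<sigma>) \<otimes>\<^sub>H F \<tau>)"
    using RST.vtensor_hs[OF x' w] by simp
  ultimately have "?A (vtensor (F (\<rho> \<boxtimes> \<sigma>)) (F \<tau>) x w) = hadd ?K (?A (vtensor (F (\<rho> \<boxtimes> \<sigma>)) (F \<tau>) x' w)) q"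
    using hmaps_add[OF A.A_hmaps tx' ty] by (simp only: q_def)
  then show ?thesis
    using K.inner_add_left[OF A.A_closed[OF tx'] q B.A_closed[OF \<beta>]] qb by simp
qed

lemma S_assoc_vector:
  assumes r: "\<rho> \<in> Ob T" and s: "\<sigma> \<in> Ob T" and t: "\<tau> \<in> Ob T"
    and u: "u \<in> hcarrier (F \<rho>)" and v: "v \<in> hcarrier (F \<sigma>)" and w: "w \<in> hcarrier (F \<tau>)"
  shows "S (\<rho> \<boxtimes> \<sigma>) \<tau> (vtensor (F (\<rho> \<boxtimes> \<sigma>)) (F \<tau>) (S \<rho> \<sigma> (vtensor (F \<rho>) (F \<sigma>) u v)) w)
    = S \<rho> (\<sigma> \<boxtimes> \<tau>) (vtensor (F \<rho>) (F (\<sigma> \<boxtimes> \<tau>)) u (S \<sigma> \<tau> (vtensor (F \<sigma>) (F \<tau>) v w)))"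
proof -
  note rs = tob_closed[OF r s] and st = tob_closed[OF s t]
  interpret RS: hs_tensor "F \<rho>" "F \<sigma>" by (rule F_tensor[OF r s])
  interpret ST: hs_tensor "F \<sigma>" "F \<tau>" by (rule F_tensor[OF s t])
  note hm = isometry_hmaps[OF S_isometry]
  have uv: "vtensor (F \<rho>) (F \<sigma>) u v \<in> hcarrier (F \<rho> \<otimes>\<^sub>H F \<sigma>)" using RS.vtensor_hs[OF u v] by simp
  have vw: "vtensor (F \<sigma>) (F \<tau>) v w \<in> hcarrier (F \<sigma> \<otimes>\<^sub>H F \<tau>)" using ST.vtensor_hs[OF v w] by simp
  show ?thesis
    using S_assoc[OF r s t u v w]
      op_tensor_vtensor[OF RS.X.riesz_space_axioms F_pre_hilbert[OF rs] F_riesz[OF t] F_pre_hilbert[OF t]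
        hm[OF r s] id_hmaps uv w]
      op_tensor_vtensor[OF F_riesz[OF r] F_pre_hilbert[OF r] ST.X.riesz_space_axioms F_pre_hilbert[OF st]
        id_hmaps hm[OF s t] u vw]
    by (simp add: S_left_def S_right_def)
qed

section \<open>The image of the conjugate equation\<close>

text \<open>The unit law writes w as S (\<Omega> \<otimes> w); naturality of S for x and the
  identity of \<tau> then moves \<open>FA\<close> inside.\<close>

lemma FA_tensor_id:
  assumes s: "\<sigma> \<in> Ob T" and t: "\<tau> \<in> Ob T" and x: "x \<in> Hom T (Unit T) \<sigma>" and w: "w \<in> hcarrier (F \<tau>)"
  shows "FA (x \<otimes> Id T \<tau>) w = S \<sigma> \<tau> (vtensor (F \<sigma>) (F \<tau>) (FA x \<Omega>) w)"
proof -
  note u = unit_closed and it = id_closed[OF t]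
  interpret hs_tensor "F (Unit T)" "F \<tau>" by (rule F_tensor[OF u t])
  have c: "vtensor (F (Unit T)) (F \<tau>) \<Omega> w \<in> hcarrier (F (Unit T) \<otimes>\<^sub>H F \<tau>)"
    using vtensor_hs[OF unit_vector(1) w] by simp
  show ?thesis
    using S_natural[OF u s t t x it c]
      op_tensor_vtensor[OF F_riesz[OF u] F_pre_hilbert[OF s] F_riesz[OF t] F_pre_hilbert[OF t]
        maps[OF u s x] maps[OF t t it] unit_vector(1) w]
    by (simp add: S_unit_left_vector[OF t w] map_id[OF t w])
qed

lemma FA_id_tensor:
  assumes s: "\<sigma> \<in> Ob T" and t: "\<tau> \<in> Ob T" and x: "x \<in> Hom T (Unit T) \<sigma>" and w: "w \<in> hcarrier (F \<tau>)"
  shows "FA (Id T \<tau> \<otimes> x) w = S \<tau> \<sigma> (vtensor (F \<tau>) (F \<sigma>) w (FA x \<Omega>))"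
proof -
  note u = unit_closed and it = id_closed[OF t]
  interpret hs_tensor "F \<tau>" "F (Unit T)" by (rule F_tensor[OF t u])
  have c: "vtensor (F \<tau>) (F (Unit T)) w \<Omega> \<in> hcarrier (F \<tau> \<otimes>\<^sub>H F (Unit T))"
    using vtensor_hs[OF w unit_vector(1)] by simp
  show ?thesis
    using S_natural[OF t t u s it x c]
      op_tensor_vtensor[OF F_riesz[OF t] F_pre_hilbert[OF t] F_riesz[OF u] F_pre_hilbert[OF s]
        maps[OF t t it] maps[OF u s x] w unit_vector(1)]
    by (simp add: S_unit_right_vector[OF t w] map_id[OF t w])
qed

text \<open>This is \<open>\<langle>x \<otimes> w, v \<otimes> y\<rangle>\<close> computed in \<open>F \<rho> \<otimes> F \<sigma> \<otimes> F \<tau>\<close>, for the projections of \<open>x\<close> and \<open>y\<close>.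
  The functional \<open>\<zeta> \<mapsto> \<langle>S (v \<otimes> y), S (S \<zeta> \<otimes> w)\<rangle>\<close> is represented by some \<open>\<psi>\<close>, which is determined by
  its values on simple tensors, where associativity applies.\<close>

lemma inner_S_S_has_sum:
  assumes r: "\<rho> \<in> Ob T" and s: "\<sigma> \<in> Ob T" and t: "\<tau> \<in> Ob T"
    and x: "x \<in> hcarrier (F (\<rho> \<boxtimes> \<sigma>))" and y: "y \<in> hcarrier (F (\<sigma> \<boxtimes> \<tau>))"
    and v: "v \<in> hcarrier (F \<rho>)" and w: "w \<in> hcarrier (F \<tau>)"
  defines "x' \<equiv> adj (F \<rho> \<otimes>\<^sub>H F \<sigma>) (F (\<rho> \<boxtimes> \<sigma>)) (S \<rho> \<sigma>) x"
    and "y' \<equiv> adj (F \<sigma> \<otimes>\<^sub>H F \<tau>) (F (\<sigma> \<boxtimes> \<tau>)) (S \<sigma> \<tau>) y"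
  shows "((\<lambda>(e, f). cnj (x' e f) * (hinner (F \<rho>) e v * y' f w)) has_sum
      hinner (F (\<rho> \<boxtimes> \<sigma> \<boxtimes> \<tau>)) (S (\<rho> \<boxtimes> \<sigma>) \<tau> (vtensor (F (\<rho> \<boxtimes> \<sigma>)) (F \<tau>) x w))
        (S \<rho> (\<sigma> \<boxtimes> \<tau>) (vtensor (F \<rho>) (F (\<sigma> \<boxtimes> \<tau>)) v y))) (onb (F \<rho>) \<times> onb (F \<sigma>))"
proof -
  let ?K = "F (\<rho> \<boxtimes> \<sigma> \<boxtimes> \<tau>)" and ?A = "S (\<rho> \<boxtimes> \<sigma>) \<tau>" and ?B = "S \<rho> (\<sigma> \<boxtimes> \<tau>)"
  note rs = tob_closed[OF r s] and st = tob_closed[OF s t]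
  note ob = tob_assoc[OF r s t]
  interpret RS: hs_tensor "F \<rho>" "F \<sigma>" by (rule F_tensor[OF r s])
  interpret ST: hs_tensor "F \<sigma>" "F \<tau>" by (rule F_tensor[OF s t])
  interpret RST: hs_tensor "F (\<rho> \<boxtimes> \<sigma>)" "F \<tau>" by (rule F_tensor[OF rs t])
  interpret R_ST: hs_tensor "F \<rho>" "F (\<sigma> \<boxtimes> \<tau>)" by (rule F_tensor[OF r st])
  interpret K: pre_hilbert_space ?K by (rule F_pre_hilbert[OF tob_closed[OF r st]])
  interpret S0: hilbert_isometry "F \<rho> \<otimes>\<^sub>H F \<sigma>" "F (\<rho> \<boxtimes> \<sigma>)" "S \<rho> \<sigma>" by (rule S_hilbert_isometry[OF r s])
  interpret S1: hilbert_isometry "F \<sigma> \<otimes>\<^sub>H F \<tau>" "F (\<sigma> \<boxtimes> \<tau>)" "S \<sigma> \<tau>" by (rule S_hilbert_isometry[OF s t])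
  interpret A: hilbert_isometry "F (\<rho> \<boxtimes> \<sigma>) \<otimes>\<^sub>H F \<tau>" ?K ?A
    using S_hilbert_isometry[OF rs t] by (simp only: ob)
  interpret B: hilbert_isometry "F \<rho> \<otimes>\<^sub>H F (\<sigma> \<boxtimes> \<tau>)" ?K ?B by (rule S_hilbert_isometry[OF r st])
  have vy: "vtensor (F \<rho>) (F (\<sigma> \<boxtimes> \<tau>)) v y \<in> hcarrier (F \<rho> \<otimes>\<^sub>H F (\<sigma> \<boxtimes> \<tau>))"
    using R_ST.vtensor_hs[OF v y] by simp
  define b where "b = ?B (vtensor (F \<rho>) (F (\<sigma> \<boxtimes> \<tau>)) v y)"
  have b: "b \<in> hcarrier ?K" unfolding b_def by (rule B.A_closed[OF vy])
  define j where "j \<zeta> = ?A (vtensor (F (\<rho> \<boxtimes> \<sigma>)) (F \<tau>) (S \<rho> \<sigma> \<zeta>) w)" for \<zeta>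
  have Sw: "vtensor (F (\<rho> \<boxtimes> \<sigma>)) (F \<tau>) (S \<rho> \<sigma> \<zeta>) w \<in> hcarrier (F (\<rho> \<boxtimes> \<sigma>) \<otimes>\<^sub>H F \<tau>)"
    if "\<zeta> \<in> hcarrier (F \<rho> \<otimes>\<^sub>H F \<sigma>)" for \<zeta>
    using RST.vtensor_hs[OF S0.A_closed[OF that] w] by simp
  have j_closed: "j \<zeta> \<in> hcarrier ?K" if "\<zeta> \<in> hcarrier (F \<rho> \<otimes>\<^sub>H F \<sigma>)" for \<zeta>
    unfolding j_def by (rule A.A_closed[OF Sw[OF that]])
  have "j \<in> hmaps (F \<rho> \<otimes>\<^sub>H F \<sigma>) ?K"
    unfolding hmaps_def
  proof (intro CollectI conjI ballI allI exI)
    fix \<zeta> assume z: "\<zeta> \<in> hcarrier (F \<rho> \<otimes>\<^sub>H F \<sigma>)"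
    show "j \<zeta> \<in> hcarrier ?K" by (rule j_closed[OF z])
    show "j (hscale (F \<rho> \<otimes>\<^sub>H F \<sigma>) c \<zeta>) = hscale ?K c (j \<zeta>)" for c
      unfolding j_def hmaps_scale[OF S0.A_hmaps z] RST.vtensor_scale_left[OF S0.A_closed[OF z] w]
      by (rule hmaps_scale[OF A.A_hmaps Sw[OF z]])
    show "hnorm ?K (j \<zeta>) \<le> hnorm (F \<tau>) w * hnorm (F \<rho> \<otimes>\<^sub>H F \<sigma>) \<zeta>"
      unfolding j_def A.A_norm[OF Sw[OF z]] RST.norm_vtensor[OF S0.A_closed[OF z] w] S0.A_norm[OF z]
      by (simp add: mult.commute)
    fix \<zeta>' assume z': "\<zeta>' \<in> hcarrier (F \<rho> \<otimes>\<^sub>H F \<sigma>)"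
    show "j (hadd (F \<rho> \<otimes>\<^sub>H F \<sigma>) \<zeta> \<zeta>') = hadd ?K (j \<zeta>) (j \<zeta>')"
      unfolding j_def hmaps_add[OF S0.A_hmaps z z'] RST.vtensor_add_left[OF S0.A_closed[OF z] S0.A_closed[OF z'] w]
      by (rule hmaps_add[OF A.A_hmaps Sw[OF z] Sw[OF z']])
  qed
  then obtain \<psi> where psi: "\<psi> \<in> hcarrier (F \<rho> \<otimes>\<^sub>H F \<sigma>)"
    and j_psi: "\<forall>\<zeta>\<in>hcarrier (F \<rho> \<otimes>\<^sub>H F \<sigma>). hinner ?K b (j \<zeta>) = hinner (F \<rho> \<otimes>\<^sub>H F \<sigma>) \<psi> \<zeta>"
    using RS.X.riesz[OF linear_functional_hmaps[OF RS.X.pre_hilbert_space_axioms K.pre_hilbert_space_axioms _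
        K.linear_functional_inner[OF b]]] by blast
  have psi_inner: "hinner (F \<rho> \<otimes>\<^sub>H F \<sigma>) \<zeta> \<psi> = hinner ?K (j \<zeta>) b"
    if z: "\<zeta> \<in> hcarrier (F \<rho> \<otimes>\<^sub>H F \<sigma>)" for \<zeta>
    using j_psi z RS.X.inner_sym[OF z psi] K.inner_sym[OF j_closed[OF z] b] by simp
  have psi_eq: "\<psi> e f = hinner (F \<rho>) e v * y' f w" if e: "e \<in> hcarrier (F \<rho>)" and f: "f \<in> hcarrier (F \<sigma>)" for e f
  proof -
    have ef: "vtensor (F \<rho>) (F \<sigma>) e f \<in> hcarrier (F \<rho> \<otimes>\<^sub>H F \<sigma>)" using RS.vtensor_hs[OF e f] by simp
    have fw: "vtensor (F \<sigma>) (F \<tau>) f w \<in> hcarrier (F \<sigma> \<otimes>\<^sub>H F \<tau>)" using ST.vtensor_hs[OF f w] by simp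
    have efw: "vtensor (F \<rho>) (F (\<sigma> \<boxtimes> \<tau>)) e (S \<sigma> \<tau> (vtensor (F \<sigma>) (F \<tau>) f w)) \<in> hcarrier (F \<rho> \<otimes>\<^sub>H F (\<sigma> \<boxtimes> \<tau>))"
      using R_ST.vtensor_hs[OF e S1.A_closed[OF fw]] by simp
    have "\<psi> e f = hinner (F \<rho> \<otimes>\<^sub>H F \<sigma>) (vtensor (F \<rho>) (F \<sigma>) e f) \<psi>"
      using RS.inner_vtensor[OF e f] psi by simp
    also have "\<dots> = hinner ?K (?B (vtensor (F \<rho>) (F (\<sigma> \<boxtimes> \<tau>)) e (S \<sigma> \<tau> (vtensor (F \<sigma>) (F \<tau>) f w)))) b"
      by (simp only: psi_inner[OF ef] j_def S_assoc_vector[OF r s t e f w])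
    also have "\<dots> = hinner (F \<rho>) e v * hinner (F (\<sigma> \<boxtimes> \<tau>)) (S \<sigma> \<tau> (vtensor (F \<sigma>) (F \<tau>) f w)) y"
      unfolding b_def B.A_inner[OF efw vy] by (rule R_ST.inner_vtensor_vtensor[OF e S1.A_closed[OF fw] v y])
    also have "hinner (F (\<sigma> \<boxtimes> \<tau>)) (S \<sigma> \<tau> (vtensor (F \<sigma>) (F \<tau>) f w)) y = y' f w"
      unfolding S1.inner_A_adj[OF fw y] using ST.inner_vtensor[OF f w] S1.A_adj_closed[OF y]
      by (simp add: y'_def)
    finally show ?thesis .
  qed
  have x': "x' \<in> hcarrier (F \<rho> \<otimes>\<^sub>H F \<sigma>)" unfolding x'_def by (rule S0.A_adj_closed[OF x])
  \<comment> \<open>\<open>j x'\<close> is the vector obtained from S (x \<otimes> w) on replacing x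
    by its projection, so \<open>inner_S_project\<close> applies with \<open>\<beta>\<close> the
    simple tensor of v and y.\<close>
  have "hinner ?K (?A (vtensor (F (\<rho> \<boxtimes> \<sigma>)) (F \<tau>) x w)) b = hinner (F \<rho> \<otimes>\<^sub>H F \<sigma>) x' \<psi>"
    unfolding psi_inner[OF x'] unfolding b_def j_def x'_def by (rule inner_S_project[OF r s t x w vy])
  moreover have "((\<lambda>p. cnj (case_prod x' p) * case_prod \<psi> p) has_sum hinner (F \<rho> \<otimes>\<^sub>H F \<sigma>) x' \<psi>)
      (onb (F \<rho>) \<times> onb (F \<sigma>))"
    using x' psi by (intro hs_inner_has_sum) simp_all
  ultimately have "((\<lambda>p. cnj (case_prod x' p) * case_prod \<psi> p) has_sum
      hinner ?K (?A (vtensor (F (\<rho> \<boxtimes> \<sigma>)) (F \<tau>) x w)) b) (onb (F \<rho>) \<times> onb (F \<sigma>))" by simp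
  then show ?thesis
    unfolding b_def by (rule has_sum_cong[THEN iffD1, rotated]) (auto simp: psi_eq RS.H.onb_closed RS.K.onb_closed)
qed

text \<open>This is the conjugate equation \<open>(Rbhat\<^sup>* \<otimes> 1) \<circ> (1 \<otimes> Rhat) = 1\<close>, tested on the basis vector
  \<open>e\<close>.\<close>

lemma hat_conjugate:
  assumes r: "\<rho> \<in> Ob T" and rb: "\<rho>b \<in> Ob T" and conj: "conjugate_by T \<rho> \<rho>b R Rb"
    and e: "e \<in> onb (F \<rho>)"
  shows "((\<lambda>f. cnj (hat T F FA \<Omega> S \<rho> \<rho>b Rb e f) * hat T F FA \<Omega> S \<rho>b \<rho> R f e) has_sum 1) (onb (F \<rho>b))"
proof -
  interpret H: riesz_space "F \<rho>" by (rule F_riesz[OF r])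
  note u = unit_closed and rrb = tob_closed[OF r rb] and rbr = tob_closed[OF rb r]
  note ob = tob_assoc[OF r rb r] and rid = id_closed[OF r]
  have ec: "e \<in> hcarrier (F \<rho>)" by (rule H.onb_closed[OF e])
  have R: "R \<in> Hom T (Unit T) (\<rho>b \<boxtimes> \<rho>)" and Rb: "Rb \<in> Hom T (Unit T) (\<rho> \<boxtimes> \<rho>b)"
    and eq: "(Star T Rb \<otimes> Id T \<rho>) \<odot> (Id T \<rho> \<otimes> R) = Id T \<rho>"
    using conj by (simp_all add: conjugate_by_def)
  let ?K = "F (\<rho> \<boxtimes> \<rho>b \<boxtimes> \<rho>)"
  interpret K: pre_hilbert_space ?K by (rule F_pre_hilbert[OF tob_closed[OF r rbr]])
  have X: "Rb \<otimes> Id T \<rho> \<in> Hom T \<rho> (\<rho> \<boxtimes> \<rho>b \<boxtimes> \<rho>)"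
    using tar_closed[OF u rrb r r Rb rid] tob_unit[OF r] by (simp add: ob)
  have Y: "Id T \<rho> \<otimes> R \<in> Hom T \<rho> (\<rho> \<boxtimes> \<rho>b \<boxtimes> \<rho>)"
    using tar_closed[OF r r u rbr rid R] tob_unit[OF r] by simp
  have star: "Star T Rb \<otimes> Id T \<rho> = Star T (Rb \<otimes> Id T \<rho>)"
    using tar_star[OF u rrb r r Rb rid] by (simp add: star_id[OF r])
  note kk = tob_closed[OF r rbr]
  have b: "FA (Id T \<rho> \<otimes> R) e \<in> hcarrier ?K" by (rule hmaps_closed[OF maps[OF r kk Y] ec])
  have "e = FA (Id T \<rho>) e" by (rule map_id[OF r ec, symmetric])
  also have "\<dots> = FA (Star T (Rb \<otimes> Id T \<rho>)) (FA (Id T \<rho> \<otimes> R) e)"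
    using map_comp[OF r kk r Y star_closed[OF r kk X] ec] by (simp only: eq[unfolded star])
  also have "\<dots> = adj (F \<rho>) ?K (FA (Rb \<otimes> Id T \<rho>)) (FA (Id T \<rho> \<otimes> R) e)"
    by (rule map_star[OF r kk X b])
  finally have "hinner (F \<rho>) e e = hinner ?K (FA (Id T \<rho> \<otimes> R) e) (FA (Rb \<otimes> Id T \<rho>) e)"
    using adj_inner[OF H.riesz_space_axioms K.pre_hilbert_space_axioms maps[OF r kk X] b ec] by simp
  then have "hinner ?K (FA (Rb \<otimes> Id T \<rho>) e) (FA (Id T \<rho> \<otimes> R) e) = 1"
    using K.inner_sym[OF hmaps_closed[OF maps[OF r kk X] ec] b] e by (simp add: H.onb_inner)
  then have one: "hinner ?K (S (\<rho> \<boxtimes> \<rho>b) \<rho> (vtensor (F (\<rho> \<boxtimes> \<rho>b)) (F \<rho>) (FA Rb \<Omega>) e))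
      (S \<rho> (\<rho>b \<boxtimes> \<rho>) (vtensor (F \<rho>) (F (\<rho>b \<boxtimes> \<rho>)) e (FA R \<Omega>))) = 1"
    by (simp only: FA_tensor_id[OF rrb r Rb ec] FA_id_tensor[OF rbr r R ec])
  have "((\<lambda>p. case p of (e', f) \<Rightarrow> cnj (hat T F FA \<Omega> S \<rho> \<rho>b Rb e' f)
      * (hinner (F \<rho>) e' e * hat T F FA \<Omega> S \<rho>b \<rho> R f e)) has_sum 1) (onb (F \<rho>) \<times> onb (F \<rho>b))"
    using inner_S_S_has_sum[OF r rb r hmaps_closed[OF maps[OF u rrb Rb] unit_vector(1)]
        hmaps_closed[OF maps[OF u rbr R] unit_vector(1)] ec ec] one
    unfolding hat_def by simp
  \<comment> \<open>The factor \<open>hinner (F \<rho>) e' e\<close> vanishes unless e' = e, which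
    reduces the double sum to the slice over e.\<close>
  then have "((\<lambda>p. cnj (hat T F FA \<Omega> S \<rho> \<rho>b Rb (fst p) (snd p)) * hat T F FA \<Omega> S \<rho>b \<rho> R (snd p) e) has_sum 1)
      ((\<lambda>f. (e, f)) ` onb (F \<rho>b))"
    by (rule has_sum_cong_neutral[THEN iffD1, rotated -1]) (use e in \<open>auto simp: H.onb_inner\<close>)
  then show ?thesis
    by (subst (asm) has_sum_reindex) (auto simp: inj_on_def o_def)
qed

section \<open>Norms of the vectors F(R) \<Omega> and F(Rb) \<Omega>, and the conclusion\<close>

text \<open>As (\<iota>, \<iota>) = \<complex>, the morphism \<open>Star T x \<odot> x\<close> is a
  scalar c times the identity. The C*-identity shows that |c| is the squared norm of x, and applying
  F shows that it is the squared norm of the vector \<open>FA x \<Omega>\<close>.\<close>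

lemma norm_FA_unit:
  assumes irr: "irreducible_unit T" and s: "\<sigma> \<in> Ob T" and x: "x \<in> Hom T (Unit T) \<sigma>"
  shows "hnorm (F \<sigma>) (FA x \<Omega>) = Norm T x"
proof -
  note u = unit_closed
  interpret I: riesz_space "F (Unit T)" by (rule F_unit_riesz)
  interpret H: riesz_space "F \<sigma>" by (rule F_riesz[OF s])
  interpret B: cbanach_space_on "Hom T (Unit T) (Unit T)" "Add T" "Zero T (Unit T) (Unit T)" "Scale T" "Norm T"
    by (rule hom_banach[OF u u])
  interpret C: cbanach_space_on "Hom T (Unit T) \<sigma>" "Add T" "Zero T (Unit T) \<sigma>" "Scale T" "Norm T"
    by (rule hom_banach[OF u s])
  note sx = star_closed[OF u s x] and iu = id_closed[OF u]
  have fx: "FA x \<Omega> \<in> hcarrier (F \<sigma>)" by (rule hmaps_closed[OF maps[OF u s x] unit_vector(1)])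
  obtain c where c: "Star T x \<odot> x = Scale T c (Id T (Unit T))"
    using comp_closed[OF u s u x sx] irr by (auto simp: irreducible_unit_def)
  have "hscale (F (Unit T)) c \<Omega> = FA (Star T x) (FA x \<Omega>)"
    using map_comp[OF u s u x sx unit_vector(1)] map_scale[OF u u iu unit_vector(1)] map_id[OF u unit_vector(1)]
    by (simp add: c)
  also have "\<dots> = adj (F (Unit T)) (F \<sigma>) (FA x) (FA x \<Omega>)" by (rule map_star[OF u s x fx])
  finally have "hinner (F (Unit T)) (hscale (F (Unit T)) c \<Omega>) \<Omega> = hinner (F \<sigma>) (FA x \<Omega>) (FA x \<Omega>)"
    using adj_inner[OF I.riesz_space_axioms H.pre_hilbert_space_axioms maps[OF u s x] fx unit_vector(1)] by simp
  then have "cnj c = complex_of_real ((hnorm (F \<sigma>) (FA x \<Omega>))\<^sup>2)"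
    using unit_vector(1) by (simp add: I.inner_scale_left inner_unit_vector H.inner_self[OF fx] del: of_real_power)
  then have "cmod c = (hnorm (F \<sigma>) (FA x \<Omega>))\<^sup>2"
    by (metis complex_mod_cnj norm_of_real abs_of_nonneg zero_le_power2)
  moreover have "cmod c = (Norm T x)\<^sup>2"
    using cstar[OF u s x] norm_id[OF u] irr B.nrm_scale[OF iu, of c] by (simp add: c irreducible_unit_def)
  ultimately show ?thesis
    using C.nrm_nonneg[OF x] H.norm_nonneg[OF fx] by (metis power2_eq_imp_eq)
qed

text \<open>If one of \<open>R\<close>, \<open>Rb\<close> vanishes, then \<open>1\<^bsub>\<rho>\<^esub> = 0\<close>, so the other one vanishes as well.\<close>

lemma conjugate_zero:
  assumes r: "\<rho> \<in> Ob T" and rb: "\<rho>b \<in> Ob T" and conj: "conjugate_by T \<rho> \<rho>b R Rb"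
    and zero: "Norm T R = 0 \<or> Norm T Rb = 0"
  shows "FA R \<Omega> = hzero (F (\<rho>b \<boxtimes> \<rho>))" "FA Rb \<Omega> = hzero (F (\<rho> \<boxtimes> \<rho>b))"
proof -
  note u = unit_closed and rrb = tob_closed[OF r rb] and rbr = tob_closed[OF rb r]
  note rid = id_closed[OF r] and rbid = id_closed[OF rb]
  have R: "R \<in> Hom T (Unit T) (\<rho>b \<boxtimes> \<rho>)" and Rb: "Rb \<in> Hom T (Unit T) (\<rho> \<boxtimes> \<rho>b)"
    and eq: "(Star T Rb \<otimes> Id T \<rho>) \<odot> (Id T \<rho> \<otimes> R) = Id T \<rho>"
    using conj by (simp_all add: conjugate_by_def)
  have X: "Star T Rb \<otimes> Id T \<rho> \<in> Hom T (\<rho> \<boxtimes> \<rho>b \<boxtimes> \<rho>) \<rho>"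
    using tar_closed[OF rrb u r r star_closed[OF u rrb Rb] rid] tob_unit[OF r] tob_assoc[OF r rb r] by simp
  have Y: "Id T \<rho> \<otimes> R \<in> Hom T \<rho> (\<rho> \<boxtimes> \<rho>b \<boxtimes> \<rho>)"
    using tar_closed[OF r r u rbr rid R] tob_unit[OF r] by simp
  note comp = comp_scale[OF r tob_closed[OF r rbr] r Y X]
  have id0: "Id T \<rho> = Scale T 0 (Id T \<rho>)"
    using zero
  proof
    assume "Norm T R = 0"
    then have "R = Scale T 0 R" by (rule eq_scale_zero[OF u rbr R])
    then have "Id T \<rho> \<otimes> R = Scale T 0 (Id T \<rho> \<otimes> R)"
      using tar_scale[OF r r u rbr rid R, of 0] by metis
    then show ?thesis using comp[of 0] eq by metis
  next
    assume "Norm T Rb = 0"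
    then have "Rb = Scale T 0 Rb" by (rule eq_scale_zero[OF u rrb Rb])
    then have "Star T Rb = Scale T 0 (Star T Rb)"
      using star_scale[OF u rrb Rb, of 0] by (metis complex_cnj_zero)
    then have "Star T Rb \<otimes> Id T \<rho> = Scale T 0 (Star T Rb \<otimes> Id T \<rho>)"
      using tar_scale[OF rrb u r r star_closed[OF u rrb Rb] rid, of 0] by metis
    then show ?thesis using comp[of 0] eq by metis
  qed
  \<comment> \<open>F sends the identity of \<sigma> to the identity operator, so a vanishing
    identity makes F \<sigma> the zero space.\<close>
  have FA_zero: "FA x \<Omega> = hzero (F \<sigma>)"
    if s: "\<sigma> \<in> Ob T" and x: "x \<in> Hom T (Unit T) \<sigma>" and id: "Id T \<sigma> = Scale T 0 (Id T \<sigma>)" for x \<sigma>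
  proof -
    interpret H: pre_hilbert_space "F \<sigma>" by (rule F_pre_hilbert[OF s])
    have fx: "FA x \<Omega> \<in> hcarrier (F \<sigma>)" by (rule hmaps_closed[OF maps[OF u s x] unit_vector(1)])
    have "FA x \<Omega> = FA (Id T \<sigma>) (FA x \<Omega>)" by (rule map_id[OF s fx, symmetric])
    also have "\<dots> = hscale (F \<sigma>) 0 (FA (Id T \<sigma>) (FA x \<Omega>))"
      using map_scale[OF s s id_closed[OF s] fx, of 0] id by metis
    finally show ?thesis using map_id[OF s fx] H.scale_zero[OF fx] by simp
  qed
  have "Id T (\<rho>b \<boxtimes> \<rho>) = Scale T 0 (Id T (\<rho>b \<boxtimes> \<rho>))"
    using tar_scale[OF rb rb r r rbid rid, of 0] tar_id[OF rb r] id0 by metis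
  then show "FA R \<Omega> = hzero (F (\<rho>b \<boxtimes> \<rho>))" by (rule FA_zero[OF rbr R])
  have "Id T (\<rho> \<boxtimes> \<rho>b) = Scale T 0 (Id T (\<rho> \<boxtimes> \<rho>b))"
    using tar_scale[OF r r rb rb rid rbid, of 0] tar_id[OF r rb] id0 by metis
  then show "FA Rb \<Omega> = hzero (F (\<rho> \<boxtimes> \<rho>b))" by (rule FA_zero[OF rrb Rb])
qed

lemma hdim_le_hat:
  assumes r: "\<rho> \<in> Ob T" and rb: "\<rho>b \<in> Ob T" and conj: "conjugate_by T \<rho> \<rho>b R Rb"
  shows "ereal_of_enat (hdim (F \<rho>)) \<le> ereal (hnorm (F \<rho>b \<otimes>\<^sub>H F \<rho>) (hat T F FA \<Omega> S \<rho>b \<rho> R)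
    * hnorm (F \<rho> \<otimes>\<^sub>H F \<rho>b) (hat T F FA \<Omega> S \<rho> \<rho>b Rb))"
proof (rule hdim_le_if_conjugate[OF F_pre_hilbert[OF r]])
  note u = unit_closed and rrb = tob_closed[OF r rb] and rbr = tob_closed[OF rb r]
  interpret S1: hilbert_isometry "F \<rho> \<otimes>\<^sub>H F \<rho>b" "F (\<rho> \<boxtimes> \<rho>b)" "S \<rho> \<rho>b" by (rule S_hilbert_isometry[OF r rb])
  interpret S2: hilbert_isometry "F \<rho>b \<otimes>\<^sub>H F \<rho>" "F (\<rho>b \<boxtimes> \<rho>)" "S \<rho>b \<rho>" by (rule S_hilbert_isometry[OF rb r])
  have R: "R \<in> Hom T (Unit T) (\<rho>b \<boxtimes> \<rho>)" and Rb: "Rb \<in> Hom T (Unit T) (\<rho> \<boxtimes> \<rho>b)"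
    using conj by (simp_all add: conjugate_by_def)
  show "hat T F FA \<Omega> S \<rho>b \<rho> R \<in> hs_functionals (F \<rho>b) (F \<rho>)"
    using S2.A_adj_closed[OF hmaps_closed[OF maps[OF u rbr R] unit_vector(1)]] by (simp add: hat_def)
  show "hat T F FA \<Omega> S \<rho> \<rho>b Rb \<in> hs_functionals (F \<rho>) (F \<rho>b)"
    using S1.A_adj_closed[OF hmaps_closed[OF maps[OF u rrb Rb] unit_vector(1)]] by (simp add: hat_def)
  fix e assume "e \<in> onb (F \<rho>)"
  \<comment> \<open>Complex conjugation moves the conjugate from \<open>Rbhat\<close> to
    \<open>Rhat\<close>, as \<open>hdim_le_if_conjugate\<close> requires here; the sum 1 is
    real.\<close>
  then have "((\<lambda>f. cnj (cnj (hat T F FA \<Omega> S \<rho> \<rho>b Rb e f) * hat T F FA \<Omega> S \<rho>b \<rho> R f e)) has_sum cnj 1) (onb (F \<rho>b))"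
    unfolding has_sum_cnj_iff by (rule hat_conjugate[OF r rb conj])
  then show "((\<lambda>f. cnj (hat T F FA \<Omega> S \<rho>b \<rho> R f e) * hat T F FA \<Omega> S \<rho> \<rho>b Rb e f) has_sum 1) (onb (F \<rho>b))"
    by (simp add: mult.commute)
qed

end

theorem corollary3p8:
  fixes T :: "('o, 'm) tensor_cat"
    and F :: "'o \<Rightarrow> 'h hilb" and FA :: "'m \<Rightarrow> 'h \<Rightarrow> 'h" and \<Omega> :: 'h
    and S :: "'o \<Rightarrow> 'o \<Rightarrow> ('h \<Rightarrow> 'h \<Rightarrow> complex) \<Rightarrow> 'h"
    and \<rho> \<rho>b :: 'o and R Rb :: 'm
    and Rhat Rbhat :: "'h \<Rightarrow> 'h \<Rightarrow> complex"
    and d dhat :: real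
  assumes "strict_tensor_cstar_category T"
    and "irreducible_unit T"
    and "quasitensor_functor T F FA \<Omega> S"
    and "\<rho> \<in> Ob T" and "\<rho>b \<in> Ob T"
    and "conjugate_by T \<rho> \<rho>b R Rb"
  defines "Rhat \<equiv> hat T F FA \<Omega> S \<rho>b \<rho> R"
    and "Rbhat \<equiv> hat T F FA \<Omega> S \<rho> \<rho>b Rb"
    and "d \<equiv> Norm T R * Norm T Rb"
    and "dhat \<equiv> hnorm (F \<rho>b \<otimes>\<^sub>H F \<rho>) Rhat * hnorm (F \<rho> \<otimes>\<^sub>H F \<rho>b) Rbhat"
  shows "ereal_of_enat (hdim (F \<rho>)) \<le> ereal dhat \<and> dhat \<le> d
    \<and> (dhat = d \<longleftrightarrow> FA R \<Omega> \<in> S \<rho>b \<rho> ` hcarrier (F \<rho>b \<otimes>\<^sub>H F \<rho>)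
                   \<and> FA Rb \<Omega> \<in> S \<rho> \<rho>b ` hcarrier (F \<rho> \<otimes>\<^sub>H F \<rho>b))"
proof -
  interpret quasitensor_functor T F FA \<Omega> S by fact
  note irr = assms(2) and r = assms(4) and rb = assms(5) and conj = assms(6)
  note u = unit_closed and rrb = tob_closed[OF r rb] and rbr = tob_closed[OF rb r]
  interpret S1: hilbert_isometry "F \<rho>b \<otimes>\<^sub>H F \<rho>" "F (\<rho>b \<boxtimes>\<^bsub>T\<^esub> \<rho>)" "S \<rho>b \<rho>" by (rule S_hilbert_isometry[OF rb r])
  interpret S2: hilbert_isometry "F \<rho> \<otimes>\<^sub>H F \<rho>b" "F (\<rho> \<boxtimes>\<^bsub>T\<^esub> \<rho>b)" "S \<rho> \<rho>b" by (rule S_hilbert_isometry[OF r rb])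
  have R: "R \<in> Hom T (Unit T) (\<rho>b \<boxtimes>\<^bsub>T\<^esub> \<rho>)" and Rb: "Rb \<in> Hom T (Unit T) (\<rho> \<boxtimes>\<^bsub>T\<^esub> \<rho>b)"
    using conj by (simp_all add: conjugate_by_def)
  have FR: "FA R \<Omega> \<in> hcarrier (F (\<rho>b \<boxtimes>\<^bsub>T\<^esub> \<rho>))" by (rule hmaps_closed[OF maps[OF u rbr R] unit_vector(1)])
  have FRb: "FA Rb \<Omega> \<in> hcarrier (F (\<rho> \<boxtimes>\<^bsub>T\<^esub> \<rho>b))" by (rule hmaps_closed[OF maps[OF u rrb Rb] unit_vector(1)])
  let ?p = "hnorm (F \<rho>b \<otimes>\<^sub>H F \<rho>) Rhat" and ?q = "hnorm (F \<rho> \<otimes>\<^sub>H F \<rho>b) Rbhat"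
  let ?imR = "FA R \<Omega> \<in> S \<rho>b \<rho> ` hcarrier (F \<rho>b \<otimes>\<^sub>H F \<rho>)"
  let ?imRb = "FA Rb \<Omega> \<in> S \<rho> \<rho>b ` hcarrier (F \<rho> \<otimes>\<^sub>H F \<rho>b)"
  have p: "?p \<le> Norm T R" "?p = Norm T R \<longleftrightarrow> ?imR" "0 \<le> ?p"
    using S1.norm_adj_le[OF FR] S1.norm_adj_eq_iff[OF FR] S1.H.norm_nonneg[OF S1.A_adj_closed[OF FR]]
    unfolding Rhat_def hat_def norm_FA_unit[OF irr rbr R] by blast+
  have q: "?q \<le> Norm T Rb" "?q = Norm T Rb \<longleftrightarrow> ?imRb" "0 \<le> ?q"
    using S2.norm_adj_le[OF FRb] S2.norm_adj_eq_iff[OF FRb] S2.H.norm_nonneg[OF S2.A_adj_closed[OF FRb]]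
    unfolding Rbhat_def hat_def norm_FA_unit[OF irr rrb Rb] by blast+
  have le: "dhat \<le> d" unfolding dhat_def d_def by (intro mult_mono p q) (use p q in linarith)
  have "dhat = d \<longleftrightarrow> ?imR \<and> ?imRb"
  proof
    assume "?imR \<and> ?imRb"
    then show "dhat = d" using p(2) q(2) by (simp add: dhat_def d_def)
  next
    assume eq: "dhat = d"
    \<comment> \<open>Equality of the products forces equality of the factors only when both bounds
      are positive. If one of them is 0, both vectors are zero, hence images of 0 under the
      isometries.\<close>
    show "?imR \<and> ?imRb"
    proof (cases "Norm T R = 0 \<or> Norm T Rb = 0")
      case True
      then have "FA R \<Omega> = S \<rho>b \<rho> (hzero (F \<rho>b \<otimes>\<^sub>H F \<rho>))" "FA Rb \<Omega> = S \<rho> \<rho>b (hzero (F \<rho> \<otimes>\<^sub>H F \<rho>b))"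
        using conjugate_zero[OF r rb conj]
          hmaps_zero[OF S1.H.pre_hilbert_space_axioms S1.K.pre_hilbert_space_axioms S1.A_hmaps]
          hmaps_zero[OF S2.H.pre_hilbert_space_axioms S2.K.pre_hilbert_space_axioms S2.A_hmaps] by simp_all
      then show ?thesis using S1.H.zero_closed S2.H.zero_closed by blast
    next
      case False
      then have pos: "0 < Norm T R" "0 < Norm T Rb" using p q by linarith+
      have "\<not> ?p < Norm T R"
        using mult_strict_right_mono[OF _ pos(2), of ?p "Norm T R"] mult_left_mono[OF q(1) p(3)] eq
        by (auto simp: dhat_def d_def)
      moreover have "\<not> ?q < Norm T Rb"
        using mult_strict_left_mono[OF _ pos(1), of ?q "Norm T Rb"] mult_right_mono[OF p(1) q(3)] eq
        by (auto simp: dhat_def d_def)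
      ultimately show ?thesis using p q by linarith
    qed
  qed
  moreover have "ereal_of_enat (hdim (F \<rho>)) \<le> ereal dhat"
    unfolding dhat_def Rhat_def Rbhat_def by (rule hdim_le_hat[OF r rb conj])
  ultimately show ?thesis using le by blast
qed

end
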